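(* There exists a singular Levi-flat hypersurface $H \subset \mathbb{P}^2$ that is a semialgebraic set, but is not real-algebraic. That is, there exists a real-algebraic Levi-flat subvariety of codimension $1$ in $\mathbb{P}^2$ that is irreducible as a real-algebraic subvariety, but reducible as a real-analytic subvariety into two components of codimension $1$.
   Context: $\mathbb{P}^2$ is the complex projective plane; codimension means real codimension. A real-analytic subvariety of $\mathbb{P}^2$ is a closed subset which near every point of $\mathbb{P}^2$ is the common zero set of a family of real-analytic functions. A singular Levi-flat hypersurface is a real-analytic subvariety $H \subset \mathbb{P}^2$ of real codimension one (real dimension 3), possibly with singularities, that is Levi-flat: letting $H^*$ be the set of points of $H$ near which $H$ is a real-analytic submanifold of dimension 3, near every point of $H^*$ there are local holomorphic coordinates $\zeta$ in which $H^*$ is given by $\operatorname{Im}\zeta_1=0$. A real-analytic subvariety of $\mathbb{P}^2$ is (real-)algebraic if it is the zero set of a bihomogeneous polynomial $\rho(z,\bar z)$ in homogeneous coordinates $z = (z_0,z_1,z_2)$, i.e. a polynomial with $\rho(\lambda z,\overline{\lambda z}) = |\lambda|^{2k}\rho(z,\bar z)$ for all $\lambda\in\mathbb{C}$, for some integer $k$. A set is semialgebraic if it is defined by a finite set of real algebraic equalities and inequalities. A real-algebraic (respectively real-analytic) subvariety is irreducible if it is not the union of two proper real-algebraic (respectively real-analytic) subvarieties of itself, and reducible otherwise. *)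

theory Defs
  imports "HOL-Analysis.Analysis"
begin

subsection \<open>The complex projective plane\<close>

definition proj_rel :: "complex^3 \<Rightarrow> complex^3 \<Rightarrow> bool" where
  "proj_rel z w \<longleftrightarrow> z \<noteq> 0 \<and> w \<noteq> 0 \<and> (\<exists>c. c \<noteq> 0 \<and> w = c *s z)"

quotient_type projective_plane = "complex^3" / partial: proj_rel
proof (rule part_equivpI)
  have "proj_rel 1 1"
    by (auto simp: proj_rel_def vec_eq_iff intro!: exI[of _ 1])
  then show "\<exists>z. proj_rel z z" ..
  show "symp proj_rel"
  proof (rule sympI)
    fix z w assume "proj_rel z w"
    then obtain c where "z \<noteq> 0" "w \<noteq> 0" "c \<noteq> 0" "w = c *s z"
      by (auto simp: proj_rel_def)
    then show "proj_rel w z"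
      unfolding proj_rel_def by (intro conjI exI[of _ "inverse c"]) (auto simp: vec_eq_iff)
  qed
  show "transp proj_rel"
  proof (rule transpI)
    fix x y z assume "proj_rel x y" "proj_rel y z"
    then obtain c d where "x \<noteq> 0" "z \<noteq> 0" "c \<noteq> 0" "d \<noteq> 0" "y = c *s x" "z = d *s y"
      by (auto simp: proj_rel_def)
    then show "proj_rel x z"
      unfolding proj_rel_def by (intro conjI exI[of _ "d * c"]) (auto simp: vec_eq_iff)
  qed
qed

text \<open>The point with homogeneous coordinates \<open>z\<close>; only meaningful for \<open>z \<noteq> 0\<close>.\<close>

definition hpoint :: "complex^3 \<Rightarrow> projective_plane" where
  "hpoint z = abs_projective_plane z"

instantiation projective_plane :: topological_space
begin

text \<open>The quotient topology; \<open>{z. z \<noteq> 0}\<close> is open, so openness may be tested in \<open>complex^3\<close>.\<close>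

definition open_projective_plane :: "projective_plane set \<Rightarrow> bool" where
  "open_projective_plane U \<longleftrightarrow> open {z. z \<noteq> 0 \<and> hpoint z \<in> U}"

instance
proof
  have "{z :: complex^3. z \<noteq> 0} = - {0}" by auto
  then show "open (UNIV :: projective_plane set)"
    by (simp add: open_projective_plane_def open_Compl)
next
  fix S T :: "projective_plane set"
  assume "open S" "open T"
  moreover have "{z. z \<noteq> 0 \<and> hpoint z \<in> S \<inter> T} =
      {z. z \<noteq> 0 \<and> hpoint z \<in> S} \<inter> {z. z \<noteq> 0 \<and> hpoint z \<in> T}" by auto
  ultimately show "open (S \<inter> T)"
    by (simp only: open_projective_plane_def open_Int)
next
  fix K :: "projective_plane set set"
  assume K: "\<forall>S\<in>K. open S"
  have "{z. z \<noteq> 0 \<and> hpoint z \<in> \<Union>K} = (\<Union>S\<in>K. {z. z \<noteq> 0 \<and> hpoint z \<in> S})" by auto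
  with K show "open (\<Union>K)"
    unfolding open_projective_plane_def by (simp only: open_UN)
qed

end

text \<open>The three standard affine parametrisations; their images are open and cover the plane.\<close>

definition affine_charts :: "(complex^2 \<Rightarrow> projective_plane) set" where
  "affine_charts =
     {\<lambda>w. hpoint (vector [1, w$1, w$2]),
      \<lambda>w. hpoint (vector [w$1, 1, w$2]),
      \<lambda>w. hpoint (vector [w$1, w$2, 1])}"


subsection \<open>Real-analytic sets in Euclidean space\<close>

text \<open>\<open>f\<close> is given near \<open>p\<close> by a convergent power series in the real coordinates; the
  multi-indices are the functions \<open>Basis \<rightarrow> nat\<close>.\<close>

definition real_analytic_at :: "('a::euclidean_space \<Rightarrow> real) \<Rightarrow> 'a \<Rightarrow> bool" where
  "real_analytic_at f p \<longleftrightarrow>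
     (\<exists>r>0. \<exists>c :: ('a \<Rightarrow> nat) \<Rightarrow> real. \<forall>x\<in>ball p r.
        ((\<lambda>\<alpha>. c \<alpha> * (\<Prod>b\<in>Basis. ((x - p) \<bullet> b) ^ \<alpha> b)) has_sum f x)
          (Basis \<rightarrow>\<^sub>E (UNIV :: nat set)))"

definition real_analytic_on :: "('a::euclidean_space \<Rightarrow> real) \<Rightarrow> 'a set \<Rightarrow> bool" where
  "real_analytic_on f U \<longleftrightarrow> (\<forall>p\<in>U. real_analytic_at f p)"

definition analytic_set_near :: "'a::euclidean_space set \<Rightarrow> 'a \<Rightarrow> bool" where
  "analytic_set_near X p \<longleftrightarrow>
     (\<exists>U F. open U \<and> p \<in> U \<and> (\<forall>f\<in>F. real_analytic_on f U) \<and>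
        X \<inter> U = {x \<in> U. \<forall>f\<in>F. f x = 0})"

text \<open>A real-analytic submanifold of dimension \<open>d\<close> near \<open>p \<in> X\<close>: the zero set of
  \<open>DIM('a) - d\<close> real-analytic functions whose gradients at \<open>p\<close> are linearly independent.\<close>

definition analytic_submanifold_near :: "nat \<Rightarrow> 'a::euclidean_space set \<Rightarrow> 'a \<Rightarrow> bool" where
  "analytic_submanifold_near d X p \<longleftrightarrow> p \<in> X \<and>
     (\<exists>n U g v. n + d = DIM('a) \<and> open U \<and> p \<in> U \<and>
        (\<forall>i<n. real_analytic_on (g i) U \<and> (g i has_derivative (\<lambda>h. h \<bullet> v i)) (at p)) \<and>
        inj_on v {..<n} \<and> independent (v ` {..<n}) \<and>
        X \<inter> U = {x \<in> U. \<forall>i<n. g i x = 0})"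

definition holomorphic_map_on :: "(complex^'n \<Rightarrow> complex^'m) \<Rightarrow> (complex^'n) set \<Rightarrow> bool" where
  "holomorphic_map_on f U \<longleftrightarrow>
     (\<forall>x\<in>U. \<exists>D. (f has_derivative D) (at x) \<and> (\<forall>c v. D (c *s v) = c *s D v))"

definition holomorphic_coordinates :: "(complex^'n \<Rightarrow> complex^'n) \<Rightarrow> (complex^'n) set \<Rightarrow> bool" where
  "holomorphic_coordinates \<zeta> U \<longleftrightarrow>
     open U \<and> open (\<zeta> ` U) \<and> inj_on \<zeta> U \<and>
     holomorphic_map_on \<zeta> U \<and> holomorphic_map_on (inv_into U \<zeta>) (\<zeta> ` U)"

text \<open>A finite union of sets, each cut out by finitely many polynomial equations and strict
  inequalities; this is closed under Boolean operations.\<close>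

definition semialgebraic_set :: "'a::euclidean_space set \<Rightarrow> bool" where
  "semialgebraic_set S \<longleftrightarrow>
     (\<exists>\<F> :: (('a \<Rightarrow> real) set \<times> ('a \<Rightarrow> real) set) set. finite \<F> \<and>
        (\<forall>(P, Q)\<in>\<F>. finite P \<and> finite Q \<and> (\<forall>f \<in> P \<union> Q. real_polynomial_function f)) \<and>
        S = (\<Union>(P, Q)\<in>\<F>. {x. (\<forall>f\<in>P. f x = 0) \<and> (\<forall>f\<in>Q. f x > 0)}))"


subsection \<open>Subvarieties of the projective plane\<close>

text \<open>As the affine charts cover the plane, local conditions are imposed at every point of every
  chart.\<close>

definition real_analytic_subvariety :: "projective_plane set \<Rightarrow> bool" where
  "real_analytic_subvariety H \<longleftrightarrow> closed H \<and>
     (\<forall>\<phi>\<in>affine_charts. \<forall>w. analytic_set_near (\<phi> -` H) w)"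

text \<open>The dimension is the largest \<open>d\<close> such that the set is a \<open>d\<close>-dimensional real-analytic
  submanifold near one of its points.\<close>

definition has_real_dimension :: "projective_plane set \<Rightarrow> nat \<Rightarrow> bool" where
  "has_real_dimension H d \<longleftrightarrow>
     (\<exists>\<phi>\<in>affine_charts. \<exists>w. analytic_submanifold_near d (\<phi> -` H) w) \<and>
     (\<forall>d'>d. \<forall>\<phi>\<in>affine_charts. \<forall>w. \<not> analytic_submanifold_near d' (\<phi> -` H) w)"

definition has_real_codimension :: "projective_plane set \<Rightarrow> nat \<Rightarrow> bool" where
  "has_real_codimension H k \<longleftrightarrow> (\<exists>d. d + k = 4 \<and> has_real_dimension H d)"

text \<open>The set \<open>H\<^sup>*\<close>, for a subset of an affine chart.\<close>

definition regular_points :: "(complex^2) set \<Rightarrow> (complex^2) set" where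
  "regular_points X = {p. analytic_submanifold_near 3 X p}"

definition levi_flat :: "projective_plane set \<Rightarrow> bool" where
  "levi_flat H \<longleftrightarrow>
     (\<forall>\<phi>\<in>affine_charts. \<forall>p \<in> regular_points (\<phi> -` H).
        \<exists>U \<zeta>. p \<in> U \<and> holomorphic_coordinates \<zeta> U \<and>
          regular_points (\<phi> -` H) \<inter> U = {x \<in> U. Im (\<zeta> x $ 1) = 0})"

definition singular_levi_flat_hypersurface :: "projective_plane set \<Rightarrow> bool" where
  "singular_levi_flat_hypersurface H \<longleftrightarrow>
     real_analytic_subvariety H \<and> has_real_codimension H 1 \<and> levi_flat H"

definition semialgebraic :: "projective_plane set \<Rightarrow> bool" where
  "semialgebraic H \<longleftrightarrow> (\<forall>\<phi>\<in>affine_charts. semialgebraic_set (\<phi> -` H))"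

text \<open>The function \<open>z \<mapsto> \<rho>(z, cnj z)\<close> for the polynomial \<open>\<rho>\<close> with coefficient \<open>c (\<alpha>, \<beta>)\<close> at the
  monomial with exponents \<open>\<alpha>\<close> in \<open>z\<close> and \<open>\<beta>\<close> in \<open>cnj z\<close>.\<close>

definition mixed_polynomial ::
    "((3 \<Rightarrow> nat) \<times> (3 \<Rightarrow> nat)) set \<Rightarrow> ((3 \<Rightarrow> nat) \<times> (3 \<Rightarrow> nat) \<Rightarrow> complex) \<Rightarrow> complex^3 \<Rightarrow> complex"
  where
  "mixed_polynomial A c z =
     (\<Sum>(\<alpha>, \<beta>)\<in>A. c (\<alpha>, \<beta>) * (\<Prod>j\<in>UNIV. (z $ j) ^ \<alpha> j) * (\<Prod>j\<in>UNIV. (cnj (z $ j)) ^ \<beta> j))"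

definition bihomogeneous_polynomial :: "(complex^3 \<Rightarrow> complex) \<Rightarrow> bool" where
  "bihomogeneous_polynomial \<rho> \<longleftrightarrow>
     (\<exists>A c. finite A \<and> \<rho> = mixed_polynomial A c) \<and>
     (\<exists>k::nat. \<forall>l z. \<rho> (l *s z) = of_real (cmod l ^ (2 * k)) * \<rho> z)"

definition real_algebraic :: "projective_plane set \<Rightarrow> bool" where
  "real_algebraic H \<longleftrightarrow>
     (\<exists>\<rho>. bihomogeneous_polynomial \<rho> \<and> H = hpoint ` {z. z \<noteq> 0 \<and> \<rho> z = 0})"

text \<open>Irreducibility with respect to a given class \<open>V\<close> of subvarieties.\<close>

definition irreducible_among :: "(projective_plane set \<Rightarrow> bool) \<Rightarrow> projective_plane set \<Rightarrow> bool" where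
  "irreducible_among V X \<longleftrightarrow>
     V X \<and> \<not> (\<exists>Y Z. V Y \<and> V Z \<and> Y \<subset> X \<and> Z \<subset> X \<and> X = Y \<union> Z)"

end

theory Submission
  imports Defs "HOL-Complex_Analysis.Cauchy_Integral_Formula"
begin

text \<open>
  The construction takes place in the dual plane.  A point \<open>z = x + \<i> y\<close> that is not a complex
  multiple of a real vector lies on exactly one complex line with real coefficients, namely the
  line with coefficient vector \<open>x \<times> y\<close>.  Hence, for a curve in the real dual plane,
  the union of the complex lines that it parametrises, together with all real points, is cut out by
  the equation of the curve applied to \<open>x \<times> y\<close>.  This set is foliated by complex
  lines, hence Levi-flat, and it is real-algebraic if the curve is.

  The curve used here is the smooth cubic \<open>b\<^sup>2 c = a\<^sup>3 - a c\<^sup>2\<close>, that is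
  \<open>y\<^sup>2 = x\<^sup>3 - x\<close>.  Its real locus has two components, an oval and a branch through the point
  at infinity, and a quadratic form, the separator, is negative on the first and positive on the
  second.  The set \<open>web J\<close> consists of the real points and of the leaves over the components
  whose sign lies in \<open>J\<close>; so \<open>web {-1, 1}\<close> is real-algebraic, and \<open>web {-1}\<close> and
  \<open>web {1}\<close> are its two pieces.

  Each piece is analytic.  Away from the real points the sign of the separator is locally constant
  on the web.  Near a real point write the chart coordinate as \<open>u + \<i> v\<close>: the equation is a
  binary cubic form in \<open>v\<close> whose coefficients are polynomials in \<open>u\<close>, and its real roots are the
  leaves through \<open>u\<close>.  At the centre, either all real roots belong to one component, or one
  component has a single simple root and the other one has the two remaining roots.  A simple root
  depends analytically on the coefficients (\<open>real_analytic_simple_root\<close>), so in the second case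
  the cubic form factors analytically, and each factor cuts out one piece.

  Each piece is irreducible.  Pairs of a leaf and a point on it form a connected analytic manifold,
  so by the identity theorem a subvariety that contains an open set of such pairs contains all
  leaves; and it contains the real points by a second use of the identity theorem, as the
  leaves cover an open set of real points (\<open>web_indecomposable\<close>).

  The web is irreducible as an algebraic set, and the pieces are not algebraic.  On the lines with
  coefficients \<open>(x, y, 1)\<close>, a polynomial reduces modulo the cubic to \<open>A(x) + y B(x)\<close>.  The
  symmetry of the cubic in \<open>y\<close> shows that if this vanishes over an interval of values \<open>x\<close>, on both
  branches of the curve, then \<open>A = B = 0\<close>; so what vanishes on one piece vanishes on the other
  (\<open>algebraic_contains_both\<close>).

  The web is Levi-flat.  At a regular point exactly one leaf passes, and it moves with nonzero
  speed (\<open>regular_leaf\<close>): two leaves through one point span the tangent space, which forces the gradient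
  of a defining function to vanish.  The complexified parameter of the leaf is then a
  holomorphic coordinate which is real exactly on the web (\<open>leaf_coordinates\<close>).
\<close>

section \<open>Weighted norms of power series\<close>

text \<open>
  Multi-indices, in the form in which they index the power series of \<open>real_analytic_at\<close>.
\<close>

definition mindices :: "('a::euclidean_space \<Rightarrow> nat) set" where
  "mindices = Basis \<rightarrow>\<^sub>E UNIV"

definition mdegree :: "('a::euclidean_space \<Rightarrow> nat) \<Rightarrow> nat" where
  "mdegree \<alpha> = (\<Sum>b\<in>Basis. \<alpha> b)"

definition mono_at :: "'a::euclidean_space \<Rightarrow> ('a \<Rightarrow> nat) \<Rightarrow> 'a \<Rightarrow> real" where
  "mono_at p \<alpha> x = (\<Prod>b\<in>Basis. ((x - p) \<bullet> b) ^ \<alpha> b)"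

definition polybox :: "'a::euclidean_space \<Rightarrow> real \<Rightarrow> 'a set" where
  "polybox p r = {x. \<forall>b\<in>Basis. \<bar>(x - p) \<bullet> b\<bar> \<le> r}"

text \<open>
  The weighted \<open>\<ell>\<^sup>1\<close> norm, of radius \<open>r\<close>, of the Taylor coefficients of \<open>f\<close> at \<open>p\<close> is at most
  \<open>M\<close>.  Functions with finite norm form a Banach algebra, which is why products, infinite series and
  fixed points of analytic functions are analytic.  On a polybox rather than a ball the bound
  \<open>abs_mono_at_le\<close> for monomials is multiplicative.
\<close>

definition psnorm_le :: "'a::euclidean_space \<Rightarrow> real \<Rightarrow> real \<Rightarrow> ('a \<Rightarrow> real) \<Rightarrow> bool" where
  "psnorm_le p r M f \<longleftrightarrow> r > 0 \<and> (\<exists>c. (\<lambda>\<alpha>. \<bar>c \<alpha>\<bar> * r ^ mdegree \<alpha>) summable_on mindices \<and>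
      (\<Sum>\<^sub>\<infinity>\<alpha>\<in>mindices. \<bar>c \<alpha>\<bar> * r ^ mdegree \<alpha>) \<le> M \<and>
      (\<forall>x\<in>polybox p r. ((\<lambda>\<alpha>. c \<alpha> * mono_at p \<alpha> x) has_sum f x) mindices))"

lemma summable_on_le:
  fixes f g :: "'i \<Rightarrow> real"
  assumes "(g has_sum S) A" "\<And>x. x \<in> A \<Longrightarrow> 0 \<le> f x" "\<And>x. x \<in> A \<Longrightarrow> f x \<le> g x"
  shows "f summable_on A"
  by (rule summable_on_comparison_test[OF has_sum_imp_summable[OF assms(1)] assms(3,2)])

lemma summable_on_abs_le:
  fixes f g :: "'i \<Rightarrow> real"
  assumes "(g has_sum S) A" "\<And>x. x \<in> A \<Longrightarrow> \<bar>f x\<bar> \<le> g x"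
  shows "f summable_on A"
proof -
  have "(\<lambda>x. norm (f x)) summable_on A"
    by (rule summable_on_le[OF assms(1)]) (use assms(2) in auto)
  then show ?thesis by (subst summable_on_iff_abs_summable_on_real)
qed

lemma abs_mono_at_le:
  assumes "x \<in> polybox p r"
  shows "\<bar>mono_at p \<alpha> x\<bar> \<le> r ^ mdegree \<alpha>"
proof -
  have "\<bar>mono_at p \<alpha> x\<bar> = (\<Prod>b\<in>Basis. \<bar>(x - p) \<bullet> b\<bar> ^ \<alpha> b)"
    by (simp add: mono_at_def abs_prod power_abs)
  also have "\<dots> \<le> (\<Prod>b\<in>Basis. r ^ \<alpha> b)"
    using assms by (intro prod_mono) (auto simp: polybox_def intro!: power_mono)
  finally show ?thesis by (simp add: mdegree_def power_sum)
qed

text \<open>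
  Collecting equal exponents turns a series of monomials over an arbitrary index set into a power
  series without increasing the norm.  Closure of the analytic functions under products, series and
  substitution all reduces to this.
\<close>

lemma psnorm_reindex:
  fixes k :: "'i \<Rightarrow> real" and e :: "'i \<Rightarrow> ('a::euclidean_space \<Rightarrow> nat)"
  assumes r: "r > 0" and e: "e \<in> I \<rightarrow> mindices"
    and S: "((\<lambda>i. \<bar>k i\<bar> * r ^ mdegree (e i)) has_sum S) I" "S \<le> M"
    and f: "\<And>x. x \<in> polybox p r \<Longrightarrow> ((\<lambda>i. k i * mono_at p (e i) x) has_sum f x) I"
  shows "psnorm_le p r M f"
proof -
  define Fib where "Fib \<gamma> = {i \<in> I. e i = \<gamma>}" for \<gamma>
  define c where "c \<gamma> = infsum k (Fib \<gamma>)" for \<gamma>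
  define d where "d \<gamma> = infsum (\<lambda>i. \<bar>k i\<bar>) (Fib \<gamma>)" for \<gamma>
  have bij: "bij_betw snd (Sigma mindices Fib) I"
    unfolding bij_betw_def
  proof
    show "inj_on snd (Sigma mindices Fib)" by (auto simp: inj_on_def Fib_def)
    show "snd ` Sigma mindices Fib = I"
      using e by (force simp: Fib_def)
  qed
  have ks: "(\<lambda>i. \<bar>k i\<bar>) summable_on Fib \<gamma>" for \<gamma>
  proof -
    have "(\<lambda>i. \<bar>k i\<bar> * r ^ mdegree (e i)) summable_on Fib \<gamma>"
      by (rule summable_on_subset_banach[OF has_sum_imp_summable[OF S(1)]]) (auto simp: Fib_def)
    then have "(\<lambda>i. \<bar>k i\<bar> * r ^ mdegree \<gamma>) summable_on Fib \<gamma>"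
      by (rule summable_on_cong[THEN iffD1, rotated]) (simp add: Fib_def)
    then show ?thesis using r by (simp add: summable_on_cmult_left')
  qed
  then have ks': "k summable_on Fib \<gamma>" for \<gamma>
    using summable_on_iff_abs_summable_on_real by force
  have sd: "((\<lambda>\<gamma>. d \<gamma> * r ^ mdegree \<gamma>) has_sum S) mindices"
  proof (rule has_sum_SigmaD)
    show "((\<lambda>x. \<bar>k (snd x)\<bar> * r ^ mdegree (e (snd x))) has_sum S) (Sigma mindices Fib)"
      using has_sum_reindex_bij_betw[OF bij, of "\<lambda>i. \<bar>k i\<bar> * r ^ mdegree (e i)"] S(1) by simp
    show "((\<lambda>y. \<bar>k (snd (\<gamma>, y))\<bar> * r ^ mdegree (e (snd (\<gamma>, y)))) has_sum d \<gamma> * r ^ mdegree \<gamma>) (Fib \<gamma>)"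
      for \<gamma>
    proof -
      have "((\<lambda>y. \<bar>k y\<bar> * r ^ mdegree \<gamma>) has_sum d \<gamma> * r ^ mdegree \<gamma>) (Fib \<gamma>)"
        unfolding d_def using ks by (intro has_sum_cmult_left) auto
      then show ?thesis by (rule has_sum_cong[THEN iffD1, rotated]) (simp add: Fib_def)
    qed
  qed
  have cd: "\<bar>c \<gamma>\<bar> \<le> d \<gamma>" for \<gamma>
    using norm_infsum_bound[of k "Fib \<gamma>"] ks[of \<gamma>] by (simp add: c_def d_def)
  have cd': "\<bar>c \<gamma>\<bar> * r ^ mdegree \<gamma> \<le> d \<gamma> * r ^ mdegree \<gamma>" for \<gamma>
    using cd r by (intro mult_right_mono) auto
  have sc: "(\<lambda>\<gamma>. \<bar>c \<gamma>\<bar> * r ^ mdegree \<gamma>) summable_on mindices"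
    by (rule summable_on_le[OF sd _ cd']) (use r in simp)
  have "(\<Sum>\<^sub>\<infinity>\<gamma>\<in>mindices. \<bar>c \<gamma>\<bar> * r ^ mdegree \<gamma>) \<le> S"
    using infsum_mono[OF sc has_sum_imp_summable[OF sd] cd'] infsumI[OF sd] by simp
  moreover have "((\<lambda>\<gamma>. c \<gamma> * mono_at p \<gamma> x) has_sum f x) mindices" if "x \<in> polybox p r" for x
  proof (rule has_sum_SigmaD)
    show "((\<lambda>y. k (snd y) * mono_at p (e (snd y)) x) has_sum f x) (Sigma mindices Fib)"
      using has_sum_reindex_bij_betw[OF bij, of "\<lambda>i. k i * mono_at p (e i) x"] f[OF that] by simp
    show "((\<lambda>y. k (snd (\<gamma>, y)) * mono_at p (e (snd (\<gamma>, y))) x) has_sum c \<gamma> * mono_at p \<gamma> x) (Fib \<gamma>)"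
      for \<gamma>
    proof -
      have "((\<lambda>y. k y * mono_at p \<gamma> x) has_sum c \<gamma> * mono_at p \<gamma> x) (Fib \<gamma>)"
        unfolding c_def using ks' by (intro has_sum_cmult_left) auto
      then show ?thesis by (rule has_sum_cong[THEN iffD1, rotated]) (simp add: Fib_def)
    qed
  qed
  ultimately show ?thesis
    unfolding psnorm_le_def using r sc S(2) by (intro conjI exI[of _ c]) auto
qed

lemma psnormE:
  assumes "psnorm_le p r M f"
  obtains c S where "r > 0" "((\<lambda>\<alpha>. \<bar>c \<alpha>\<bar> * r ^ mdegree \<alpha>) has_sum S) mindices" "S \<le> M" "0 \<le> S"
    "\<And>x. x \<in> polybox p r \<Longrightarrow> ((\<lambda>\<alpha>. c \<alpha> * mono_at p \<alpha> x) has_sum f x) mindices"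
proof -
  from assms obtain c where c: "r > 0" "(\<lambda>\<alpha>. \<bar>c \<alpha>\<bar> * r ^ mdegree \<alpha>) summable_on mindices"
      "(\<Sum>\<^sub>\<infinity>\<alpha>\<in>mindices. \<bar>c \<alpha>\<bar> * r ^ mdegree \<alpha>) \<le> M"
      "\<forall>x\<in>polybox p r. ((\<lambda>\<alpha>. c \<alpha> * mono_at p \<alpha> x) has_sum f x) mindices"
    unfolding psnorm_le_def by blast
  show ?thesis
  proof (rule that[of c "\<Sum>\<^sub>\<infinity>\<alpha>\<in>mindices. \<bar>c \<alpha>\<bar> * r ^ mdegree \<alpha>"])
    show "0 \<le> (\<Sum>\<^sub>\<infinity>\<alpha>\<in>mindices. \<bar>c \<alpha>\<bar> * r ^ mdegree \<alpha>)"
      using c(1) by (intro infsum_nonneg) auto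
  qed (use c in auto)
qed

lemma psnormI:
  assumes "r > 0" "((\<lambda>\<alpha>. \<bar>c \<alpha>\<bar> * r ^ mdegree \<alpha>) has_sum S) mindices" "S \<le> M"
    "\<And>x. x \<in> polybox p r \<Longrightarrow> ((\<lambda>\<alpha>. c \<alpha> * mono_at p \<alpha> x) has_sum f x) mindices"
  shows "psnorm_le p r M f"
  by (rule psnorm_reindex[where e = "\<lambda>i. i", OF assms(1) _ assms(2,3)]) (use assms in auto)

lemma psnorm_bound:
  assumes "psnorm_le p r M f" "x \<in> polybox p r"
  shows "\<bar>f x\<bar> \<le> M"
proof -
  obtain c S where c: "r > 0" "((\<lambda>\<alpha>. \<bar>c \<alpha>\<bar> * r ^ mdegree \<alpha>) has_sum S) mindices" "S \<le> M"
    "\<And>x. x \<in> polybox p r \<Longrightarrow> ((\<lambda>\<alpha>. c \<alpha> * mono_at p \<alpha> x) has_sum f x) mindices"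
    using assms(1) by (rule psnormE) blast
  have le: "c \<alpha> * mono_at p \<alpha> x \<le> \<bar>c \<alpha>\<bar> * r ^ mdegree \<alpha>" "- (\<bar>c \<alpha>\<bar> * r ^ mdegree \<alpha>) \<le> c \<alpha> * mono_at p \<alpha> x" for \<alpha>
  proof -
    have "\<bar>c \<alpha> * mono_at p \<alpha> x\<bar> \<le> \<bar>c \<alpha>\<bar> * r ^ mdegree \<alpha>"
      using abs_mono_at_le[OF assms(2)] by (simp add: abs_mult mult_left_mono)
    then show "c \<alpha> * mono_at p \<alpha> x \<le> \<bar>c \<alpha>\<bar> * r ^ mdegree \<alpha>" "- (\<bar>c \<alpha>\<bar> * r ^ mdegree \<alpha>) \<le> c \<alpha> * mono_at p \<alpha> x"
      by linarith+
  qed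
  have "f x \<le> S" using has_sum_mono[OF c(4)[OF assms(2)] c(2)] le by blast
  moreover have "- S \<le> f x"
    using has_sum_mono[OF has_sum_uminusI[OF c(2)] c(4)[OF assms(2)]] le by blast
  ultimately show ?thesis using c(3) by linarith
qed

lemma psnorm_nonneg: "psnorm_le p r M f \<Longrightarrow> 0 \<le> M"
  by (erule psnormE) auto

lemma psnorm_pos: "psnorm_le p r M f \<Longrightarrow> r > 0"
  by (simp add: psnorm_le_def)

lemma psnorm_cong:
  assumes "psnorm_le p r M f" "\<And>x. x \<in> polybox p r \<Longrightarrow> f x = g x"
  shows "psnorm_le p r M g"
  using assms unfolding psnorm_le_def by simp

lemma psnorm_mono: "psnorm_le p r M f \<Longrightarrow> M \<le> N \<Longrightarrow> psnorm_le p r N f"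
  unfolding psnorm_le_def by (meson order_trans)

lemma psnorm_const:
  assumes "r > 0" shows "psnorm_le p r \<bar>k\<bar> (\<lambda>_. k)"
proof (rule psnorm_reindex[where I = "{()}" and k = "\<lambda>_. k" and e = "\<lambda>_. (\<lambda>b\<in>Basis. 0)", OF assms])
qed (auto simp: mindices_def mdegree_def mono_at_def has_sum_finite_iff)

lemma psnorm_coord:
  assumes "r > 0" "b \<in> Basis" shows "psnorm_le p r r (\<lambda>x. (x - p) \<bullet> b)"
proof (rule psnorm_reindex[where I = "{()}" and k = "\<lambda>_. 1" and e = "\<lambda>_. (\<lambda>b'\<in>Basis. if b' = b then 1 else 0)", OF assms(1)])
  have *: "mono_at p (\<lambda>b'\<in>Basis. if b' = b then 1 else 0) x = (x - p) \<bullet> b" for x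
  proof -
    have "mono_at p (\<lambda>b'\<in>Basis. if b' = b then 1 else 0) x = (\<Prod>b'\<in>Basis. if b' = b then (x - p) \<bullet> b' else 1)"
      unfolding mono_at_def by (rule prod.cong) auto
    also have "\<dots> = (x - p) \<bullet> b" using assms(2) by (subst prod.delta) auto
    finally show ?thesis .
  qed
  have **: "mdegree (\<lambda>b'\<in>Basis. if b' = b then 1 else 0) = 1"
    using assms(2) by (simp add: mdegree_def)
  show "((\<lambda>i. \<bar>1\<bar> * r ^ mdegree (\<lambda>b'\<in>Basis. if b' = b then 1 else 0)) has_sum r) {()}"
    unfolding ** by (simp add: has_sum_finite_iff)
  show "((\<lambda>i. 1 * mono_at p (\<lambda>b'\<in>Basis. if b' = b then 1 else 0) x) has_sum (x - p) \<bullet> b) {()}" for x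
    unfolding * by (simp add: has_sum_finite_iff)
qed (auto simp: mindices_def)

lemma psnorm_add:
  assumes "psnorm_le p r M f" "psnorm_le p r N g"
  shows "psnorm_le p r (M + N) (\<lambda>x. f x + g x)"
proof -
  obtain c S where c: "r > 0" "((\<lambda>\<alpha>. \<bar>c \<alpha>\<bar> * r ^ mdegree \<alpha>) has_sum S) mindices" "S \<le> M"
    "\<And>x. x \<in> polybox p r \<Longrightarrow> ((\<lambda>\<alpha>. c \<alpha> * mono_at p \<alpha> x) has_sum f x) mindices"
    using assms(1) by (rule psnormE) blast
  obtain d T where d: "((\<lambda>\<alpha>. \<bar>d \<alpha>\<bar> * r ^ mdegree \<alpha>) has_sum T) mindices" "T \<le> N"
    "\<And>x. x \<in> polybox p r \<Longrightarrow> ((\<lambda>\<alpha>. d \<alpha> * mono_at p \<alpha> x) has_sum g x) mindices"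
    using assms(2) by (rule psnormE) blast
  have le: "\<bar>c \<alpha> + d \<alpha>\<bar> * r ^ mdegree \<alpha> \<le> \<bar>c \<alpha>\<bar> * r ^ mdegree \<alpha> + \<bar>d \<alpha>\<bar> * r ^ mdegree \<alpha>" for \<alpha>
    using c(1) by (simp flip: distrib_right add: mult_right_mono)
  have s: "(\<lambda>\<alpha>. \<bar>c \<alpha> + d \<alpha>\<bar> * r ^ mdegree \<alpha>) summable_on mindices"
    by (rule summable_on_le[OF has_sum_add[OF c(2) d(1)] _ le]) (use c(1) in simp)
  show ?thesis
  proof (rule psnormI[OF c(1) has_sum_infsum[OF s]])
    show "(\<Sum>\<^sub>\<infinity>\<alpha>\<in>mindices. \<bar>c \<alpha> + d \<alpha>\<bar> * r ^ mdegree \<alpha>) \<le> M + N"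
      using has_sum_mono[OF has_sum_infsum[OF s] has_sum_add[OF c(2) d(1)] le] c(3) d(2) by linarith
    show "((\<lambda>\<alpha>. (c \<alpha> + d \<alpha>) * mono_at p \<alpha> x) has_sum (f x + g x)) mindices" if "x \<in> polybox p r" for x
      using has_sum_add[OF c(4)[OF that] d(3)[OF that]] by (simp add: distrib_right)
  qed
qed

lemma psnorm_infsum:
  assumes r: "r > 0" and f: "\<And>j. j \<in> J \<Longrightarrow> psnorm_le p r (M j) (f j)" and M: "M summable_on J"
  shows "psnorm_le p r (\<Sum>\<^sub>\<infinity>j\<in>J. M j) (\<lambda>x. \<Sum>\<^sub>\<infinity>j\<in>J. f j x)"
    and "x \<in> polybox p r \<Longrightarrow> (\<lambda>j. f j x) summable_on J"
proof -
  have "\<forall>j\<in>J. \<exists>c. (\<lambda>\<alpha>. \<bar>c \<alpha>\<bar> * r ^ mdegree \<alpha>) summable_on mindices \<and>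
      (\<Sum>\<^sub>\<infinity>\<alpha>\<in>mindices. \<bar>c \<alpha>\<bar> * r ^ mdegree \<alpha>) \<le> M j \<and>
      (\<forall>x\<in>polybox p r. ((\<lambda>\<alpha>. c \<alpha> * mono_at p \<alpha> x) has_sum f j x) mindices)"
    using f unfolding psnorm_le_def by blast
  then obtain c where c': "\<forall>j\<in>J. (\<lambda>\<alpha>. \<bar>c j \<alpha>\<bar> * r ^ mdegree \<alpha>) summable_on mindices \<and>
      (\<Sum>\<^sub>\<infinity>\<alpha>\<in>mindices. \<bar>c j \<alpha>\<bar> * r ^ mdegree \<alpha>) \<le> M j \<and>
      (\<forall>x\<in>polybox p r. ((\<lambda>\<alpha>. c j \<alpha> * mono_at p \<alpha> x) has_sum f j x) mindices)"
    unfolding bchoice_iff by blast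
  define S where "S j = (\<Sum>\<^sub>\<infinity>\<alpha>\<in>mindices. \<bar>c j \<alpha>\<bar> * r ^ mdegree \<alpha>)" for j
  have c: "\<And>j. j \<in> J \<Longrightarrow> ((\<lambda>\<alpha>. \<bar>c j \<alpha>\<bar> * r ^ mdegree \<alpha>) has_sum S j) mindices"
    "\<And>j. j \<in> J \<Longrightarrow> S j \<le> M j" "\<And>j. 0 \<le> S j"
    "\<And>j x. j \<in> J \<Longrightarrow> x \<in> polybox p r \<Longrightarrow> ((\<lambda>\<alpha>. c j \<alpha> * mono_at p \<alpha> x) has_sum f j x) mindices"
    using c' r unfolding S_def by (auto intro!: has_sum_infsum infsum_nonneg)
  have sS: "S summable_on J"
    by (rule summable_on_le[OF has_sum_infsum[OF M] c(3,2)])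
  have sf: "(\<lambda>j. f j x) summable_on J" if "x \<in> polybox p r" for x
  proof -
    show ?thesis
      by (rule summable_on_abs_le[OF has_sum_infsum[OF M]]) (use psnorm_bound[OF f that] in simp)
  qed
  then show "x \<in> polybox p r \<Longrightarrow> (\<lambda>j. f j x) summable_on J" .
  let ?I = "Sigma J (\<lambda>_. mindices)"
  have s: "(\<lambda>i. \<bar>c (fst i) (snd i)\<bar> * r ^ mdegree (snd i)) summable_on ?I"
    by (rule summable_on_SigmaI[OF _ sS]) (use c r in auto)
  show "psnorm_le p r (\<Sum>\<^sub>\<infinity>j\<in>J. M j) (\<lambda>x. \<Sum>\<^sub>\<infinity>j\<in>J. f j x)"
  proof (rule psnorm_reindex[where I = ?I and k = "\<lambda>i. c (fst i) (snd i)" and e = snd, OF r])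
    show "((\<lambda>i. \<bar>c (fst i) (snd i)\<bar> * r ^ mdegree (snd i)) has_sum (\<Sum>\<^sub>\<infinity>j\<in>J. S j)) ?I"
      by (rule has_sum_SigmaI[OF _ has_sum_infsum[OF sS] s]) (use c in auto)
    show "(\<Sum>\<^sub>\<infinity>j\<in>J. S j) \<le> (\<Sum>\<^sub>\<infinity>j\<in>J. M j)"
      using c(2) by (intro infsum_mono sS M) auto
    show "((\<lambda>i. c (fst i) (snd i) * mono_at p (snd i) x) has_sum (\<Sum>\<^sub>\<infinity>j\<in>J. f j x)) ?I"
      if x: "x \<in> polybox p r" for x
    proof (rule has_sum_SigmaI[OF _ has_sum_infsum[OF sf[OF x]]])
      show "(\<lambda>i. c (fst i) (snd i) * mono_at p (snd i) x) summable_on ?I"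
        by (rule summable_on_abs_le[OF has_sum_infsum[OF s]])
          (simp add: abs_mult mult_left_mono abs_mono_at_le[OF x])
    qed (use c x in auto)
  qed auto
qed

lemma psnorm_mult:
  assumes "psnorm_le p r M f" "psnorm_le p r N g"
  shows "psnorm_le p r (M * N) (\<lambda>x. f x * g x)"
proof -
  obtain c S where c: "r > 0" "((\<lambda>\<alpha>. \<bar>c \<alpha>\<bar> * r ^ mdegree \<alpha>) has_sum S) mindices" "S \<le> M" "0 \<le> S"
    "\<And>x. x \<in> polybox p r \<Longrightarrow> ((\<lambda>\<alpha>. c \<alpha> * mono_at p \<alpha> x) has_sum f x) mindices"
    using assms(1) by (rule psnormE) blast
  obtain d T where d: "((\<lambda>\<alpha>. \<bar>d \<alpha>\<bar> * r ^ mdegree \<alpha>) has_sum T) mindices" "T \<le> N" "0 \<le> T"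
    "\<And>x. x \<in> polybox p r \<Longrightarrow> ((\<lambda>\<alpha>. d \<alpha> * mono_at p \<alpha> x) has_sum g x) mindices"
    using assms(2) by (rule psnormE) blast
  define e :: "('a \<Rightarrow> nat) \<times> ('a \<Rightarrow> nat) \<Rightarrow> ('a \<Rightarrow> nat)" where "e i = (\<lambda>b\<in>Basis. fst i b + snd i b)" for i
  have me: "mdegree (e i) = mdegree (fst i) + mdegree (snd i)" for i
    by (simp add: mdegree_def e_def sum.distrib)
  have mo: "mono_at p (e i) x = mono_at p (fst i) x * mono_at p (snd i) x" for i x
    by (simp add: mono_at_def e_def power_add flip: prod.distrib)
  let ?I = "Sigma mindices (\<lambda>_. mindices)"
  have in1: "((\<lambda>\<beta>. \<bar>c \<alpha> * d \<beta>\<bar> * r ^ mdegree (e (\<alpha>, \<beta>))) has_sum (\<bar>c \<alpha>\<bar> * r ^ mdegree \<alpha>) * T) mindices" for \<alpha>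
    using has_sum_cmult_right[OF d(1), of "\<bar>c \<alpha>\<bar> * r ^ mdegree \<alpha>"]
    by (simp add: me abs_mult power_add mult_ac)
  have out1: "((\<lambda>\<alpha>. (\<bar>c \<alpha>\<bar> * r ^ mdegree \<alpha>) * T) has_sum S * T) mindices"
    by (rule has_sum_cmult_left[OF c(2)])
  have s: "(\<lambda>i. \<bar>c (fst i) * d (snd i)\<bar> * r ^ mdegree (e i)) summable_on ?I"
    by (rule summable_on_SigmaI[OF _ has_sum_imp_summable[OF out1]]) (use in1 c(1) in auto)
  show ?thesis
  proof (rule psnorm_reindex[where I = ?I and k = "\<lambda>i. c (fst i) * d (snd i)" and e = e, OF c(1)])
    show "((\<lambda>i. \<bar>c (fst i) * d (snd i)\<bar> * r ^ mdegree (e i)) has_sum (S * T)) ?I"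
      by (rule has_sum_SigmaI[OF _ out1 s]) (use in1 in auto)
    show "S * T \<le> M * N" using c d by (intro mult_mono) auto
    show "((\<lambda>i. c (fst i) * d (snd i) * mono_at p (e i) x) has_sum (f x * g x)) ?I"
      if x: "x \<in> polybox p r" for x
    proof (rule has_sum_SigmaI)
      show "(\<lambda>i. c (fst i) * d (snd i) * mono_at p (e i) x) summable_on ?I"
        by (rule summable_on_abs_le[OF has_sum_infsum[OF s]])
          (simp add: abs_mult mult_left_mono abs_mono_at_le[OF x])
      show "((\<lambda>\<alpha>. (c \<alpha> * mono_at p \<alpha> x) * g x) has_sum (f x * g x)) mindices"
        by (rule has_sum_cmult_left[OF c(5)[OF x]])
      show "((\<lambda>\<beta>. c (fst (\<alpha>, \<beta>)) * d (snd (\<alpha>, \<beta>)) * mono_at p (e (\<alpha>, \<beta>)) x) has_sum c \<alpha> * mono_at p \<alpha> x * g x) mindices" for \<alpha>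
        using has_sum_cmult_right[OF d(4)[OF x], of "c \<alpha> * mono_at p \<alpha> x"]
        by (simp add: mo mult_ac)
    qed
  qed (auto simp: mindices_def e_def)
qed

lemma psnorm_cmult: "psnorm_le p r M f \<Longrightarrow> psnorm_le p r (\<bar>k\<bar> * M) (\<lambda>x. k * f x)"
  using psnorm_mult[OF psnorm_const] psnorm_pos by blast

lemma psnorm_uminus: "psnorm_le p r M f \<Longrightarrow> psnorm_le p r M (\<lambda>x. - f x)"
  using psnorm_cmult[of p r M f "-1"] by simp

lemma psnorm_power:
  assumes "psnorm_le p r M f" shows "psnorm_le p r (M ^ n) (\<lambda>x. f x ^ n)"
proof (induction n)
  case 0
  show ?case using psnorm_const[of r p 1] psnorm_pos[OF assms] by simp
next
  case (Suc n)
  show ?case using psnorm_mult[OF assms Suc] by simp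
qed

lemma psnorm_prod:
  assumes "finite B" "r > 0" "\<And>b. b \<in> B \<Longrightarrow> psnorm_le p r (M b) (f b)"
  shows "psnorm_le p r (\<Prod>b\<in>B. M b) (\<lambda>x. \<Prod>b\<in>B. f b x)"
  using assms
proof (induction B rule: finite_induct)
  case empty
  show ?case using psnorm_const[of r p 1] \<open>r > 0\<close> by simp
next
  case (insert b B)
  then show ?case using psnorm_mult[of p r "M b" "f b"] by simp
qed

lemma polybox_mono: "r' \<le> r \<Longrightarrow> polybox p r' \<subseteq> polybox p r"
  by (force simp: polybox_def)

lemma ball_subset_polybox: "ball p r \<subseteq> polybox p r"
proof
  fix x assume "x \<in> ball p r"
  then have "norm (x - p) < r" by (simp add: dist_norm norm_minus_commute)
  then show "x \<in> polybox p r" using Basis_le_norm[of _ "x - p"] by (force simp: polybox_def)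
qed

lemma polybox_self: "0 \<le> r \<Longrightarrow> p \<in> polybox p r"
  by (simp add: polybox_def)

lemma mdegree_0_iff: "\<alpha> \<in> mindices \<Longrightarrow> mdegree \<alpha> = 0 \<longleftrightarrow> \<alpha> = (\<lambda>b\<in>Basis. 0)"
  unfolding mindices_def mdegree_def by (auto simp: PiE_def extensional_def fun_eq_iff)

lemma mono_at_self:
  "\<alpha> \<in> mindices \<Longrightarrow> mono_at p \<alpha> p = (if \<alpha> = (\<lambda>b\<in>Basis. 0) then 1 else 0)"
  by (subst mdegree_0_iff[symmetric]) (auto simp: mono_at_def mdegree_def prod_zero_iff)

lemma psnorm_shrink:
  assumes "psnorm_le p r M f" "0 < r'" "r' \<le> r"
  shows "psnorm_le p r' M f"
proof -
  obtain c S where c: "r > 0" "((\<lambda>\<alpha>. \<bar>c \<alpha>\<bar> * r ^ mdegree \<alpha>) has_sum S) mindices" "S \<le> M"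
    "\<And>x. x \<in> polybox p r \<Longrightarrow> ((\<lambda>\<alpha>. c \<alpha> * mono_at p \<alpha> x) has_sum f x) mindices"
    using assms(1) by (rule psnormE) blast
  have le: "\<bar>c \<alpha>\<bar> * r' ^ mdegree \<alpha> \<le> \<bar>c \<alpha>\<bar> * r ^ mdegree \<alpha>" for \<alpha>
    using assms by (intro mult_left_mono power_mono) auto
  have s: "(\<lambda>\<alpha>. \<bar>c \<alpha>\<bar> * r' ^ mdegree \<alpha>) summable_on mindices"
    by (rule summable_on_le[OF c(2) _ le]) (use assms in simp)
  show ?thesis
  proof (rule psnormI[OF \<open>0 < r'\<close> has_sum_infsum[OF s]])
    show "(\<Sum>\<^sub>\<infinity>\<alpha>\<in>mindices. \<bar>c \<alpha>\<bar> * r' ^ mdegree \<alpha>) \<le> M"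
      using has_sum_mono[OF has_sum_infsum[OF s] c(2) le] c(3) by linarith
  qed (use c(4) polybox_mono[OF assms(3)] in blast)
qed

text \<open>
  Without constant term, every monomial contains at least one factor that shrinks with the radius.
\<close>

lemma psnorm_shrink0:
  assumes "psnorm_le p r M f" "f p = 0" "0 < r'" "r' \<le> r"
  shows "psnorm_le p r' (M * (r' / r)) f"
proof -
  obtain c S where c: "r > 0" "((\<lambda>\<alpha>. \<bar>c \<alpha>\<bar> * r ^ mdegree \<alpha>) has_sum S) mindices" "S \<le> M"
    "\<And>x. x \<in> polybox p r \<Longrightarrow> ((\<lambda>\<alpha>. c \<alpha> * mono_at p \<alpha> x) has_sum f x) mindices"
    using assms(1) by (rule psnormE) blast
  let ?z = "\<lambda>b\<in>Basis. 0 :: nat"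
  have z: "?z \<in> mindices" by (auto simp: mindices_def)
  have "((\<lambda>\<alpha>. c \<alpha> * mono_at p \<alpha> p) has_sum 0) mindices"
    using c(4)[of p] polybox_self[of r p] c(1) assms(2) by simp
  moreover have "((\<lambda>\<alpha>. c \<alpha> * mono_at p \<alpha> p) has_sum c ?z) mindices"
  proof -
    have "((\<lambda>\<alpha>. c \<alpha> * mono_at p \<alpha> p) has_sum c ?z) {?z}"
      using mono_at_self[OF z, of p] by (simp add: has_sum_finite_iff)
    then show ?thesis
      by (rule has_sum_cong_neutral[THEN iffD1, rotated -1]) (use z in \<open>auto simp: mono_at_self\<close>)
  qed
  ultimately have c0: "c ?z = 0" by (rule has_sum_unique[symmetric])
  have le: "\<bar>c \<alpha>\<bar> * r' ^ mdegree \<alpha> \<le> (\<bar>c \<alpha>\<bar> * r ^ mdegree \<alpha>) * (r' / r)" if "\<alpha> \<in> mindices" for \<alpha>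
  proof (cases "mdegree \<alpha>")
    case 0
    then show ?thesis using c0 mdegree_0_iff[OF that] by simp
  next
    case (Suc n)
    have "r' ^ Suc n \<le> r ^ n * r'"
      using assms by (auto intro!: mult_mono power_mono simp: mult.commute)
    also have "\<dots> = r ^ Suc n * (r' / r)" using c(1) by simp
    finally show ?thesis unfolding Suc mult.assoc by (rule mult_left_mono) simp
  qed
  have hs: "((\<lambda>\<alpha>. (\<bar>c \<alpha>\<bar> * r ^ mdegree \<alpha>) * (r' / r)) has_sum (S * (r' / r))) mindices"
    by (rule has_sum_cmult_left[OF c(2)])
  have s: "(\<lambda>\<alpha>. \<bar>c \<alpha>\<bar> * r' ^ mdegree \<alpha>) summable_on mindices"
    by (rule summable_on_le[OF hs _ le]) (use assms in simp)
  show ?thesis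
  proof (rule psnormI[OF \<open>0 < r'\<close> has_sum_infsum[OF s]])
    have "S * (r' / r) \<le> M * (r' / r)" using c(1,3) assms by (intro mult_right_mono) auto
    then show "(\<Sum>\<^sub>\<infinity>\<alpha>\<in>mindices. \<bar>c \<alpha>\<bar> * r' ^ mdegree \<alpha>) \<le> M * (r' / r)"
      using has_sum_mono[OF has_sum_infsum[OF s] hs le] by linarith
  qed (use c(4) polybox_mono[OF assms(4)] in blast)
qed

text \<open>
  Substitution is an infinite series of products, and the norm of each term is bounded by that
  of the monomial of \<open>f\<close> at radius \<open>R\<close>.
\<close>

lemma psnorm_compose:
  assumes f: "psnorm_le q R K f" and r: "r > 0"
    and \<Psi>: "\<And>b. b \<in> Basis \<Longrightarrow> psnorm_le p r R (\<lambda>x. (\<Psi> x - q) \<bullet> b)"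
  shows "psnorm_le p r K (\<lambda>x. f (\<Psi> x))"
proof -
  obtain c S where c: "R > 0" "((\<lambda>\<alpha>. \<bar>c \<alpha>\<bar> * R ^ mdegree \<alpha>) has_sum S) mindices" "S \<le> K"
    "\<And>x. x \<in> polybox q R \<Longrightarrow> ((\<lambda>\<alpha>. c \<alpha> * mono_at q \<alpha> x) has_sum f x) mindices"
    using f by (rule psnormE) blast
  have t: "psnorm_le p r (\<bar>c \<alpha>\<bar> * R ^ mdegree \<alpha>) (\<lambda>x. c \<alpha> * mono_at q \<alpha> (\<Psi> x))" for \<alpha>
    unfolding mono_at_def mdegree_def power_sum
    by (intro psnorm_cmult psnorm_prod psnorm_power \<Psi> r) auto
  have "psnorm_le p r (\<Sum>\<^sub>\<infinity>\<alpha>\<in>mindices. \<bar>c \<alpha>\<bar> * R ^ mdegree \<alpha>) (\<lambda>x. \<Sum>\<^sub>\<infinity>\<alpha>\<in>mindices. c \<alpha> * mono_at q \<alpha> (\<Psi> x))"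
    by (rule psnorm_infsum(1)[OF r t has_sum_imp_summable[OF c(2)]])
  then have "psnorm_le p r K (\<lambda>x. \<Sum>\<^sub>\<infinity>\<alpha>\<in>mindices. c \<alpha> * mono_at q \<alpha> (\<Psi> x))"
    unfolding infsumI[OF c(2)] using c(3) by (rule psnorm_mono)
  then show ?thesis
  proof (rule psnorm_cong)
    fix x assume "x \<in> polybox p r"
    then have "\<Psi> x \<in> polybox q R" using psnorm_bound[OF \<Psi>] by (auto simp: polybox_def)
    then show "(\<Sum>\<^sub>\<infinity>\<alpha>\<in>mindices. c \<alpha> * mono_at q \<alpha> (\<Psi> x)) = f (\<Psi> x)"
      using c(4) infsumI by blast
  qed
qed

text \<open>
  At the corner of a small box all monomials take their extreme value, so convergence there is
  already summability of the weighted coefficients.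
\<close>

lemma real_analytic_at_iff_psnorm: "real_analytic_at f p \<longleftrightarrow> (\<exists>r M. psnorm_le p r M f)"
proof
  assume "\<exists>r M. psnorm_le p r M f"
  then obtain r M c where c: "r > 0"
    "\<And>x. x \<in> polybox p r \<Longrightarrow> ((\<lambda>\<alpha>. c \<alpha> * mono_at p \<alpha> x) has_sum f x) mindices"
    unfolding psnorm_le_def by blast
  have "ball p r \<subseteq> polybox p r" by (rule ball_subset_polybox)
  then show "real_analytic_at f p"
    using c unfolding real_analytic_at_def mono_at_def mindices_def by blast
next
  assume "real_analytic_at f p"
  then obtain r c where c: "r > 0"
    "\<And>x. x \<in> ball p r \<Longrightarrow> ((\<lambda>\<alpha>. c \<alpha> * mono_at p \<alpha> x) has_sum f x) mindices"
    unfolding real_analytic_at_def mono_at_def mindices_def by blast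
  \<comment> \<open>A box of this size lies in the ball of radius \<open>r\<close>, by comparison with the \<open>\<ell>\<^sup>1\<close> norm.\<close>
  define \<rho> where "\<rho> = r / (2 * DIM('a))"
  have \<rho>: "\<rho> > 0" using c(1) by (simp add: \<rho>_def)
  have sub: "polybox p \<rho> \<subseteq> ball p r"
  proof
    fix x assume x: "x \<in> polybox p \<rho>"
    have "norm (x - p) \<le> (\<Sum>b\<in>Basis. \<bar>(x - p) \<bullet> b\<bar>)" by (rule norm_le_l1)
    also have "\<dots> \<le> (\<Sum>b\<in>(Basis::'a set). \<rho>)" using x by (intro sum_mono) (auto simp: polybox_def)
    also have "\<dots> < r" using c(1) by (simp add: \<rho>_def)
    finally show "x \<in> ball p r" by (simp add: dist_norm norm_minus_commute)
  qed
  define x0 where "x0 = p + \<rho> *\<^sub>R (\<Sum>Basis)"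
  have x0b: "(x0 - p) \<bullet> b = \<rho>" if "b \<in> Basis" for b
    using that by (simp add: x0_def inner_sum_left_Basis)
  have x0: "x0 \<in> polybox p \<rho>" using x0b \<rho> by (auto simp: polybox_def)
  have m0: "mono_at p \<alpha> x0 = \<rho> ^ mdegree \<alpha>" for \<alpha>
    by (simp add: mono_at_def mdegree_def x0b power_sum cong: prod.cong)
  have "(\<lambda>\<alpha>. c \<alpha> * mono_at p \<alpha> x0) summable_on mindices"
    using c(2) x0 sub has_sum_imp_summable by blast
  then have "(\<lambda>\<alpha>. norm (c \<alpha> * \<rho> ^ mdegree \<alpha>)) summable_on mindices"
    unfolding m0 by (subst (asm) summable_on_iff_abs_summable_on_real)
  then have s: "(\<lambda>\<alpha>. \<bar>c \<alpha>\<bar> * \<rho> ^ mdegree \<alpha>) summable_on mindices"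
    using \<rho> by (simp add: abs_mult)
  have "psnorm_le p \<rho> (\<Sum>\<^sub>\<infinity>\<alpha>\<in>mindices. \<bar>c \<alpha>\<bar> * \<rho> ^ mdegree \<alpha>) f"
    using sub by (intro psnormI[OF \<rho> has_sum_infsum[OF s] order_refl] c(2)) blast
  then show "\<exists>r M. psnorm_le p r M f" by blast
qed

section \<open>Real-analytic functions\<close>

lemma psnorm_common:
  assumes "real_analytic_at f p" "real_analytic_at g p"
  obtains r M N where "psnorm_le p r M f" "psnorm_le p r N g"
proof -
  obtain r1 M r2 N where 1: "psnorm_le p r1 M f" "psnorm_le p r2 N g"
    using assms unfolding real_analytic_at_iff_psnorm by blast
  let ?r = "min r1 r2"
  have r: "0 < ?r" using psnorm_pos[OF 1(1)] psnorm_pos[OF 1(2)] by simp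
  show ?thesis
    using that[of ?r M N] psnorm_shrink[OF 1(1) r] psnorm_shrink[OF 1(2) r] by simp
qed

lemma real_analytic_at_const: "real_analytic_at (\<lambda>_. k) p"
  unfolding real_analytic_at_iff_psnorm using psnorm_const[of 1] zero_less_one by blast

lemma real_analytic_at_add:
  assumes "real_analytic_at f p" "real_analytic_at g p"
  shows "real_analytic_at (\<lambda>x. f x + g x) p"
  using psnorm_common[OF assms] psnorm_add real_analytic_at_iff_psnorm by metis

lemma real_analytic_at_mult:
  assumes "real_analytic_at f p" "real_analytic_at g p"
  shows "real_analytic_at (\<lambda>x. f x * g x) p"
  using psnorm_common[OF assms] psnorm_mult real_analytic_at_iff_psnorm by metis

lemma real_analytic_at_uminus:
  assumes "real_analytic_at f p"
  shows "real_analytic_at (\<lambda>x. - f x) p"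
  using assms psnorm_uminus unfolding real_analytic_at_iff_psnorm by blast

lemma real_analytic_at_diff:
  assumes "real_analytic_at f p" "real_analytic_at g p"
  shows "real_analytic_at (\<lambda>x. f x - g x) p"
  using real_analytic_at_add[OF assms(1) real_analytic_at_uminus[OF assms(2)]] by simp

lemma real_analytic_at_power:
  assumes "real_analytic_at f p"
  shows "real_analytic_at (\<lambda>x. f x ^ n) p"
  using assms psnorm_power unfolding real_analytic_at_iff_psnorm by blast

lemma real_analytic_at_sum:
  assumes "\<And>i. i \<in> I \<Longrightarrow> real_analytic_at (f i) p"
  shows "real_analytic_at (\<lambda>x. \<Sum>i\<in>I. f i x) p"
  using assms by (induction I rule: infinite_finite_induct)
    (auto intro: real_analytic_at_const real_analytic_at_add)

lemma real_analytic_at_cong: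
  assumes "real_analytic_at f p" "open U" "p \<in> U" "\<And>x. x \<in> U \<Longrightarrow> f x = g x"
  shows "real_analytic_at g p"
proof -
  obtain r c where c: "r > 0" "\<And>x. x \<in> ball p r \<Longrightarrow>
       ((\<lambda>\<alpha>. c \<alpha> * (\<Prod>b\<in>Basis. ((x - p) \<bullet> b) ^ \<alpha> b)) has_sum f x) (Basis \<rightarrow>\<^sub>E UNIV)"
    using assms(1) unfolding real_analytic_at_def by blast
  obtain s where s: "s > 0" "ball p s \<subseteq> U" using assms(2,3) by (meson openE)
  have "((\<lambda>\<alpha>. c \<alpha> * (\<Prod>b\<in>Basis. ((x - p) \<bullet> b) ^ \<alpha> b)) has_sum g x) (Basis \<rightarrow>\<^sub>E UNIV)"
    if "x \<in> ball p (min r s)" for x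
  proof -
    have "x \<in> ball p r" "x \<in> U" using that s(2) by auto
    then show ?thesis using c(2)[of x] assms(4)[of x] by simp
  qed
  then show ?thesis
    unfolding real_analytic_at_def using c(1) s(1) by (intro exI[of _ "min r s"] conjI exI[of _ c]) auto
qed

lemma real_analytic_at_linear:
  assumes "bounded_linear f"
  shows "real_analytic_at f p"
proof -
  interpret bounded_linear f by fact
  have eq: "f x = f p + (\<Sum>b\<in>Basis. f b * ((x - p) \<bullet> b))" for x
  proof -
    have "f x = f p + f (x - p)" by (simp add: diff)
    also have "f (x - p) = f (\<Sum>b\<in>Basis. ((x - p) \<bullet> b) *\<^sub>R b)" by (simp add: euclidean_representation)
    also have "\<dots> = (\<Sum>b\<in>Basis. f b * ((x - p) \<bullet> b))" by (simp add: sum scaleR mult.commute)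
    finally show ?thesis .
  qed
  have "real_analytic_at (\<lambda>x. f p + (\<Sum>b\<in>Basis. f b * ((x - p) \<bullet> b))) p"
  proof (intro real_analytic_at_add real_analytic_at_const real_analytic_at_sum real_analytic_at_mult)
    show "real_analytic_at (\<lambda>x. (x - p) \<bullet> b) p" if "b \<in> Basis" for b
      unfolding real_analytic_at_iff_psnorm using psnorm_coord[OF zero_less_one that] by blast
  qed
  then show ?thesis
    by (rule real_analytic_at_cong[OF _ open_UNIV UNIV_I]) (rule eq[symmetric])
qed

lemma real_analytic_at_polynomial:
  "real_polynomial_function f \<Longrightarrow> real_analytic_at f p"
  by (induction rule: real_polynomial_function.induct)
    (auto intro: real_analytic_at_linear real_analytic_at_const real_analytic_at_add real_analytic_at_mult)

text \<open>
  Oscillations have arbitrarily small norm on small boxes; this is the smallness hypothesis of every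
  substitution and contraction argument.
\<close>

lemma real_analytic_at_small:
  assumes "real_analytic_at f p" "e > 0"
  obtains r0 where "r0 > 0" "\<And>r. 0 < r \<Longrightarrow> r \<le> r0 \<Longrightarrow> psnorm_le p r e (\<lambda>x. f x - f p)"
proof -
  have "real_analytic_at (\<lambda>x. f x - f p) p"
    by (intro real_analytic_at_diff assms real_analytic_at_const)
  then obtain R M where 1: "psnorm_le p R M (\<lambda>x. f x - f p)"
    unfolding real_analytic_at_iff_psnorm by blast
  have R: "R > 0" "M \<ge> 0" using psnorm_pos[OF 1] psnorm_nonneg[OF 1] by auto
  define r0 where "r0 = min R (e * R / (M + 1))"
  show ?thesis
  proof
    show "r0 > 0" using R assms(2) by (simp add: r0_def)
    fix r assume r: "0 < r" "r \<le> r0"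
    have "M * (r / R) \<le> (M + 1) * (r / R)" using r R by (intro mult_right_mono) auto
    also have "\<dots> \<le> (M + 1) * ((e * R / (M + 1)) / R)"
      using r R by (intro mult_left_mono divide_right_mono) (auto simp: r0_def)
    also have "\<dots> = e" using R by simp
    finally have le: "M * (r / R) \<le> e" .
    have "psnorm_le p r (M * (r / R)) (\<lambda>x. f x - f p)"
      using psnorm_shrink0[OF 1 _ r(1)] r by (simp add: r0_def)
    then show "psnorm_le p r e (\<lambda>x. f x - f p)" using le by (rule psnorm_mono)
  qed
qed

lemma real_analytic_at_compose:
  fixes \<Psi> :: "'a::euclidean_space \<Rightarrow> 'b::euclidean_space"
  assumes f: "real_analytic_at f (\<Psi> p)"
    and \<Psi>: "\<And>b. b \<in> Basis \<Longrightarrow> real_analytic_at (\<lambda>x. \<Psi> x \<bullet> b) p"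
  shows "real_analytic_at (\<lambda>x. f (\<Psi> x)) p"
proof -
  obtain R K where R: "psnorm_le (\<Psi> p) R K f"
    using f unfolding real_analytic_at_iff_psnorm by blast
  have "R > 0" using psnorm_pos[OF R] .
  have "\<forall>b\<in>Basis. \<exists>r0>0. \<forall>r. 0 < r \<longrightarrow> r \<le> r0 \<longrightarrow> psnorm_le p r R (\<lambda>x. \<Psi> x \<bullet> b - \<Psi> p \<bullet> b)"
    using real_analytic_at_small[OF \<Psi> \<open>R > 0\<close>] by metis
  then obtain r0 where r0: "\<And>b. b \<in> Basis \<Longrightarrow> r0 b > (0::real)"
    "\<And>b r. b \<in> Basis \<Longrightarrow> 0 < r \<Longrightarrow> r \<le> r0 b \<Longrightarrow> psnorm_le p r R (\<lambda>x. \<Psi> x \<bullet> b - \<Psi> p \<bullet> b)"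
    by metis
  define r where "r = Min (r0 ` Basis)"
  have r: "r > 0" "\<And>b. b \<in> Basis \<Longrightarrow> r \<le> r0 b"
    using r0(1) by (auto simp: r_def)
  have "psnorm_le p r K (\<lambda>x. f (\<Psi> x))"
    by (rule psnorm_compose[OF R r(1)]) (use r0(2)[OF _ r(1) r(2)] in \<open>simp add: inner_diff_left\<close>)
  then show ?thesis unfolding real_analytic_at_iff_psnorm by blast
qed

lemma real_analytic_at_powser:
  assumes f: "real_analytic_at f p" and "\<rho> > 0"
    and g: "\<And>y. \<bar>y - f p\<bar> < \<rho> \<Longrightarrow> (\<lambda>n. a n * (y - f p) ^ n) sums g y"
  shows "real_analytic_at (\<lambda>x. g (f x)) p"
proof -
  define R where "R = \<rho> / 2"
  have R: "0 < R" "R < \<rho>" using \<open>\<rho> > 0\<close> by (auto simp: R_def)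
  have "summable (\<lambda>n. a n * ((R + \<rho>) / 2) ^ n)"
    using g[of "f p + (R + \<rho>) / 2"] R by (auto simp: sums_iff)
  then have s: "summable (\<lambda>n. norm (a n * R ^ n))"
    by (rule powser_insidea) (use R in auto)
  then have s': "(\<lambda>n. \<bar>a n\<bar> * R ^ n) summable_on UNIV"
    using R by (intro norm_summable_imp_summable_on) (simp add: abs_mult)
  obtain r where r: "r > 0" "psnorm_le p r R (\<lambda>x. f x - f p)"
    using real_analytic_at_small[OF f R(1)] by (metis order_refl)
  have t: "psnorm_le p r (\<bar>a n\<bar> * R ^ n) (\<lambda>x. a n * (f x - f p) ^ n)" for n
    by (intro psnorm_cmult psnorm_power r)
  have sum: "psnorm_le p r (\<Sum>\<^sub>\<infinity>n. \<bar>a n\<bar> * R ^ n) (\<lambda>x. \<Sum>\<^sub>\<infinity>n. a n * (f x - f p) ^ n)"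
    by (rule psnorm_infsum(1)[OF r(1) t s'])
  have "psnorm_le p r (\<Sum>\<^sub>\<infinity>n. \<bar>a n\<bar> * R ^ n) (\<lambda>x. g (f x))"
  proof (rule psnorm_cong[OF sum])
    fix x assume x: "x \<in> polybox p r"
    have "(\<lambda>n. a n * (f x - f p) ^ n) summable_on UNIV"
      by (rule psnorm_infsum(2)[OF r(1) t s' x])
    then have "(\<lambda>n. a n * (f x - f p) ^ n) sums (\<Sum>\<^sub>\<infinity>n. a n * (f x - f p) ^ n)"
      by (intro has_sum_imp_sums has_sum_infsum)
    moreover have "\<bar>f x - f p\<bar> < \<rho>"
      using psnorm_bound[OF r(2) x] R by simp
    ultimately show "(\<Sum>\<^sub>\<infinity>n. a n * (f x - f p) ^ n) = g (f x)"
      using g sums_unique2 by blast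
  qed
  then show ?thesis unfolding real_analytic_at_iff_psnorm by blast
qed

lemma real_analytic_at_Re_holomorphic:
  assumes f: "real_analytic_at f p" and h: "h holomorphic_on U" "open U" "of_real (f p) \<in> U"
  shows "real_analytic_at (\<lambda>x. Re (h (of_real (f x)))) p"
proof -
  obtain \<rho> where \<rho>: "\<rho> > 0" "ball (of_real (f p)) \<rho> \<subseteq> U" using h(2,3) by (meson openE)
  have hol: "h holomorphic_on ball (of_real (f p)) \<rho>" using h(1) \<rho>(2) holomorphic_on_subset by blast
  define a where "a n = Re ((deriv ^^ n) h (of_real (f p)) / fact n)" for n
  have "(\<lambda>n. a n * (y - f p) ^ n) sums Re (h (of_real y))" if "\<bar>y - f p\<bar> < \<rho>" for y
  proof -
    have "cmod (of_real (f p) - of_real y) = \<bar>f p - y\<bar>"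
      by (metis norm_of_real of_real_diff)
    then have mem: "complex_of_real y \<in> ball (complex_of_real (f p)) \<rho>"
      using that by (simp add: dist_norm abs_minus_commute)
    have "Re (z * (of_real y - of_real (f p)) ^ n) = Re z * (y - f p) ^ n" for z n
      by (simp flip: of_real_diff of_real_power)
    then show ?thesis
      using sums_Re[OF holomorphic_power_series[OF hol mem]] by (simp only: a_def)
  qed
  then show ?thesis using real_analytic_at_powser[OF f \<rho>(1), of a "\<lambda>y. Re (h (of_real y))"] by blast
qed

lemma real_analytic_at_inverse:
  assumes "real_analytic_at f p" "f p \<noteq> 0"
  shows "real_analytic_at (\<lambda>x. inverse (f x)) p"
proof -
  have "real_analytic_at (\<lambda>x. Re (inverse (of_real (f x)))) p"
    by (rule real_analytic_at_Re_holomorphic[OF assms(1), of _ "- {0}"])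
      (use assms(2) in \<open>auto intro!: holomorphic_intros\<close>)
  then show ?thesis by (simp flip: of_real_inverse)
qed

lemma real_analytic_at_divide:
  assumes "real_analytic_at f p" "real_analytic_at g p" "g p \<noteq> 0"
  shows "real_analytic_at (\<lambda>x. f x / g x) p"
  unfolding divide_inverse by (intro real_analytic_at_mult real_analytic_at_inverse assms)

lemmas real_analytic_intros = real_analytic_at_const real_analytic_at_add real_analytic_at_mult
  real_analytic_at_uminus real_analytic_at_diff real_analytic_at_power real_analytic_at_sum
  real_analytic_at_divide

text \<open>
  Expanding around a nearby centre is the substitution of \<open>(x - q) + (q - p)\<close>, whose norm is at
  most the old radius.
\<close>

lemma psnorm_recenter:
  assumes f: "psnorm_le p r M f" and q: "q \<in> polybox p (r / 2)"
  shows "psnorm_le q (r / 2) M f"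
proof (rule psnorm_compose[OF f, where \<Psi> = "\<lambda>x. x"])
  show "r / 2 > 0" using psnorm_pos[OF f] by simp
  fix b :: 'a assume b: "b \<in> Basis"
  have "\<bar>(q - p) \<bullet> b\<bar> \<le> r / 2" using q b by (simp add: polybox_def)
  moreover have "psnorm_le q (r / 2) (r / 2 + \<bar>(q - p) \<bullet> b\<bar>) (\<lambda>x. (x - q) \<bullet> b + (q - p) \<bullet> b)"
    using psnorm_pos[OF f] b by (intro psnorm_add psnorm_coord psnorm_const) auto
  moreover have "(\<lambda>x. (x - q) \<bullet> b + (q - p) \<bullet> b) = (\<lambda>x. (x - p) \<bullet> b)"
    by (simp add: fun_eq_iff inner_diff_left)
  ultimately show "psnorm_le q (r / 2) r (\<lambda>x. (x - p) \<bullet> b)" by (auto elim: psnorm_mono)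
qed

lemma real_analytic_at_near:
  assumes "real_analytic_at f p"
  obtains \<rho> where "\<rho> > 0" "\<And>q. q \<in> ball p \<rho> \<Longrightarrow> real_analytic_at f q"
proof -
  obtain R K where R: "psnorm_le p R K f"
    using assms unfolding real_analytic_at_iff_psnorm by blast
  show ?thesis
  proof (rule that[of "R / 2"])
    fix q assume "q \<in> ball p (R / 2)"
    then have "psnorm_le q (R / 2) K f" using ball_subset_polybox by (intro psnorm_recenter[OF R]) blast
    then show "real_analytic_at f q" unfolding real_analytic_at_iff_psnorm by blast
  qed (use psnorm_pos[OF R] in simp)
qed

text \<open>
  After division by the value of \<open>e1\<close> at \<open>p\<close>, the equation is a fixed point problem
  for a map that contracts a small ball of the Banach algebra of power series by the factor \<open>1/2\<close>.  The
  iteration starting at \<open>0\<close> stays in this ball, and its limit is the telescoping series of its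
  increments.
\<close>

lemma real_analytic_simple_root:
  fixes e0 e1 e2 e3 :: "'a::euclidean_space \<Rightarrow> real"
  assumes an: "real_analytic_at e0 p" "real_analytic_at e1 p" "real_analytic_at e2 p" "real_analytic_at e3 p"
    and z: "e0 p = 0" "e1 p \<noteq> 0"
  obtains \<tau> U where "real_analytic_at \<tau> p" "\<tau> p = 0" "open U" "p \<in> U"
    "\<And>x. x \<in> U \<Longrightarrow> e0 x + e1 x * \<tau> x + e2 x * \<tau> x ^ 2 + e3 x * \<tau> x ^ 3 = 0"
proof -
  define k0 k1 k2 k3 where "k0 x = e0 x / e1 p" "k1 x = e1 x / e1 p - 1" "k2 x = e2 x / e1 p" "k3 x = e3 x / e1 p" for x
  have kan: "real_analytic_at k0 p" "real_analytic_at k1 p" "real_analytic_at k2 p" "real_analytic_at k3 p"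
    unfolding k0_k1_k2_k3_def by (intro real_analytic_intros an z)+
  have kz: "k0 p = 0" "k1 p = 0" using z by (auto simp: k0_k1_k2_k3_def)
  define K where "K = 1 + \<bar>k2 p\<bar> + \<bar>k3 p\<bar>"
  have K: "K \<ge> 1" by (simp add: K_def)
  \<comment> \<open>With this radius and norms at most \<open>\<delta> / 4\<close> of \<open>k0\<close>, \<open>k1\<close>, the map \<open>T\<close> below preserves the ball
    of radius \<open>\<delta>\<close> and halves distances in it.\<close>
  define \<delta> where "\<delta> = 1 / (16 * K)"
  have \<delta>: "\<delta> > 0" "\<delta> \<le> 1/16" "K * \<delta> = 1/16" using K by (auto simp: \<delta>_def field_simps)
  obtain r0 where r0: "r0 > 0" "\<And>r. 0 < r \<Longrightarrow> r \<le> r0 \<Longrightarrow> psnorm_le p r (\<delta> / 4) (\<lambda>x. k0 x - k0 p)"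
    using real_analytic_at_small[OF kan(1), of "\<delta> / 4"] \<delta> by auto
  obtain r1 where r1: "r1 > 0" "\<And>r. 0 < r \<Longrightarrow> r \<le> r1 \<Longrightarrow> psnorm_le p r (\<delta> / 4) (\<lambda>x. k1 x - k1 p)"
    using real_analytic_at_small[OF kan(2), of "\<delta> / 4"] \<delta> by auto
  obtain r2 where r2: "r2 > 0" "\<And>r. 0 < r \<Longrightarrow> r \<le> r2 \<Longrightarrow> psnorm_le p r 1 (\<lambda>x. k2 x - k2 p)"
    using real_analytic_at_small[OF kan(3), of 1] by auto
  obtain r3 where r3: "r3 > 0" "\<And>r. 0 < r \<Longrightarrow> r \<le> r3 \<Longrightarrow> psnorm_le p r 1 (\<lambda>x. k3 x - k3 p)"
    using real_analytic_at_small[OF kan(4), of 1] by auto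
  define r where "r = min (min r0 r1) (min r2 r3)"
  have r: "r > 0" using r0 r1 r2 r3 by (simp add: r_def)
  have b0: "psnorm_le p r (\<delta> / 4) k0" and b1: "psnorm_le p r (\<delta> / 4) k1"
    using r0(2)[OF r] r1(2)[OF r] kz by (auto simp: r_def)
  have "psnorm_le p r (1 + \<bar>k2 p\<bar>) (\<lambda>x. (k2 x - k2 p) + k2 p)"
    by (intro psnorm_add psnorm_const r r2(2)) (auto simp: r_def)
  then have b2: "psnorm_le p r K k2" by (simp, elim psnorm_mono) (simp add: K_def)
  have "psnorm_le p r (1 + \<bar>k3 p\<bar>) (\<lambda>x. (k3 x - k3 p) + k3 p)"
    by (intro psnorm_add psnorm_const r r3(2)) (auto simp: r_def)
  then have b3: "psnorm_le p r K k3" by (simp, elim psnorm_mono) (simp add: K_def)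
  define T where "T \<tau> x = - (k0 x + k1 x * \<tau> x + k2 x * \<tau> x ^ 2 + k3 x * \<tau> x ^ 3)" for \<tau> :: "'a \<Rightarrow> real" and x
  have \<delta>2: "K * \<delta>\<^sup>2 = \<delta> / 16" "K * \<delta> ^ 3 \<le> \<delta> / 16"
  proof -
    have *: "K * \<delta>\<^sup>2 = (K * \<delta>) * \<delta>" "K * \<delta> ^ 3 = (K * \<delta>) * (\<delta> * \<delta>)" by (auto simp: power2_eq_square power3_eq_cube)
    show "K * \<delta>\<^sup>2 = \<delta> / 16" unfolding * \<delta>(3) by simp
    have "\<delta> * \<delta> \<le> \<delta> * 1" using \<delta> by (intro mult_left_mono) auto
    then show "K * \<delta> ^ 3 \<le> \<delta> / 16" unfolding * \<delta>(3) by simp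
  qed
  have Tself: "psnorm_le p r \<delta> (T \<tau>)" if "psnorm_le p r \<delta> \<tau>" for \<tau>
  proof -
    have "psnorm_le p r (\<delta> / 4 + (\<delta> / 4) * \<delta> + K * \<delta>\<^sup>2 + K * \<delta> ^ 3) (T \<tau>)"
      unfolding T_def by (intro psnorm_uminus psnorm_add psnorm_mult psnorm_power b0 b1 b2 b3 that)
    moreover have "(\<delta> / 4) * \<delta> \<le> (\<delta> / 4) * 1" using \<delta> by (intro mult_left_mono) auto
    ultimately show ?thesis using \<delta>2 \<delta>(1) by (elim psnorm_mono) linarith
  qed
  have Tcon: "psnorm_le p r (D / 2) (\<lambda>x. T \<tau> x - T \<sigma> x)"
    if "psnorm_le p r \<delta> \<tau>" "psnorm_le p r \<delta> \<sigma>" "psnorm_le p r D (\<lambda>x. \<tau> x - \<sigma> x)" for \<tau> \<sigma> D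
  proof -
    have eq: "T \<tau> x - T \<sigma> x = - ((\<tau> x - \<sigma> x) * (k1 x + k2 x * (\<tau> x + \<sigma> x) + k3 x * (\<tau> x ^ 2 + \<tau> x * \<sigma> x + \<sigma> x ^ 2)))" for x
      by (simp add: T_def algebra_simps power2_eq_square power3_eq_cube)
    have "psnorm_le p r (D * (\<delta> / 4 + K * (\<delta> + \<delta>) + K * (\<delta>\<^sup>2 + \<delta> * \<delta> + \<delta>\<^sup>2))) (\<lambda>x. T \<tau> x - T \<sigma> x)"
      unfolding eq by (intro psnorm_uminus psnorm_add psnorm_mult psnorm_power b0 b1 b2 b3 that)
    moreover have "\<delta> / 4 + K * (\<delta> + \<delta>) + K * (\<delta>\<^sup>2 + \<delta> * \<delta> + \<delta>\<^sup>2) \<le> 1 / 2"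
    proof -
      have "K * (\<delta> + \<delta>) = 1 / 8" using \<delta>(3) by (simp add: distrib_left)
      moreover have "K * (\<delta>\<^sup>2 + \<delta> * \<delta> + \<delta>\<^sup>2) = 3 * (\<delta> / 16)"
      proof -
        have "K * (\<delta>\<^sup>2 + \<delta> * \<delta> + \<delta>\<^sup>2) = 3 * (K * \<delta>\<^sup>2)"
          by (simp add: distrib_left power2_eq_square)
        then show ?thesis unfolding \<delta>2(1) .
      qed
      ultimately show ?thesis using \<delta>(2) by linarith
    qed
    then have "D * (\<delta> / 4 + K * (\<delta> + \<delta>) + K * (\<delta>\<^sup>2 + \<delta> * \<delta> + \<delta>\<^sup>2)) \<le> D / 2"
      using mult_left_mono[OF _ psnorm_nonneg[OF that(3)], of _ "1 / 2"] by simp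
    ultimately show ?thesis by (elim psnorm_mono)
  qed
  define S where "S n = (T ^^ n) (\<lambda>_. 0)" for n
  have S0: "S 0 = (\<lambda>_. 0)" and SS: "S (Suc n) = T (S n)" for n by (auto simp: S_def)
  have bS: "psnorm_le p r \<delta> (S n)" for n
  proof (induction n)
    case 0
    show ?case using psnorm_mono[OF psnorm_const[OF r, of p 0], of \<delta>] \<delta>(1) by (simp add: S0)
  qed (simp add: SS Tself)
  have bD: "psnorm_le p r (\<delta> * (1/2) ^ n) (\<lambda>x. S (Suc n) x - S n x)" for n
  proof (induction n)
    case 0
    show ?case using bS[of "Suc 0"] by (simp add: S0)
  next
    case (Suc n)
    show ?case using Tcon[OF bS bS Suc] by (simp add: SS[of "Suc n"] SS[of n, symmetric])
  qed
  have sg: "(\<lambda>n. \<delta> * (1/2) ^ n) summable_on UNIV"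
    using \<delta>(1) by (intro norm_summable_imp_summable_on) (simp add: abs_mult power_abs summable_geometric summable_mult)
  define \<tau> where "\<tau> x = (\<Sum>\<^sub>\<infinity>n. S (Suc n) x - S n x)" for x
  have an\<tau>: "real_analytic_at \<tau> p"
    unfolding real_analytic_at_iff_psnorm \<tau>_def using psnorm_infsum(1)[OF r bD sg] by blast
  have lim: "(\<lambda>n. S n x) \<longlonglongrightarrow> \<tau> x" if "x \<in> polybox p r" for x
  proof -
    have "(\<lambda>n. S (Suc n) x - S n x) sums \<tau> x"
      unfolding \<tau>_def using psnorm_infsum(2)[OF r bD sg that] by (intro has_sum_imp_sums has_sum_infsum)
    then show ?thesis
      unfolding sums_def sum_lessThan_telescope[of "\<lambda>n. S n x"] by (simp add: S0)
  qed
  have fp: "\<tau> x = T \<tau> x" if "x \<in> polybox p r" for x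
  proof -
    have "(\<lambda>n. S (Suc n) x) \<longlonglongrightarrow> T \<tau> x"
      unfolding SS T_def by (intro tendsto_intros lim that)
    moreover have "(\<lambda>n. S (Suc n) x) \<longlonglongrightarrow> \<tau> x" using lim[OF that] by (rule LIMSEQ_Suc)
    ultimately show ?thesis by (rule LIMSEQ_unique[symmetric])
  qed
  have "S n p = 0" for n by (induction n) (auto simp: S0 SS T_def kz)
  then have "\<tau> p = 0" by (simp add: \<tau>_def)
  show ?thesis
  proof (rule that[OF an\<tau> \<open>\<tau> p = 0\<close>])
    show "open (ball p r)" "p \<in> ball p r" using r by auto
    fix x assume "x \<in> ball p r"
    then have "x \<in> polybox p r" using ball_subset_polybox by blast
    from fp[OF this] have "e1 p * (\<tau> x - T \<tau> x) = 0" by simp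
    moreover have "e1 p * (\<tau> x - T \<tau> x) = e0 x + e1 x * \<tau> x + e2 x * \<tau> x ^ 2 + e3 x * \<tau> x ^ 3"
      using z(2) by (simp add: T_def k0_k1_k2_k3_def algebra_simps)
    ultimately show "e0 x + e1 x * \<tau> x + e2 x * \<tau> x ^ 2 + e3 x * \<tau> x ^ 3 = 0" by simp
  qed
qed

section \<open>Gradients of real-analytic functions\<close>

text \<open>
  Around the centre \<open>y\<close> the function \<open>f - f y\<close> has no constant term, so its norm at radius
  \<open>norm (x - y)\<close> is small of first order.
\<close>

lemma psnorm_Lipschitz:
  assumes f: "psnorm_le p r M f" and x: "x \<in> ball p (r / 4)" and y: "y \<in> ball p (r / 4)"
  shows "\<bar>f x - f y\<bar> \<le> 4 * M / r * norm (x - y)"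
proof (cases "x = y")
  case False
  have r: "r > 0" using psnorm_pos[OF f] .
  have "y \<in> ball p (r / 2)" using y r by auto
  then have fy: "psnorm_le y (r / 2) M f" using ball_subset_polybox by (intro psnorm_recenter[OF f]) blast
  have "\<bar>f y\<bar> \<le> M" by (rule psnorm_bound[OF fy polybox_self]) (use r in simp)
  then have "psnorm_le y (r / 2) (M + M) (\<lambda>x. f x + - f y)"
    using r by (intro psnorm_add fy psnorm_mono[OF psnorm_const]) auto
  moreover have "norm (x - y) < r / 2"
    using x y norm_triangle_ineq4[of "x - p" "y - p"] by (simp add: dist_norm norm_minus_commute)
  ultimately have "psnorm_le y (norm (x - y)) ((M + M) * (norm (x - y) / (r / 2))) (\<lambda>x. f x + - f y)"
    using False by (intro psnorm_shrink0) auto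
  moreover have "x \<in> polybox y (norm (x - y))" using Basis_le_norm by (auto simp: polybox_def)
  ultimately have "\<bar>f x + - f y\<bar> \<le> (M + M) * (norm (x - y) / (r / 2))" by (rule psnorm_bound)
  then show ?thesis by (simp add: field_simps)
qed simp

text \<open>
  Once the terms of degree at most one are removed, all remaining monomials contain two factors that
  shrink with the radius.
\<close>

lemma psnorm_second_order:
  assumes f: "psnorm_le p r M f"
  obtains u where "\<And>r'. 0 < r' \<Longrightarrow> r' \<le> r \<Longrightarrow> psnorm_le p r' (M * (r' / r)\<^sup>2) (\<lambda>x. f x - f p - (x - p) \<bullet> u)"
proof -
  obtain c S where c: "r > 0" "((\<lambda>\<alpha>. \<bar>c \<alpha>\<bar> * r ^ mdegree \<alpha>) has_sum S) mindices" "S \<le> M"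
    "\<And>x. x \<in> polybox p r \<Longrightarrow> ((\<lambda>\<alpha>. c \<alpha> * mono_at p \<alpha> x) has_sum f x) mindices"
    using f by (rule psnormE) blast
  let ?z = "\<lambda>b\<in>Basis. 0 :: nat"
  define e :: "'a \<Rightarrow> 'a \<Rightarrow> nat" where "e b = (\<lambda>b'\<in>Basis. if b' = b then 1 else 0)" for b
  have z: "?z \<in> mindices" by (auto simp: mindices_def)
  have em: "e b \<in> mindices" for b by (auto simp: mindices_def e_def)
  have inj: "inj_on e Basis"
  proof (rule inj_onI)
    fix b b' :: 'a assume b: "b \<in> Basis" "b' \<in> Basis" "e b = e b'"
    then have "e b b = e b' b" by simp
    then show "b = b'" using b by (simp add: e_def split: if_splits)
  qed
  have de: "mdegree (e b) = 1" if "b \<in> Basis" for b using that by (simp add: mdegree_def e_def)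
  have me: "mono_at p (e b) x = (x - p) \<bullet> b" if "b \<in> Basis" for b x
  proof -
    have "mono_at p (e b) x = (\<Prod>b'\<in>Basis. if b' = b then (x - p) \<bullet> b' else 1)"
      unfolding mono_at_def e_def by (rule prod.cong) auto
    also have "\<dots> = (x - p) \<bullet> b" using that by (subst prod.delta) auto
    finally show ?thesis .
  qed
  have dz: "mdegree ?z = 0" by (simp add: mdegree_def)
  have mz: "mono_at p ?z x = 1" for x by (simp add: mono_at_def)
  define L where "L = insert ?z (e ` Basis)"
  have L: "finite L" "L \<subseteq> mindices" using z em by (auto simp: L_def)
  have z_notin: "?z \<notin> e ` Basis"
  proof
    assume "?z \<in> e ` Basis"
    then obtain b where b: "b \<in> Basis" "e b = ?z" by auto
    have "mdegree (e b) = 0" unfolding b(2) by (rule dz)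
    then show False using de[OF b(1)] by simp
  qed
  define u where "u = (\<Sum>b\<in>Basis. c (e b) *\<^sub>R b)"
  have sumL: "(\<Sum>\<alpha>\<in>L. c \<alpha> * mono_at p \<alpha> x) = c ?z + (x - p) \<bullet> u" for x
  proof -
    have "(\<Sum>\<alpha>\<in>L. c \<alpha> * mono_at p \<alpha> x) = c ?z + (\<Sum>b\<in>Basis. c (e b) * mono_at p (e b) x)"
      unfolding L_def using z_notin inj by (simp add: mz sum.reindex)
    also have "(\<Sum>b\<in>Basis. c (e b) * mono_at p (e b) x) = (x - p) \<bullet> u"
      by (simp add: u_def inner_sum_right me)
    finally show ?thesis .
  qed
  have rest: "((\<lambda>\<alpha>. c \<alpha> * mono_at p \<alpha> x) has_sum (f x - (c ?z + (x - p) \<bullet> u))) (mindices - L)"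
    if "x \<in> polybox p r" for x
  proof -
    have "((\<lambda>\<alpha>. c \<alpha> * mono_at p \<alpha> x) has_sum (c ?z + (x - p) \<bullet> u)) L"
      using L(1) sumL by (simp add: has_sum_finite_iff)
    then show ?thesis by (intro has_sum_Diff c(4) that L)
  qed
  have deg2: "mdegree \<alpha> \<ge> 2" if "\<alpha> \<in> mindices - L" for \<alpha>
  proof (rule ccontr)
    assume "\<not> mdegree \<alpha> \<ge> 2"
    then consider "mdegree \<alpha> = 0" | "mdegree \<alpha> = 1" by linarith
    then show False
    proof cases
      case 1
      then show ?thesis using that mdegree_0_iff[of \<alpha>] by (auto simp: L_def)
    next
      case 2
      then obtain b where b: "b \<in> Basis" "\<alpha> b = 1" "\<forall>b'\<in>Basis. b \<noteq> b' \<longrightarrow> \<alpha> b' = 0"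
        unfolding mdegree_def by (subst (asm) sum_eq_1_iff) auto
      have "\<alpha> = e b"
        using that b by (auto simp: fun_eq_iff e_def mindices_def PiE_def extensional_def)
      then show ?thesis using that b(1) by (auto simp: L_def)
    qed
  qed
  have fp: "f p = c ?z"
  proof -
    have p: "p \<in> polybox p r" using c(1) by (intro polybox_self) auto
    have "((\<lambda>\<alpha>. c \<alpha> * mono_at p \<alpha> p) has_sum 0) (mindices - L)"
    proof (rule has_sum_0)
      fix \<alpha> assume "\<alpha> \<in> mindices - L"
      then show "c \<alpha> * mono_at p \<alpha> p = 0" using mono_at_self[of \<alpha> p] by (auto simp: L_def)
    qed
    from has_sum_unique[OF rest[OF p] this] show ?thesis by simp
  qed
  show ?thesis
  proof (rule that)
    fix r' assume r': "0 < r'" "r' \<le> r"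
    have le: "\<bar>c \<alpha>\<bar> * r' ^ mdegree \<alpha> \<le> (\<bar>c \<alpha>\<bar> * r ^ mdegree \<alpha>) * (r' / r)\<^sup>2" if \<alpha>: "\<alpha> \<in> mindices - L" for \<alpha>
    proof -
      obtain n where n: "mdegree \<alpha> = n + 2" using deg2[OF \<alpha>] by (metis add.commute le_Suc_ex)
      have "r' ^ (n + 2) \<le> r ^ n * r'\<^sup>2"
        unfolding power_add using r' by (auto intro!: mult_right_mono power_mono)
      also have "\<dots> = r ^ (n + 2) * (r' / r)\<^sup>2" using c(1) by (simp add: power_add power_divide power2_eq_square)
      finally show ?thesis unfolding n mult.assoc by (rule mult_left_mono) simp
    qed
    have sumc: "(\<lambda>\<alpha>. \<bar>c \<alpha>\<bar> * r ^ mdegree \<alpha>) summable_on (mindices - L)"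
      by (rule summable_on_subset_banach[OF has_sum_imp_summable[OF c(2)]]) auto
    define S' where "S' = (\<Sum>\<^sub>\<infinity>\<alpha>\<in>mindices - L. \<bar>c \<alpha>\<bar> * r ^ mdegree \<alpha>)"
    have S': "((\<lambda>\<alpha>. \<bar>c \<alpha>\<bar> * r ^ mdegree \<alpha>) has_sum S') (mindices - L)"
      unfolding S'_def by (rule has_sum_infsum[OF sumc])
    have "S' \<le> S" by (rule has_sum_mono2[OF S' c(2)]) (use c(1) in auto)
    then have S'M: "S' \<le> M" using c(3) by simp
    have hs: "((\<lambda>\<alpha>. (\<bar>c \<alpha>\<bar> * r ^ mdegree \<alpha>) * (r' / r)\<^sup>2) has_sum (S' * (r' / r)\<^sup>2)) (mindices - L)"
      by (rule has_sum_cmult_left[OF S'])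
    have s: "(\<lambda>\<alpha>. \<bar>c \<alpha>\<bar> * r' ^ mdegree \<alpha>) summable_on (mindices - L)"
      by (rule summable_on_le[OF hs _ le]) (use r' in simp)
    show "psnorm_le p r' (M * (r' / r)\<^sup>2) (\<lambda>x. f x - f p - (x - p) \<bullet> u)"
    proof (rule psnorm_reindex[where I = "mindices - L" and k = c and e = "\<lambda>\<alpha>. \<alpha>", OF r'(1) _ has_sum_infsum[OF s]])
      have "(\<Sum>\<^sub>\<infinity>\<alpha>\<in>mindices - L. \<bar>c \<alpha>\<bar> * r' ^ mdegree \<alpha>) \<le> S' * (r' / r)\<^sup>2"
        by (rule has_sum_mono[OF has_sum_infsum[OF s] hs le])
      also have "\<dots> \<le> M * (r' / r)\<^sup>2" using S'M by (intro mult_right_mono) auto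
      finally show "(\<Sum>\<^sub>\<infinity>\<alpha>\<in>mindices - L. \<bar>c \<alpha>\<bar> * r' ^ mdegree \<alpha>) \<le> M * (r' / r)\<^sup>2" .
      show "((\<lambda>\<alpha>. c \<alpha> * mono_at p \<alpha> x) has_sum f x - f p - (x - p) \<bullet> u) (mindices - L)"
        if "x \<in> polybox p r'" for x
        using rest[of x] that polybox_mono[OF r'(2)] by (auto simp: fp algebra_simps)
    qed auto
  qed
qed

text \<open>
  The remainder of second order has a Lipschitz constant that tends to \<open>0\<close> with the radius; so
  the function is strictly differentiable, which is stronger than differentiability at
  \<open>p\<close> and makes the gradient continuous.
\<close>

lemma real_analytic_strict_gradient:
  assumes f: "real_analytic_at f p"
  obtains u where "(f has_derivative (\<lambda>h. h \<bullet> u)) (at p)"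
    "\<And>e. e > 0 \<Longrightarrow> \<exists>d>0. \<forall>x\<in>ball p d. \<forall>y\<in>ball p d. \<bar>f x - f y - (x - y) \<bullet> u\<bar> \<le> e * norm (x - y)"
proof -
  obtain r M where 1: "psnorm_le p r M f" using f unfolding real_analytic_at_iff_psnorm by blast
  have r: "r > 0" "M \<ge> 0" using psnorm_pos[OF 1] psnorm_nonneg[OF 1] by auto
  obtain u where u: "\<And>r'. 0 < r' \<Longrightarrow> r' \<le> r \<Longrightarrow> psnorm_le p r' (M * (r' / r)\<^sup>2) (\<lambda>x. f x - f p - (x - p) \<bullet> u)"
    using psnorm_second_order[OF 1] by blast
  have strict: "\<exists>d>0. \<forall>x\<in>ball p d. \<forall>y\<in>ball p d. \<bar>f x - f y - (x - y) \<bullet> u\<bar> \<le> e * norm (x - y)"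
    if e: "e > 0" for e
  proof -
    define r' where "r' = min r (e * r\<^sup>2 / (4 * (M + 1)))"
    have r': "0 < r'" "r' \<le> r" using r e by (auto simp: r'_def)
    have "4 * (M * (r' / r)\<^sup>2) / r' = 4 * M * r' / r\<^sup>2"
      using r' by (simp add: power_divide power2_eq_square)
    also have "\<dots> \<le> 4 * (M + 1) * (e * r\<^sup>2 / (4 * (M + 1))) / r\<^sup>2"
      using r r' by (intro divide_right_mono mult_mono) (auto simp: r'_def)
    also have "\<dots> = e" using r by simp
    finally have le: "4 * (M * (r' / r)\<^sup>2) / r' \<le> e" .
    have "\<bar>f x - f y - (x - y) \<bullet> u\<bar> \<le> e * norm (x - y)" if "x \<in> ball p (r' / 4)" "y \<in> ball p (r' / 4)" for x y
    proof -
      have "\<bar>(f x - f p - (x - p) \<bullet> u) - (f y - f p - (y - p) \<bullet> u)\<bar> \<le> 4 * (M * (r' / r)\<^sup>2) / r' * norm (x - y)"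
        using that by (rule psnorm_Lipschitz[OF u[OF r']])
      also have "\<dots> \<le> e * norm (x - y)" using le by (intro mult_right_mono) auto
      finally show ?thesis by (simp add: inner_diff_left algebra_simps)
    qed
    then show ?thesis using r'(1) by (intro exI[of _ "r' / 4"]) auto
  qed
  show ?thesis
  proof (rule that[OF _ strict])
    show "(f has_derivative (\<lambda>h. h \<bullet> u)) (at p)"
      unfolding has_derivative_at_alt
    proof (intro conjI allI impI bounded_linear_inner_left)
      fix e :: real assume "e > 0"
      from strict[OF this] obtain d where d: "d > 0"
        "\<forall>x\<in>ball p d. \<forall>y\<in>ball p d. \<bar>f x - f y - (x - y) \<bullet> u\<bar> \<le> e * norm (x - y)" by blast
      then show "\<exists>d>0. \<forall>y. norm (y - p) < d \<longrightarrow> norm (f y - f p - (y - p) \<bullet> u) \<le> e * norm (y - p)"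
        by (intro exI[of _ d]) (auto simp: dist_norm norm_minus_commute)
    qed
  qed
qed

text \<open>
  Strict differentiability bounds difference quotients at all pairs of points near \<open>p\<close>, hence the
  gradients at these points.
\<close>

lemma real_analytic_gradient_continuous:
  assumes f: "real_analytic_at f p" and fv: "(f has_derivative (\<lambda>h. h \<bullet> v)) (at p)" and e: "e > 0"
  obtains d where "d > 0"
    "\<And>q w. q \<in> ball p d \<Longrightarrow> (f has_derivative (\<lambda>h. h \<bullet> w)) (at q) \<Longrightarrow> norm (w - v) \<le> e"
proof -
  obtain u where u: "(f has_derivative (\<lambda>h. h \<bullet> u)) (at p)"
    "\<And>e. e > 0 \<Longrightarrow> \<exists>d>0. \<forall>x\<in>ball p d. \<forall>y\<in>ball p d. \<bar>f x - f y - (x - y) \<bullet> u\<bar> \<le> e * norm (x - y)"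
    using real_analytic_strict_gradient[OF f] by blast
  have "(\<lambda>h. h \<bullet> u) = (\<lambda>h. h \<bullet> v)" using has_derivative_unique[OF u(1) fv] .
  then have "h \<bullet> u = h \<bullet> v" for h by meson
  then have uv: "u = v" by (metis inner_commute vector_eq_ldot)
  obtain d where d: "d > 0" "\<forall>x\<in>ball p d. \<forall>y\<in>ball p d. \<bar>f x - f y - (x - y) \<bullet> v\<bar> \<le> e / 2 * norm (x - y)"
    using u(2)[of "e / 2"] e uv by auto
  show ?thesis
  proof (rule that[OF d(1)])
    fix q w assume q: "q \<in> ball p d" and w: "(f has_derivative (\<lambda>h. h \<bullet> w)) (at q)"
    show "norm (w - v) \<le> e"
    proof (cases "w = v")
      case False
      obtain d1 where d1: "d1 > 0" "ball q d1 \<subseteq> ball p d" using q by (meson open_ball openE)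
      obtain d2 where d2: "d2 > 0" "\<forall>y. norm (y - q) < d2 \<longrightarrow> norm (f y - f q - (y - q) \<bullet> w) \<le> e / 2 * norm (y - q)"
        using w e unfolding has_derivative_at_alt by (metis half_gt_zero)
      define h where "h = (min d1 d2 / 2 / norm (w - v)) *\<^sub>R (w - v)"
      have nh: "norm h = min d1 d2 / 2" using False d1 d2 by (simp add: h_def)
      then have h: "norm h < d1" "norm h < d2" "norm h > 0" using d1 d2 by auto
      have "q + h \<in> ball q d1" using h(1) by (simp add: dist_norm)
      then have "q + h \<in> ball p d" using d1(2) by blast
      then have "\<bar>f (q + h) - f q - h \<bullet> v\<bar> \<le> e / 2 * norm h"
        using d(2) q by (metis add_diff_cancel_left')
      moreover have "\<bar>f (q + h) - f q - h \<bullet> w\<bar> \<le> e / 2 * norm h"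
        using d2(2)[rule_format, of "q + h"] h(2) by simp
      ultimately have "\<bar>h \<bullet> w - h \<bullet> v\<bar> \<le> e * norm h" by linarith
      then have "\<bar>h \<bullet> (w - v)\<bar> \<le> e * norm h" by (simp add: inner_diff_right)
      moreover have "h \<bullet> (w - v) = norm h * norm (w - v)"
        using False d1(1) d2(1) by (simp add: h_def dot_square_norm power2_eq_square)
      ultimately have "norm h * norm (w - v) \<le> norm h * e" by (simp add: mult.commute)
      then show ?thesis using h(3) by simp
    qed (use e in simp)
  qed
qed

lemma real_analytic_at_imp_continuous: "real_analytic_at f p \<Longrightarrow> isCont f p"
  by (metis has_derivative_continuous real_analytic_strict_gradient)

section \<open>The identity theorem\<close>

lemma real_analytic_at_real_powser:
  fixes h :: "real \<Rightarrow> real"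
  assumes "real_analytic_at h t"
  obtains a r where "r > 0" "\<And>x. \<bar>x - t\<bar> < r \<Longrightarrow> (\<lambda>n. a n * (x - t) ^ n) sums h x"
proof -
  obtain r c where c: "r > 0" "\<And>x. x \<in> ball t r \<Longrightarrow>
       ((\<lambda>\<alpha>. c \<alpha> * (\<Prod>b\<in>Basis. ((x - t) \<bullet> b) ^ \<alpha> b)) has_sum h x) (Basis \<rightarrow>\<^sub>E UNIV)"
    using assms unfolding real_analytic_at_def by blast
  define k :: "nat \<Rightarrow> real \<Rightarrow> nat" where "k n = (\<lambda>b\<in>Basis. n)" for n
  have bij: "bij_betw k UNIV (Basis \<rightarrow>\<^sub>E UNIV)"
  proof (rule bij_betw_byWitness[where f' = "\<lambda>\<alpha>. \<alpha> 1"])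
    show "\<forall>\<alpha>\<in>Basis \<rightarrow>\<^sub>E UNIV. k (\<alpha> 1) = \<alpha>"
      by (auto simp: k_def fun_eq_iff PiE_def extensional_def)
  qed (auto simp: k_def PiE_def extensional_def)
  show ?thesis
  proof (rule that[OF c(1)])
    fix x assume "\<bar>x - t\<bar> < r"
    then have "x \<in> ball t r" by (simp add: dist_real_def abs_minus_commute)
    from c(2)[OF this] have "((\<lambda>n. c (k n) * (\<Prod>b\<in>Basis. ((x - t) \<bullet> b) ^ k n b)) has_sum h x) UNIV"
      by (subst has_sum_reindex_bij_betw[OF bij])
    then show "(\<lambda>n. c (k n) * (x - t) ^ n) sums h x"
      by (intro has_sum_imp_sums) (simp add: k_def)
  qed
qed

text \<open>
  The points near which an analytic function of one variable vanishes, and the points around which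
  its zeros are isolated, exhaust the line.  Both sets are open, and connectedness gives the identity theorem.
\<close>

lemma real_analytic_zero_dichotomy:
  fixes h :: "real \<Rightarrow> real"
  assumes "real_analytic_at h t"
  obtains e where "e > 0" "\<forall>s\<in>ball t e. h s = 0" | e where "e > 0" "\<forall>s\<in>ball t e - {t}. h s \<noteq> 0"
proof -
  obtain a r where a: "r > 0" "\<And>x. \<bar>x - t\<bar> < r \<Longrightarrow> (\<lambda>n. a n * (x - t) ^ n) sums h x"
    using real_analytic_at_real_powser[OF assms] by blast
  show thesis
  proof (cases "\<forall>n. a n = 0")
    case True
    have "h s = 0" if "s \<in> ball t r" for s
      using a(2)[of s] that True sums_unique2[OF _ sums_zero] by (auto simp: dist_real_def abs_minus_commute)
    then show thesis using that(1) a(1) by blast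
  next
    case False
    show thesis
    proof (cases "h t = 0")
      case True
      have "(\<lambda>n. a n * (t - t) ^ n) sums a 0"
        using sums_If_finite_set[of "{0}" "\<lambda>n. a n * (t - t) ^ n"] powser_sums_zero[of a] by simp
      then have "a 0 = 0" using a(2)[of t] a(1) True sums_unique2 by fastforce
      then obtain m where "a m \<noteq> 0" "m > 0" using False by (metis neq0_conv)
      from powser_0_nonzero[of r t a h, OF a(1) _ True this] a(2)
      obtain s where "0 < s" "\<And>z. z \<in> cball t s - {t} \<Longrightarrow> h z \<noteq> 0" by auto
      then show thesis using that(2)[of s] by (meson Diff_iff ball_subset_cball subsetD)
    next
      case False
      have "isCont h t" using assms by (rule real_analytic_at_imp_continuous)
      from continuous_at_avoid[OF this False]
      obtain e where "e > 0" "\<forall>y. dist t y < e \<longrightarrow> h y \<noteq> 0" by blast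
      then show thesis using that(2)[of e] by auto
    qed
  qed
qed

text \<open>
  Any two points of a convex set are joined by a segment, along which the function is analytic in
  one variable.
\<close>

lemma real_analytic_identity_convex:
  fixes f :: "'a::euclidean_space \<Rightarrow> real"
  assumes C: "convex C" and f: "real_analytic_on f C"
    and q: "q \<in> C" "e > 0" "\<forall>x\<in>ball q e. f x = 0" and x: "x \<in> C"
  shows "f x = 0"
proof -
  define \<phi> where "\<phi> t = q + t *\<^sub>R (x - q)" for t
  have \<phi>C: "\<phi> t \<in> C" if "t \<in> {0..1}" for t
    using convexD_alt[OF C q(1) x, of t] that by (simp add: \<phi>_def algebra_simps)
  have an: "real_analytic_at (\<lambda>t. f (\<phi> t)) t" if "t \<in> {0..1}" for t
  proof (rule real_analytic_at_compose[where f = f and \<Psi> = \<phi>])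
    show "real_analytic_at f (\<phi> t)" using f \<phi>C[OF that] by (simp add: real_analytic_on_def)
    show "real_analytic_at (\<lambda>x. \<phi> x \<bullet> b) t" for b
      unfolding \<phi>_def inner_add_left inner_scaleR_left
      by (intro real_analytic_intros real_analytic_at_linear bounded_linear_ident)
  qed
  define Z where "Z = {t. \<exists>e>0. \<forall>s\<in>ball t e. f (\<phi> s) = 0}"
  define N where "N = {t. \<exists>e>0. \<forall>s\<in>ball t e - {t}. f (\<phi> s) \<noteq> 0}"
  have oZ: "open Z"
    unfolding open_contains_ball
  proof
    fix t assume "t \<in> Z"
    then obtain e where e: "e > 0" "\<forall>s\<in>ball t e. f (\<phi> s) = 0" by (auto simp: Z_def)
    have "ball t e \<subseteq> Z"
    proof
      fix s assume "s \<in> ball t e"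
      then obtain e' where "e' > 0" "ball s e' \<subseteq> ball t e" by (meson open_ball openE)
      then show "s \<in> Z" using e(2) by (auto simp: Z_def)
    qed
    then show "\<exists>e>0. ball t e \<subseteq> Z" using e(1) by blast
  qed
  have oN: "open N"
    unfolding open_contains_ball
  proof
    fix t assume t: "t \<in> N"
    then obtain e where e: "e > 0" "\<forall>s\<in>ball t e - {t}. f (\<phi> s) \<noteq> 0" by (auto simp: N_def)
    have "ball t e \<subseteq> N"
    proof
      fix s assume s: "s \<in> ball t e"
      show "s \<in> N"
      proof (cases "s = t")
        case False
        have "open (ball t e - {t})" by (simp add: open_delete)
        moreover have "s \<in> ball t e - {t}" using s False by simp
        ultimately obtain e' where e': "e' > 0" "ball s e' \<subseteq> ball t e - {t}" by (meson openE)
        then have "\<forall>s'\<in>ball s e' - {s}. f (\<phi> s') \<noteq> 0" using e(2) by blast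
        then show ?thesis using e'(1) unfolding N_def by blast
      qed (use t in simp)
    qed
    then show "\<exists>e>0. ball t e \<subseteq> N" using e(1) by blast
  qed
  have cov: "{0..1} \<subseteq> Z \<union> N"
  proof
    fix t :: real assume "t \<in> {0..1}"
    then have "real_analytic_at (\<lambda>t. f (\<phi> t)) t" by (rule an)
    then show "t \<in> Z \<union> N"
    proof (rule real_analytic_zero_dichotomy)
      fix e :: real assume "e > 0" "\<forall>s\<in>ball t e. f (\<phi> s) = 0"
      then have "t \<in> Z" unfolding Z_def by blast
      then show ?thesis ..
    next
      fix e :: real assume "e > 0" "\<forall>s\<in>ball t e - {t}. f (\<phi> s) \<noteq> 0"
      then have "t \<in> N" unfolding N_def by blast
      then show ?thesis ..
    qed
  qed
  have disj: "Z \<inter> N = {}"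
  proof -
    have False if t: "t \<in> Z" "t \<in> N" for t
    proof -
      obtain e where e: "e > 0" "\<forall>s\<in>ball t e. f (\<phi> s) = 0" using t(1) by (auto simp: Z_def)
      obtain e' where e': "e' > 0" "\<forall>s\<in>ball t e' - {t}. f (\<phi> s) \<noteq> 0" using t(2) by (auto simp: N_def)
      have "t + min e e' / 2 \<in> ball t e" "t + min e e' / 2 \<in> ball t e' - {t}"
        using e(1) e'(1) by (auto simp: dist_real_def)
      then show False using e(2) e'(2) by blast
    qed
    then show ?thesis by blast
  qed
  have "0 \<in> Z"
  proof -
    define d where "d = e / (norm (x - q) + 1)"
    have d: "d > 0" using q(2) by (simp add: d_def add_nonneg_pos)
    have "f (\<phi> s) = 0" if "s \<in> ball 0 d" for s
    proof -
      have "norm (\<phi> s - q) = \<bar>s\<bar> * norm (x - q)" by (simp add: \<phi>_def)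
      also have "\<dots> \<le> \<bar>s\<bar> * (norm (x - q) + 1)" by (intro mult_left_mono) auto
      also have "\<dots> < e"
        using that by (subst pos_less_divide_eq[symmetric]) (auto simp: d_def add_nonneg_pos)
      finally show ?thesis using q(3) by (simp add: dist_norm norm_minus_commute)
    qed
    then show ?thesis unfolding Z_def using d by blast
  qed
  then have "Z \<inter> {0..1} \<noteq> {}" by auto
  then have "N \<inter> {0..1} = {}"
    using connectedD[OF connected_Icc oZ oN, of 0 1] cov disj by blast
  moreover have "(1::real) \<in> {0..1}" by simp
  ultimately have "1 \<in> Z" using cov by blast
  then have "f (\<phi> 1) = 0" unfolding Z_def by force
  then show ?thesis by (simp add: \<phi>_def)
qed

lemma analytic_set_near_separated:
  assumes "analytic_set_near T x" "x \<notin> T"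
  shows "\<exists>e>0. ball x e \<inter> T = {}"
proof -
  obtain U F where U: "open U" "x \<in> U" "\<forall>f\<in>F. real_analytic_on f U" "T \<inter> U = {x \<in> U. \<forall>f\<in>F. f x = 0}"
    using assms(1) unfolding analytic_set_near_def by blast
  then obtain f where f: "f \<in> F" "f x \<noteq> 0" using assms(2) by blast
  have "isCont f x"
    using U f by (auto intro!: real_analytic_at_imp_continuous simp: real_analytic_on_def)
  from continuous_at_avoid[OF this f(2)] obtain e where e: "e > 0" "\<forall>y. dist x y < e \<longrightarrow> f y \<noteq> 0" by blast
  obtain e' where e': "e' > 0" "ball x e' \<subseteq> U" using U by (meson openE)
  have "ball x (min e e') \<inter> T = {}"
  proof -
    have False if "y \<in> ball x (min e e')" "y \<in> T" for y
    proof -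
      have "y \<in> T \<inter> U" using that e'(2) by auto
      then have "f y = 0" using U(4) f(1) by blast
      then show False using e(2) that(1) by auto
    qed
    then show ?thesis by blast
  qed
  then show ?thesis using e(1) e'(1) by (intro exI[of _ "min e e'"]) auto
qed

text \<open>
  The interior of \<open>T\<close> is closed in \<open>M\<close>: near a boundary point, the functions that define
  \<open>T\<close> vanish on an open part of a ball, hence on the whole ball.
\<close>

lemma analytic_set_identity:
  fixes M T :: "'a::euclidean_space set"
  assumes M: "open M" "connected M" and T: "T \<subseteq> M"
    and an: "\<And>x. x \<in> M \<Longrightarrow> analytic_set_near T x"
    and int: "interior T \<noteq> {}"
  shows "T = M"
proof -
  define W where "W = M - interior T"
  have sub: "interior T \<subseteq> M" using T interior_subset by blast
  have "open W"
    unfolding open_contains_ball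
  proof
    fix x assume x: "x \<in> W"
    show "\<exists>e>0. ball x e \<subseteq> W"
    proof (cases "x \<in> T")
      case False
      then obtain e where e: "e > 0" "ball x e \<inter> T = {}" using analytic_set_near_separated[OF an] x by (auto simp: W_def)
      obtain e' where e': "e' > 0" "ball x e' \<subseteq> M" using x M(1) by (auto simp: W_def elim: openE)
      have "ball x (min e e') \<subseteq> W" using e e' interior_subset[of T] by (auto simp: W_def)
      then show ?thesis using e(1) e'(1) by (metis min_less_iff_conj)
    next
      case True
      obtain U F where U: "open U" "x \<in> U" "\<forall>f\<in>F. real_analytic_on f U" "T \<inter> U = {x \<in> U. \<forall>f\<in>F. f x = 0}"
        using an[of x] x unfolding W_def analytic_set_near_def by blast
      obtain e where e: "e > 0" "ball x e \<subseteq> U" using U(1,2) by (meson openE)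
      obtain e' where e': "e' > 0" "ball x e' \<subseteq> M" using x M(1) by (auto simp: W_def elim: openE)
      have "ball x (min e e') \<inter> interior T = {}"
      proof (rule ccontr)
        assume "ball x (min e e') \<inter> interior T \<noteq> {}"
        then obtain q where q: "q \<in> ball x e" "q \<in> interior T" by auto
        then obtain d where d: "d > 0" "ball q d \<subseteq> ball x e" "ball q d \<subseteq> T"
        proof -
          have "open (ball x e \<inter> interior T)" "q \<in> ball x e \<inter> interior T" using q by auto
          then obtain d where "d > 0" "ball q d \<subseteq> ball x e \<inter> interior T" by (meson openE)
          then show ?thesis using that[of d] interior_subset[of T] by blast
        qed
        have "y \<in> T" if y: "y \<in> ball x e" for y
        proof -
          have "f y = 0" if "f \<in> F" for f
          proof (rule real_analytic_identity_convex[OF convex_ball _ q(1) d(1) _ y])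
            show "real_analytic_on f (ball x e)" using U(3) that e(2) by (auto simp: real_analytic_on_def)
            show "\<forall>x\<in>ball q d. f x = 0" using d U(4) e(2) that by blast
          qed
          then show ?thesis using U(4) y e(2) by blast
        qed
        then have "ball x e \<subseteq> T" by blast
        then have "x \<in> interior T" using e(1) by (meson centre_in_ball interior_maximal open_ball subsetD)
        then show False using x by (simp add: W_def)
      qed
      then have "ball x (min e e') \<subseteq> W" using e' by (auto simp: W_def)
      then show ?thesis using e(1) e'(1) by (metis min_less_iff_conj)
    qed
  qed
  moreover have "M \<subseteq> interior T \<union> W" "interior T \<inter> W \<inter> M = {}" by (auto simp: W_def)
  ultimately have "W \<inter> M = {}"
    using connectedD[OF M(2) open_interior, of W T] int sub by blast
  then have "M \<subseteq> T" using interior_subset[of T] by (auto simp: W_def)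
  then show ?thesis using T by blast
qed

section \<open>Real lines and a cubic in the dual plane\<close>

text \<open>
  The zeros are the points of the complex line with real coefficient vector \<open>a\<close>.
\<close>

definition line_form :: "real^3 \<Rightarrow> complex^3 \<Rightarrow> complex" where
  "line_form a z = of_real (a$1) * z$1 + of_real (a$2) * z$2 + of_real (a$3) * z$3"

text \<open>
  The cross product of the real and the imaginary part of \<open>z\<close>: the real line through \<open>z\<close>.  It
  vanishes exactly at complex multiples of real vectors.
\<close>

definition real_line :: "complex^3 \<Rightarrow> real^3" where
  "real_line z = vector [Im (cnj (z$2) * z$3), Im (cnj (z$3) * z$1), Im (cnj (z$1) * z$2)]"

text \<open>
  In the affine coordinates \<open>x = v$1 / v$3\<close>, \<open>y = v$2 / v$3\<close> the curve is \<open>y\<^sup>2 = x\<^sup>3 - x\<close>.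
\<close>

definition cubic :: "real^3 \<Rightarrow> real" where
  "cubic v = (v$2)\<^sup>2 * v$3 - (v$1)^3 + v$1 * (v$3)\<^sup>2"

text \<open>
  On the affine part of the curve the separator equals \<open>x + y\<^sup>2 - 1/2 = x\<^sup>3 - 1/2\<close>, which is negative on
  the oval, where \<open>-1 \<le> x \<le> 0\<close>, and positive on the other component, where \<open>x \<ge> 1\<close>.  The term
  \<open>v$2\<^sup>2\<close> makes it positive also at the point at infinity.
\<close>

definition separator :: "real^3 \<Rightarrow> real" where
  "separator v = v$1 * v$3 + (v$2)\<^sup>2 - (v$3)\<^sup>2 / 2"

lemma real_line_nth [simp]:
  "real_line z $ 1 = Im (cnj (z$2) * z$3)" "real_line z $ 2 = Im (cnj (z$3) * z$1)"
  "real_line z $ 3 = Im (cnj (z$1) * z$2)"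
  by (simp_all add: real_line_def)

lemma vec3_eq_iff: "(a :: 'a^3) = b \<longleftrightarrow> a$1 = b$1 \<and> a$2 = b$2 \<and> a$3 = b$3"
  by (simp add: vec_eq_iff forall_3)

lemma vec2_eq_iff: "(a :: 'a^2) = b \<longleftrightarrow> a$1 = b$1 \<and> a$2 = b$2"
  by (simp add: vec_eq_iff forall_2)

lemma line_form_real_line: "line_form (real_line z) z = 0"
  by (auto simp: line_form_def complex_eq_iff algebra_simps)

lemma line_form_scale: "line_form (k *\<^sub>R a) z = of_real k * line_form a z" "line_form a (c *s z) = c * line_form a z"
  by (simp_all add: line_form_def algebra_simps)

lemma real_line_scale: "real_line (c *s z) = (cmod c)\<^sup>2 *\<^sub>R real_line z"
  unfolding cmod_power2 by (simp add: vec3_eq_iff power2_eq_square algebra_simps)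

text \<open>
  A real vector that annihilates \<open>z\<close> is orthogonal to its real and to its imaginary part, hence
  proportional to their cross product.
\<close>

lemma real_line_unique:
  assumes n: "real_line z \<noteq> 0" and a: "line_form a z = 0"
  obtains k where "a = k *\<^sub>R real_line z"
proof -
  let ?n = "real_line z"
  have r: "a$1 * Re (z$1) + a$2 * Re (z$2) + a$3 * Re (z$3) = 0"
    "a$1 * Im (z$1) + a$2 * Im (z$2) + a$3 * Im (z$3) = 0"
    using a by (auto simp: line_form_def complex_eq_iff)
  define x1 x2 x3 y1 y2 y3 where xy: "x1 = Re (z$1)" "x2 = Re (z$2)" "x3 = Re (z$3)" "y1 = Im (z$1)" "y2 = Im (z$2)" "y3 = Im (z$3)"
  have nn: "?n$1 = x2 * y3 - y2 * x3" "?n$2 = x3 * y1 - y3 * x1" "?n$3 = x1 * y2 - y1 * x2"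
    by (auto simp: xy)
  have r': "a$1 * x1 + a$2 * x2 + a$3 * x3 = 0" "a$1 * y1 + a$2 * y2 + a$3 * y3 = 0"
    using r by (auto simp: xy)
  have c: "a$1 * ?n$2 = a$2 * ?n$1" "a$2 * ?n$3 = a$3 * ?n$2" "a$1 * ?n$3 = a$3 * ?n$1"
    unfolding nn using r' by algebra+
  from n consider "?n$1 \<noteq> 0" | "?n$2 \<noteq> 0" | "?n$3 \<noteq> 0" by (auto simp: vec3_eq_iff)
  then show ?thesis
  proof cases
    case 1
    then show ?thesis using c that[of "a$1 / ?n$1"] by (auto simp: vec3_eq_iff field_simps)
  next
    case 2
    then show ?thesis using c that[of "a$2 / ?n$2"] by (auto simp: vec3_eq_iff field_simps)
  next
    case 3
    then show ?thesis using c that[of "a$3 / ?n$3"] by (auto simp: vec3_eq_iff field_simps)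
  qed
qed

section \<open>The two components of the cubic\<close>

text \<open>
  Parametrisations of the two components with period \<open>\<pi>\<close> up to scaling.  The oval is
  \<open>x = - cos\<^sup>2 t\<close>, the other component is \<open>x = 1 / cos\<^sup>2 t\<close>; in both cases \<open>x\<^sup>3 - x\<close> is a
  square up to the factor \<open>1 + cos\<^sup>2 t\<close>, whose root is analytic.  The second
  parametrisation is multiplied by \<open>cos\<^sup>3 t\<close>, so that it extends to the point at infinity.
\<close>

definition leaf :: "real \<Rightarrow> real \<Rightarrow> real^3" where
  "leaf \<sigma> t = (if \<sigma> = 1 then vector [cos t, sin t * sqrt (1 + (cos t)\<^sup>2), (cos t)^3]
     else vector [- (cos t)\<^sup>2, sin t * cos t * sqrt (1 + (cos t)\<^sup>2), 1])"

lemma cubic_scale: "cubic (k *\<^sub>R v) = k^3 * cubic v"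
  by (simp add: cubic_def power2_eq_square power3_eq_cube algebra_simps)

lemma cubic_0 [simp]: "cubic 0 = 0"
  by (simp add: cubic_def)

lemma separator_scale: "separator (k *\<^sub>R v) = k\<^sup>2 * separator v"
  by (simp add: separator_def power2_eq_square algebra_simps)

lemma sgn_square_mult: "k \<noteq> 0 \<Longrightarrow> sgn (k\<^sup>2 * x) = sgn (x::real)"
  by (simp add: sgn_real_def zero_less_mult_iff)

text \<open>
  If the cubic and the separator both vanish, then the ratio \<open>k\<close> of the first and the third coordinate satisfies
  \<open>k\<^sup>3 = 1/2\<close>, while the vanishing of the separator makes \<open>1/2 - k\<close> nonnegative.
\<close>

lemma separator_nonzero:
  assumes "cubic v = 0" "v \<noteq> 0"
  shows "separator v \<noteq> 0"
proof
  assume s: "separator v = 0"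
  define a b c where abc: "a = v$1" "b = v$2" "c = v$3"
  have 1: "b\<^sup>2 * c = a^3 - a * c\<^sup>2" using assms(1) by (simp add: cubic_def abc)
  have 2: "b\<^sup>2 = c\<^sup>2 / 2 - a * c" using s by (simp add: separator_def abc)
  have "a^3 = c^3 / 2" using 1 unfolding 2 by (simp add: power2_eq_square power3_eq_cube algebra_simps)
  have "c \<noteq> 0"
  proof
    assume "c = 0"
    then have "a = 0" "b = 0" using \<open>a^3 = c^3 / 2\<close> 2 by auto
    then show False using \<open>c = 0\<close> assms(2) by (simp add: abc vec3_eq_iff)
  qed
  define k where "k = a / c"
  have k3: "k^3 = 1 / 2" using \<open>a^3 = c^3 / 2\<close> \<open>c \<noteq> 0\<close> by (simp add: k_def power_divide)
  have "b\<^sup>2 = c\<^sup>2 * (1 / 2 - k)" unfolding 2 k_def using \<open>c \<noteq> 0\<close> by (simp add: power2_eq_square algebra_simps)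
  then have "0 \<le> c\<^sup>2 * (1 / 2 - k)" by (metis zero_le_power2)
  then have k: "k \<le> 1 / 2" using \<open>c \<noteq> 0\<close> by (simp add: zero_le_mult_iff)
  show False
  proof (cases "k \<ge> 0")
    case True
    then have "k^3 \<le> (1/2)^3" using k by (intro power_mono) auto
    then show False using k3 by (simp add: power3_eq_cube)
  next
    case False
    then have "k^3 < 0" by (simp add: power3_eq_cube mult_less_0_iff zero_less_mult_iff)
    then show False using k3 by simp
  qed
qed

lemma leaf_1_nth [simp]:
  "leaf 1 t $ 1 = cos t" "leaf 1 t $ 2 = sin t * sqrt (1 + (cos t)\<^sup>2)" "leaf 1 t $ 3 = (cos t)^3"
  by (simp_all add: leaf_def)

lemma leaf_m1_nth [simp]:
  "leaf (-1) t $ 1 = - (cos t)\<^sup>2" "leaf (-1) t $ 2 = sin t * cos t * sqrt (1 + (cos t)\<^sup>2)" "leaf (-1) t $ 3 = 1"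
  by (simp_all add: leaf_def)

lemma leaf_cubic:
  assumes "\<sigma> \<in> {-1, 1}"
  shows "cubic (leaf \<sigma> t) = 0"
proof -
  define c s r where "c = cos t" "s = sin t" "r = sqrt (1 + c\<^sup>2)"
  have cs: "s\<^sup>2 = 1 - c\<^sup>2" and r: "r\<^sup>2 = 1 + c\<^sup>2"
    by (simp_all add: c_s_r_def sin_squared_eq)
  consider "\<sigma> = 1" | "\<sigma> = -1" using assms by auto
  then show ?thesis
  proof cases
    case 1
    have "cubic (leaf \<sigma> t) = s\<^sup>2 * r\<^sup>2 * c^3 - c^3 + c * (c^3)\<^sup>2"
      by (simp add: 1 cubic_def c_s_r_def power_mult_distrib)
    also have "\<dots> = 0" unfolding cs r by algebra
    finally show ?thesis .
  next
    case 2
    have "cubic (leaf \<sigma> t) = s\<^sup>2 * c\<^sup>2 * r\<^sup>2 + (c\<^sup>2)^3 - c\<^sup>2"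
      by (simp add: 2 cubic_def c_s_r_def power_mult_distrib)
    also have "\<dots> = 0" unfolding cs r by algebra
    finally show ?thesis .
  qed
qed

lemma leaf_separator:
  assumes "\<sigma> \<in> {-1, 1}"
  shows "sgn (separator (leaf \<sigma> t)) = \<sigma>"
proof -
  define c s r where "c = cos t" "s = sin t" "r = sqrt (1 + c\<^sup>2)"
  have cs: "s\<^sup>2 = 1 - c\<^sup>2" and r: "r\<^sup>2 = 1 + c\<^sup>2"
    by (simp_all add: c_s_r_def sin_squared_eq)
  have c2: "0 \<le> c\<^sup>2" "c\<^sup>2 \<le> 1" using cs zero_le_power2[of s] by auto
  have c6: "(c\<^sup>2)^3 \<le> 1" "(c\<^sup>2)^3 \<ge> 0" using power_le_one[OF c2, of 3] by simp_all
  consider "\<sigma> = 1" | "\<sigma> = -1" using assms by auto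
  then show ?thesis
  proof cases
    case 1
    have "separator (leaf \<sigma> t) = c * c^3 + s\<^sup>2 * r\<^sup>2 - (c^3)\<^sup>2 / 2"
      by (simp add: 1 separator_def c_s_r_def power_mult_distrib)
    also have "\<dots> = 1 - (c\<^sup>2)^3 / 2" unfolding cs r by algebra
    finally show ?thesis using 1 c6 by simp
  next
    case 2
    have "separator (leaf \<sigma> t) = - c\<^sup>2 + s\<^sup>2 * c\<^sup>2 * r\<^sup>2 - 1 / 2"
      by (simp add: 2 separator_def c_s_r_def power_mult_distrib)
    also have "\<dots> = - ((c\<^sup>2)^3) - 1 / 2" unfolding cs r by algebra
    finally have "separator (leaf \<sigma> t) < 0" using c6(2) by linarith
    then show ?thesis by (simp add: 2)
  qed
qed

lemma leaf_nonzero: "\<sigma> \<in> {-1, 1} \<Longrightarrow> leaf \<sigma> t \<noteq> 0"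
  using leaf_separator[of \<sigma> t] by (auto simp: separator_def)

lemma exists_angle:
  assumes "x\<^sup>2 + y\<^sup>2 = (1::real)"
  obtains t where "cos t = x" "sin t = y"
  using sincos_total_2pi[OF assms] by metis

text \<open>
  In the affine coordinates of \<open>v\<close>, the abscissa \<open>x\<close> determines \<open>cos\<^sup>2 t\<close>, as \<open>1 / x\<close> or \<open>- x\<close>; with
  \<open>cos t\<close> chosen nonnegative, the sign of the ordinate is the sign of \<open>sin t\<close>.
\<close>

lemma leaf_surj:
  assumes v: "cubic v = 0" "v \<noteq> 0"
  obtains \<sigma> t k where "\<sigma> \<in> {-1, 1}" "k \<noteq> 0" "v = k *\<^sub>R leaf \<sigma> t"
proof (cases "v$3 = 0")
  case True
  then have "v$1 = 0" using v(1) by (simp add: cubic_def)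
  then have "v = (v$2) *\<^sub>R leaf 1 (pi / 2)" "v$2 \<noteq> 0" using True v(2) by (auto simp: vec3_eq_iff)
  then show ?thesis using that[of 1] by blast
next
  case False
  define x y where "x = v$1 / v$3" "y = v$2 / v$3"
  have v': "v$1 = v$3 * x" "v$2 = v$3 * y" using False by (auto simp: x_y_def)
  have "v$3^3 * (y\<^sup>2 - x^3 + x) = 0"
    using v(1) unfolding cubic_def v' by (simp add: power2_eq_square power3_eq_cube algebra_simps)
  then have "y\<^sup>2 - x^3 + x = 0" using False by simp
  then have y: "y\<^sup>2 = x * (x\<^sup>2 - 1)" by (simp add: power2_eq_square power3_eq_cube algebra_simps)
  define e where "e = (if y \<ge> 0 then 1 else - 1 :: real)"
  have e: "e * \<bar>y\<bar> = y" "e\<^sup>2 = 1" by (auto simp: e_def)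
  have nn: "0 \<le> x * (x\<^sup>2 - 1)" using y by (metis zero_le_power2)
  show ?thesis
  proof (cases "x > 0")
    case True
    then have "1 \<le> x\<^sup>2" using nn by (simp add: zero_le_mult_iff)
    then have x1: "x \<ge> 1" using True power2_le_imp_le[of 1 x] by simp
    have ix: "0 \<le> 1 - 1/x" using x1 by simp
    obtain t where t: "cos t = sqrt (1 / x)" "sin t = e * sqrt (1 - 1 / x)"
      by (rule exists_angle[of "sqrt (1 / x)" "e * sqrt (1 - 1/x)"]) (use x1 in \<open>simp add: power_mult_distrib e\<close>)
    have c2: "(cos t)\<^sup>2 = 1 / x" using x1 by (simp add: t)
    have c0: "cos t > 0" using x1 by (simp add: t)
    have c3: "(cos t)^3 = cos t / x" using c2 by (simp add: power3_eq_cube power2_eq_square)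
    have "sqrt (1 - 1/x) * sqrt (1 + 1/x) = \<bar>y\<bar> * (cos t / x)"
    proof (rule power2_eq_imp_eq)
      have "(sqrt (1 - 1/x) * sqrt (1 + 1/x))\<^sup>2 = (1 - 1/x) * (1 + 1/x)"
        using ix x1 by (simp add: power_mult_distrib)
      also have "\<dots> = y\<^sup>2 * ((1 / x) / x\<^sup>2)" unfolding y using x1 by (simp add: field_simps power2_eq_square)
      also have "\<dots> = (\<bar>y\<bar> * (cos t / x))\<^sup>2" by (simp add: power_mult_distrib power_divide c2)
      finally show "(sqrt (1 - 1/x) * sqrt (1 + 1/x))\<^sup>2 = (\<bar>y\<bar> * (cos t / x))\<^sup>2" .
    qed (use ix x1 c0 in auto)
    then have "sin t * sqrt (1 + (cos t)\<^sup>2) = y * (cos t / x)"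
      unfolding t(2) c2 using e(1) by (metis mult.assoc)
    then have "v = (v$3 * x / cos t) *\<^sub>R leaf 1 t"
      using c0 x1 by (simp add: vec3_eq_iff v' c3)
    moreover have "v$3 * x / cos t \<noteq> 0" using False x1 c0 by auto
    ultimately show ?thesis using that[of 1] by blast
  next
    case False
    have "x = 0 \<or> x\<^sup>2 \<le> 1" using nn False by (auto simp: zero_le_mult_iff)
    then have "x\<^sup>2 \<le> 1" by auto
    then have x1: "-1 \<le> x" "x \<le> 0" using False abs_le_square_iff[of x 1] by auto
    obtain t where t: "cos t = sqrt (- x)" "sin t = e * sqrt (1 + x)"
      by (rule exists_angle[of "sqrt (- x)" "e * sqrt (1 + x)"]) (use x1 in \<open>simp add: power_mult_distrib e\<close>)
    have c2: "(cos t)\<^sup>2 = - x" using x1 by (simp add: t)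
    have "sqrt (1 + x) * sqrt (- x) * sqrt (1 - x) = \<bar>y\<bar>"
    proof (rule power2_eq_imp_eq)
      have "(sqrt (1 + x) * sqrt (- x) * sqrt (1 - x))\<^sup>2 = (1 + x) * (- x) * (1 - x)"
        using x1 by (simp add: power_mult_distrib)
      also have "\<dots> = \<bar>y\<bar>\<^sup>2" unfolding power2_abs y by (simp add: power2_eq_square algebra_simps)
      finally show "(sqrt (1 + x) * sqrt (- x) * sqrt (1 - x))\<^sup>2 = \<bar>y\<bar>\<^sup>2" .
    qed (use x1 in auto)
    then have "e * sqrt (1 + x) * sqrt (- x) * sqrt (1 - x) = y" using e(1) by (simp add: mult.assoc)
    moreover have "sqrt (1 + (cos t)\<^sup>2) = sqrt (1 - x)" by (simp add: c2)
    ultimately have "sin t * cos t * sqrt (1 + (cos t)\<^sup>2) = y" unfolding t by simp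
    then have "v = (v$3) *\<^sub>R leaf (-1) t"
      by (simp add: vec3_eq_iff v' c2)
    then show ?thesis using that[of "-1"] \<open>v$3 \<noteq> 0\<close> by blast
  qed
qed

lemma leaf_iff:
  assumes "\<sigma> \<in> {-1, 1}" "v \<noteq> 0"
  shows "cubic v = 0 \<and> sgn (separator v) = \<sigma> \<longleftrightarrow> (\<exists>t k. k \<noteq> 0 \<and> v = k *\<^sub>R leaf \<sigma> t)"
proof
  assume v: "cubic v = 0 \<and> sgn (separator v) = \<sigma>"
  obtain \<sigma>' t k where k: "\<sigma>' \<in> {-1, 1}" "k \<noteq> 0" "v = k *\<^sub>R leaf \<sigma>' t"
    using leaf_surj v assms(2) by metis
  have "sgn (separator v) = \<sigma>'"
    using k by (simp add: separator_scale sgn_square_mult leaf_separator)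
  then show "\<exists>t k. k \<noteq> 0 \<and> v = k *\<^sub>R leaf \<sigma> t" using k v by blast
next
  assume "\<exists>t k. k \<noteq> 0 \<and> v = k *\<^sub>R leaf \<sigma> t"
  then show "cubic v = 0 \<and> sgn (separator v) = \<sigma>"
    using assms by (auto simp: separator_scale cubic_scale sgn_square_mult leaf_separator leaf_cubic)
qed

text \<open>
  The set of \<open>\<sigma>\<close> in \<open>J\<close> selects the components: \<open>-1\<close> is the oval, \<open>1\<close> the other one.  The real
  points always belong to the cone.  The leaves of the oval pass through only some of them; near the boundary
  of the part that they cover, the other real points cannot be omitted from an analytic set, like the
  handle of a Whitney umbrella.
\<close>

definition web_cone :: "real set \<Rightarrow> (complex^3) set" where
  "web_cone J = {z. real_line z = 0 \<or> cubic (real_line z) = 0 \<and> sgn (separator (real_line z)) \<in> J}"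

lemma web_cone_iff_leaf:
  assumes "J \<subseteq> {-1, 1}"
  shows "z \<in> web_cone J \<longleftrightarrow> real_line z = 0 \<or> (\<exists>\<sigma>\<in>J. \<exists>t. line_form (leaf \<sigma> t) z = 0)"
proof (cases "real_line z = 0")
  case False
  have "cubic (real_line z) = 0 \<and> sgn (separator (real_line z)) = \<sigma> \<longleftrightarrow> (\<exists>t. line_form (leaf \<sigma> t) z = 0)"
    if \<sigma>: "\<sigma> \<in> J" for \<sigma>
  proof -
    have \<sigma>': "\<sigma> \<in> {-1, 1}" using \<sigma> assms by auto
    show ?thesis unfolding leaf_iff[OF \<sigma>' False]
    proof
      assume "\<exists>t k. k \<noteq> 0 \<and> real_line z = k *\<^sub>R leaf \<sigma> t"
      then obtain t k where "k \<noteq> 0" "real_line z = k *\<^sub>R leaf \<sigma> t" by blast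
      then have "of_real k * line_form (leaf \<sigma> t) z = 0" using line_form_real_line[of z] by (simp add: line_form_scale)
      then show "\<exists>t. line_form (leaf \<sigma> t) z = 0" using \<open>k \<noteq> 0\<close> by auto
    next
      assume "\<exists>t. line_form (leaf \<sigma> t) z = 0"
      then obtain t where t: "line_form (leaf \<sigma> t) z = 0" by blast
      obtain k where k: "leaf \<sigma> t = k *\<^sub>R real_line z" using real_line_unique[OF False t] .
      have "k \<noteq> 0" using k leaf_nonzero[OF \<sigma>'] by auto
      then have "inverse k \<noteq> 0" "real_line z = inverse k *\<^sub>R leaf \<sigma> t" by (auto simp: k)
      then show "\<exists>t k. k \<noteq> 0 \<and> real_line z = k *\<^sub>R leaf \<sigma> t" by blast
    qed
  qed
  then show ?thesis unfolding web_cone_def mem_Collect_eq using False by blast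
qed (simp add: web_cone_def)

lemma web_cone_scale:
  assumes "c \<noteq> 0"
  shows "c *s z \<in> web_cone J \<longleftrightarrow> z \<in> web_cone J"
proof -
  have "sgn (separator (real_line (c *s z))) = sgn (separator (real_line z))"
    unfolding real_line_scale separator_scale by (rule sgn_square_mult) (use assms in simp)
  moreover have "cubic (real_line (c *s z)) = 0 \<longleftrightarrow> cubic (real_line z) = 0"
    "real_line (c *s z) = 0 \<longleftrightarrow> real_line z = 0"
    unfolding real_line_scale cubic_scale using assms by auto
  ultimately show ?thesis by (simp add: web_cone_def)
qed

lemma web_cone_all: "z \<in> web_cone {-1, 1} \<longleftrightarrow> cubic (real_line z) = 0"
  using separator_nonzero[of "real_line z"]
  by (cases "real_line z = 0") (auto simp: web_cone_def sgn_real_def cubic_0)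

text \<open>
  The separator distinguishes the components.  On one component, proportional leaves have the same
  \<open>cos\<^sup>2 t\<close>, hence the same root; what remains is that \<open>(cos t, sin t)\<close> is determined up to sign.
\<close>

lemma leaf_inj:
  assumes "\<sigma> \<in> {-1, 1}" "\<sigma>' \<in> {-1, 1}" "leaf \<sigma> t = k *\<^sub>R leaf \<sigma>' t'"
  shows "\<sigma> = \<sigma>' \<and> sin (t - t') = 0"
proof
  have "k \<noteq> 0" using assms(3) leaf_nonzero[OF assms(1)] by auto
  then have "sgn (separator (leaf \<sigma> t)) = sgn (separator (leaf \<sigma>' t'))"
    unfolding assms(3) by (simp add: separator_scale sgn_square_mult)
  then show ss: "\<sigma> = \<sigma>'" using leaf_separator assms by metis
  define c s r c' s' r' where d: "c = cos t" "s = sin t" "r = sqrt (1 + c\<^sup>2)" "c' = cos t'" "s' = sin t'" "r' = sqrt (1 + c'\<^sup>2)"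
  have cs: "s\<^sup>2 + c\<^sup>2 = 1" "s'\<^sup>2 + c'\<^sup>2 = 1" by (auto simp: d)
  have r: "r > 0" "r' > 0" by (auto simp: d add_pos_nonneg)
  have rr: "r = r'" if "c\<^sup>2 = c'\<^sup>2" using that by (simp add: d)
  have "s * c' = c * s'"
  proof (cases "\<sigma> = 1")
    case True
    then have e: "c = k * c'" "s * r = k * (s' * r')" "c^3 = k * c'^3"
      using assms(3) ss by (auto simp: vec3_eq_iff d)
    show ?thesis
    proof (cases "c' = 0")
      case True
      then show ?thesis using e(1) by simp
    next
      case False
      have "k^3 * c'^3 = k * c'^3" using e(1,3) by (simp add: power_mult_distrib)
      then have "k^3 = k" using False by simp
      then have k2: "k\<^sup>2 = 1" using \<open>k \<noteq> 0\<close> by (simp add: power3_eq_cube power2_eq_square)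
      then have "c\<^sup>2 = c'\<^sup>2" using e(1) by (simp add: power_mult_distrib)
      then have "s = k * s'" using e(2) rr r by simp
      then show ?thesis using e(1) by simp
    qed
  next
    case False
    then have s1: "\<sigma> = -1" using assms(1) by simp
    then have e: "k = 1" "c\<^sup>2 = k * c'\<^sup>2" "s * c * r = k * (s' * c' * r')"
      using assms(3) ss by (auto simp: vec3_eq_iff d)
    then have cc: "c\<^sup>2 = c'\<^sup>2" by simp
    then have sc: "s * c = s' * c'" using e rr[OF cc] r by simp
    show ?thesis
    proof (cases "c' = 0")
      case True
      then show ?thesis using cc by simp
    next
      case False
      from cc have "c = c' \<or> c = - c'" by (simp add: power2_eq_iff)
      then show ?thesis using sc by (elim disjE) algebra+
    qed
  qed
  then show "sin (t - t') = 0" by (simp add: sin_diff d)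
qed

lemma leaf_period: "\<exists>k. k \<noteq> 0 \<and> leaf \<sigma> (t + pi * of_int n) = k *\<^sub>R leaf \<sigma> t"
proof -
  define e :: real where "e = cos (pi * of_int n)"
  have s: "sin (pi * of_int n) = 0" using sin_zero_iff_int2 by (metis mult.commute)
  then have e2: "e\<^sup>2 = 1" unfolding e_def by (simp add: cos_squared_eq)
  then have e: "e * e = 1" "e \<noteq> 0" "e^3 = e" by (auto simp: power2_eq_square power3_eq_cube)
  have "cos (t + pi * of_int n) = e * cos t" "sin (t + pi * of_int n) = e * sin t"
    by (simp_all add: cos_add sin_add s e_def)
  then have "leaf \<sigma> (t + pi * of_int n) = (if \<sigma> = 1 then e else 1) *\<^sub>R leaf \<sigma> t"
    using e by (simp add: leaf_def vec3_eq_iff power_mult_distrib e2 mult.assoc mult.left_commute)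
  then show ?thesis using e(2) by (metis zero_neq_one)
qed

lemma leaf_reduce:
  "\<exists>s k. c - pi / 2 \<le> s \<and> s < c + pi / 2 \<and> k \<noteq> 0 \<and> leaf \<sigma> t = k *\<^sub>R leaf \<sigma> s"
proof -
  define n where "n = \<lfloor>(t - c + pi / 2) / pi\<rfloor>"
  define s where "s = t - pi * of_int n"
  have "of_int n \<le> (t - c + pi / 2) / pi" "(t - c + pi / 2) / pi < of_int n + 1"
    unfolding n_def by linarith+
  then have "c - pi / 2 \<le> s" "s < c + pi / 2" by (auto simp: s_def field_simps)
  moreover have "\<exists>k. k \<noteq> 0 \<and> leaf \<sigma> t = k *\<^sub>R leaf \<sigma> s"
    using leaf_period[of \<sigma> s n] by (simp add: s_def)
  ultimately show ?thesis by blast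
qed

definition leaf_deriv :: "real \<Rightarrow> real \<Rightarrow> real^3" where
  "leaf_deriv \<sigma> t = (let c = cos t; s = sin t; r = sqrt (1 + c\<^sup>2) in
     if \<sigma> = 1 then vector [- s, c * r - s\<^sup>2 * c / r, - (3 * c\<^sup>2 * s)]
     else vector [2 * s * c, (c\<^sup>2 - s\<^sup>2) * r - s\<^sup>2 * c\<^sup>2 / r, 0])"

lemma leaf_has_derivative: "((\<lambda>t. leaf \<sigma> t $ i) has_real_derivative leaf_deriv \<sigma> t $ i) (at t)"
proof -
  have p: "1 + (cos t)\<^sup>2 > 0" by (simp add: add_pos_nonneg)
  have r: "((\<lambda>t. sqrt (1 + (cos t)\<^sup>2)) has_real_derivative - (sin t * cos t / sqrt (1 + (cos t)\<^sup>2))) (at t)"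
  proof -
    have "((\<lambda>t. 1 + (cos t)\<^sup>2) has_real_derivative - (2 * cos t * sin t)) (at t)"
      by (auto intro!: derivative_eq_intros)
    then have "((\<lambda>t. sqrt (1 + (cos t)\<^sup>2)) has_real_derivative
        inverse (sqrt (1 + (cos t)\<^sup>2)) / 2 * - (2 * cos t * sin t)) (at t)"
      by (rule DERIV_chain2[where f = sqrt and g = "\<lambda>t. 1 + (cos t)\<^sup>2", OF DERIV_real_sqrt[OF p]])
    moreover have "inverse R / 2 * - (2 * C * S) = - (S * C / R)" for R C S :: real
      by (simp add: field_simps)
    ultimately show ?thesis by metis
  qed
  define R where "R t = sqrt (1 + (cos t)\<^sup>2)" for t
  have R: "(R has_real_derivative - (sin t * cos t / R t)) (at t)"
    using r unfolding R_def by simp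
  have l: "leaf \<sigma> t = (if \<sigma> = 1 then vector [cos t, sin t * R t, (cos t)^3]
     else vector [- (cos t)\<^sup>2, sin t * cos t * R t, 1])" for t
    by (simp add: leaf_def R_def)
  have "i = 1 \<or> i = 2 \<or> i = 3" by (rule exhaust_3)
  then show ?thesis
    unfolding l leaf_deriv_def Let_def R_def[symmetric]
    by (cases "\<sigma> = 1"; elim disjE)
      (auto simp: algebra_simps power2_eq_square power3_eq_cube intro!: derivative_eq_intros R)
qed

text \<open>
  The tangent line of the curve at a leaf is well defined; with \<open>c = cos t\<close>, the relevant minor is a positive multiple of
  \<open>1 + c\<^sup>4\<close> on the unbounded component.
\<close>

lemma leaf_immersion:
  assumes "\<sigma> \<in> {-1, 1}" "\<alpha> *\<^sub>R leaf \<sigma> t + \<beta> *\<^sub>R leaf_deriv \<sigma> t = 0"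
  shows "\<alpha> = 0 \<and> \<beta> = 0"
proof -
  define c s r where d: "c = cos t" "s = sin t" "r = sqrt (1 + c\<^sup>2)"
  have cs: "s\<^sup>2 = 1 - c\<^sup>2" by (simp_all add: d sin_squared_eq)
  have r: "r > 0" "r * r = 1 + c\<^sup>2" by (auto simp: d add_pos_nonneg)
  consider "\<sigma> = 1" | "\<sigma> = -1" using assms by auto
  then have "\<beta> = 0"
  proof cases
    case 1
    then have e: "\<alpha> * c - \<beta> * s = 0" "\<alpha> * (s * r) + \<beta> * (c * r - s\<^sup>2 * c / r) = 0"
      using assms(2) by (auto simp: vec3_eq_iff leaf_deriv_def Let_def d)
    have "\<beta> * (c * (c * r - s\<^sup>2 * c / r) + s * (s * r)) = 0" using e by algebra
    moreover have "(c * (c * r - s\<^sup>2 * c / r) + s * (s * r)) * r = 1 + c^4"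
    proof -
      have "(c * (c * r - s\<^sup>2 * c / r) + s * (s * r)) * r = c\<^sup>2 * (r * r) - s\<^sup>2 * c\<^sup>2 + s\<^sup>2 * (r * r)"
        using r(1) by (simp add: field_simps power2_eq_square)
      also have "\<dots> = 1 + c^4" unfolding r(2) cs by algebra
      finally show ?thesis .
    qed
    moreover have "1 + c^4 > 0" by (simp add: add_pos_nonneg)
    ultimately show ?thesis by force
  next
    case 2
    then have e: "\<alpha> = 0" "\<beta> * (s * c) = 0" "\<beta> * ((c\<^sup>2 - s\<^sup>2) * r - s\<^sup>2 * c\<^sup>2 / r) = 0"
      using assms(2) by (auto simp: vec3_eq_iff leaf_deriv_def Let_def d)
    show ?thesis
    proof (rule ccontr)
      assume "\<beta> \<noteq> 0"
      then have "s * c = 0" "(c\<^sup>2 - s\<^sup>2) * r = s\<^sup>2 * c\<^sup>2 / r" using e by auto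
      then have "c\<^sup>2 = s\<^sup>2" using r(1) by auto
      then show False using \<open>s * c = 0\<close> cs by auto
    qed
  qed
  then show ?thesis using assms leaf_nonzero[OF assms(1), of t] by simp
qed

section \<open>Charts and homogeneous sets\<close>

text \<open>
  The charts are handled through their lifts to homogeneous coordinates, which are affine maps.
\<close>

definition chart_lifts :: "(complex^2 \<Rightarrow> complex^3) set" where
  "chart_lifts = {\<lambda>w. vector [1, w$1, w$2], \<lambda>w. vector [w$1, 1, w$2], \<lambda>w. vector [w$1, w$2, 1]}"

lemma affine_charts_eq_lifts: "affine_charts = (\<lambda>A w. hpoint (A w)) ` chart_lifts"
  by (simp add: affine_charts_def chart_lifts_def)

lemma lift_nonzero: "A \<in> chart_lifts \<Longrightarrow> A w \<noteq> 0"
  by (auto simp: chart_lifts_def vec3_eq_iff)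

lemma lift_cases:
  assumes "z \<noteq> 0"
  obtains A w c where "A \<in> chart_lifts" "c \<noteq> 0" "z = c *s A w"
proof -
  consider "z$1 \<noteq> 0" | "z$2 \<noteq> 0" | "z$3 \<noteq> 0" using assms by (auto simp: vec3_eq_iff)
  then show ?thesis
  proof cases
    case 1
    show ?thesis
      by (rule that[of "\<lambda>w. vector [1, w$1, w$2]" "z$1" "vector [z$2 / z$1, z$3 / z$1]"])
        (use 1 in \<open>auto simp: chart_lifts_def vec3_eq_iff\<close>)
  next
    case 2
    show ?thesis
      by (rule that[of "\<lambda>w. vector [w$1, 1, w$2]" "z$2" "vector [z$1 / z$2, z$3 / z$2]"])
        (use 2 in \<open>auto simp: chart_lifts_def vec3_eq_iff\<close>)
  next
    case 3
    show ?thesis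
      by (rule that[of "\<lambda>w. vector [w$1, w$2, 1]" "z$3" "vector [z$1 / z$3, z$2 / z$3]"])
        (use 3 in \<open>auto simp: chart_lifts_def vec3_eq_iff\<close>)
  qed
qed

lemma real_line_lift_0_iff:
  "A \<in> chart_lifts \<Longrightarrow> real_line (A w) = 0 \<longleftrightarrow> Im (w$1) = 0 \<and> Im (w$2) = 0"
  by (auto simp: chart_lifts_def vec3_eq_iff)

lemma hpoint_eq_iff: "hpoint z = hpoint w \<longleftrightarrow> (\<exists>c. c \<noteq> 0 \<and> w = c *s z)" if "z \<noteq> 0" "w \<noteq> 0"
proof -
  have r: "proj_rel z z" "proj_rel w w"
    using that by (auto simp: proj_rel_def intro!: exI[of _ 1])
  have "proj_rel z w \<longleftrightarrow> abs_projective_plane z = abs_projective_plane w"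
    using Quotient_rel[OF Quotient_projective_plane, of z w] r by blast
  then show ?thesis using that by (auto simp: hpoint_def proj_rel_def)
qed

lemma hpoint_scale: "z \<noteq> 0 \<Longrightarrow> c \<noteq> 0 \<Longrightarrow> hpoint (c *s z) = hpoint z"
  by (subst eq_commute, subst hpoint_eq_iff) (auto simp: vec_eq_iff)

text \<open>
  The subset of the plane with cone \<open>C\<close>.
\<close>

definition locus :: "(complex^3) set \<Rightarrow> projective_plane set" where
  "locus C = hpoint ` {z. z \<noteq> 0 \<and> z \<in> C}"

definition scale_invariant :: "(complex^3) set \<Rightarrow> bool" where
  "scale_invariant C \<longleftrightarrow> (\<forall>z c. c \<noteq> 0 \<longrightarrow> z \<in> C \<longrightarrow> c *s z \<in> C)"

lemma hpoint_in_locus: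
  assumes "scale_invariant C" "z \<noteq> 0"
  shows "hpoint z \<in> locus C \<longleftrightarrow> z \<in> C"
proof
  assume "hpoint z \<in> locus C"
  then obtain w where w: "w \<noteq> 0" "w \<in> C" "hpoint w = hpoint z" by (auto simp: locus_def)
  then show "z \<in> C" using hpoint_eq_iff[OF w(1) assms(2)] assms(1) by (auto simp: scale_invariant_def)
qed (use assms in \<open>auto simp: locus_def\<close>)

lemma hpoint_surj: obtains z where "z \<noteq> 0" "hpoint z = p"
proof -
  have "proj_rel (rep_projective_plane p) (rep_projective_plane p)"
    by (rule Quotient_rep_reflp[OF Quotient_projective_plane])
  then have "rep_projective_plane p \<noteq> 0" by (simp add: proj_rel_def)
  moreover have "hpoint (rep_projective_plane p) = p"
    unfolding hpoint_def by (rule Quotient_abs_rep[OF Quotient_projective_plane])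
  ultimately show ?thesis using that by blast
qed

lemma projective_set_subset_iff: "Y \<subseteq> Z \<longleftrightarrow> (\<forall>z. z \<noteq> 0 \<longrightarrow> hpoint z \<in> Y \<longrightarrow> hpoint z \<in> Z)"
  by (metis hpoint_surj subset_iff)

lemma closed_locus:
  assumes "scale_invariant C" "closed C"
  shows "closed (locus C)"
proof -
  have "{z. z \<noteq> 0 \<and> hpoint z \<in> - locus C} = - {0} \<inter> - C"
    using hpoint_in_locus[OF assms(1)] by auto
  then show ?thesis
    using assms(2) unfolding closed_def open_projective_plane_def by (metis closed_def closed_singleton open_Int)
qed

lemma vimage_chart_locus:
  assumes "scale_invariant C" "A \<in> chart_lifts"
  shows "(\<lambda>w. hpoint (A w)) -` locus C = {w. A w \<in> C}"
  using hpoint_in_locus[OF assms(1) lift_nonzero[OF assms(2)]] by auto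

definition web :: "real set \<Rightarrow> projective_plane set" where
  "web J = locus (web_cone J)"

lemma web_cone_invariant: "scale_invariant (web_cone J)"
  by (simp add: scale_invariant_def web_cone_scale)

lemmas hpoint_in_web = hpoint_in_locus[OF web_cone_invariant, folded web_def]
lemmas vimage_chart_web = vimage_chart_locus[OF web_cone_invariant, folded web_def]

lemma web_cone_single:
  assumes "\<sigma> \<in> {-1, 1}"
  shows "z \<in> web_cone {\<sigma>} \<longleftrightarrow> cubic (real_line z) = 0 \<and> 0 \<le> \<sigma> * separator (real_line z)"
proof (cases "real_line z = 0")
  case False
  then show ?thesis
    using separator_nonzero[OF _ False] assms by (auto simp: web_cone_def sgn_real_def split: if_splits)
qed (simp add: web_cone_def separator_def)

lemma continuous_real_line [continuous_intros]:
  "continuous_on S f \<Longrightarrow> continuous_on S (\<lambda>x. real_line (f x) $ i)"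
proof -
  assume f: "continuous_on S f"
  have "i = 1 \<or> i = 2 \<or> i = 3" by (rule exhaust_3)
  then show ?thesis
    by (elim disjE) (auto intro!: continuous_intros f)
qed

lemma closed_web_cone:
  assumes "J \<in> {{-1}, {1}, {-1, 1}}"
  shows "closed (web_cone J)"
proof -
  have c: "continuous_on UNIV (\<lambda>z. cubic (real_line z))" "continuous_on UNIV (\<lambda>z. separator (real_line z))"
    unfolding cubic_def separator_def by (intro continuous_intros; simp)+
  have "closed (web_cone {\<sigma>})" if "\<sigma> \<in> {-1, 1}" for \<sigma>
  proof -
    have "web_cone {\<sigma>} = {z. cubic (real_line z) = 0 \<and> 0 \<le> \<sigma> * separator (real_line z)}"
      using web_cone_single[OF that] by auto
    then show ?thesis
      by (auto intro!: closed_Collect_conj closed_Collect_eq closed_Collect_le continuous_intros c)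
  qed
  moreover have "closed (web_cone {-1, 1})"
  proof -
    have "web_cone {-1, 1} = {z. cubic (real_line z) = 0}" using web_cone_all by auto
    then show ?thesis by (auto intro!: closed_Collect_eq continuous_intros c)
  qed
  ultimately show ?thesis using assms by auto
qed

section \<open>Polynomials in a chart\<close>

lemma bounded_linear_Re_nth: "bounded_linear (\<lambda>w. Re (w $ i))"
  by (rule bounded_linear_compose[OF bounded_linear_Re bounded_linear_vec_nth])

lemma bounded_linear_Im_nth: "bounded_linear (\<lambda>w. Im (w $ i))"
  by (rule bounded_linear_compose[OF bounded_linear_Im bounded_linear_vec_nth])

lemmas polyfun_intros = real_polynomial_function.intros(2) real_polynomial_function.intros(3)
  real_polynomial_function.intros(4) real_polynomial_function_diff
  real_polynomial_function_minus real_polynomial_function_power real_polynomial_function_divide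
  real_polynomial_function.intros(1)[OF bounded_linear_Re_nth]
  real_polynomial_function.intros(1)[OF bounded_linear_Im_nth]

lemma polyfun_lift:
  assumes "A \<in> chart_lifts"
  shows "real_polynomial_function (\<lambda>w. Re (A w $ i))" "real_polynomial_function (\<lambda>w. Im (A w $ i))"
proof -
  have "i = 1 \<or> i = 2 \<or> i = 3" by (rule exhaust_3)
  then have "real_polynomial_function (\<lambda>w. Re (A w $ i)) \<and> real_polynomial_function (\<lambda>w. Im (A w $ i))"
    using assms unfolding chart_lifts_def by (elim disjE insertE emptyE) (auto intro!: polyfun_intros)
  then show "real_polynomial_function (\<lambda>w. Re (A w $ i))" "real_polynomial_function (\<lambda>w. Im (A w $ i))"
    by blast+
qed

lemma polyfun_real_line_lift:
  assumes "A \<in> chart_lifts"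
  shows "real_polynomial_function (\<lambda>w. real_line (A w) $ i)"
proof -
  have "i = 1 \<or> i = 2 \<or> i = 3" by (rule exhaust_3)
  then show ?thesis
    by (elim disjE) (auto intro!: polyfun_intros polyfun_lift[OF assms])
qed

lemma polyfun_cubic_lift: "A \<in> chart_lifts \<Longrightarrow> real_polynomial_function (\<lambda>w. cubic (real_line (A w)))"
  unfolding cubic_def by (intro polyfun_intros polyfun_real_line_lift)

lemma polyfun_separator_lift: "A \<in> chart_lifts \<Longrightarrow> real_polynomial_function (\<lambda>w. separator (real_line (A w)))"
  unfolding separator_def by (intro polyfun_intros polyfun_real_line_lift)

lemma continuous_on_polyfun: "real_polynomial_function f \<Longrightarrow> continuous_on S f"
  using continuous_on_polymonial_function real_polynomial_function_eq by blast

lemma real_analytic_on_polyfun: "real_polynomial_function f \<Longrightarrow> real_analytic_on f S"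
  by (simp add: real_analytic_on_def real_analytic_at_polynomial)

lemma analytic_set_nearI:
  assumes "open U" "p \<in> U" "\<And>f. f \<in> F \<Longrightarrow> real_analytic_on f U"
    "\<And>x. x \<in> U \<Longrightarrow> x \<in> X \<longleftrightarrow> (\<forall>f\<in>F. f x = 0)"
  shows "analytic_set_near X p"
  unfolding analytic_set_near_def using assms by (intro exI[of _ U] exI[of _ F]) auto

section \<open>Slices with fixed real part\<close>

text \<open>
  The real line through the point with real part \<open>Re w\<close> and imaginary part \<open>v\<close>.  In a chart this is
  linear in \<open>v\<close>, so the cubic becomes a binary cubic form in \<open>v\<close>.
\<close>

definition slice :: "(complex^2 \<Rightarrow> complex^3) \<Rightarrow> complex^2 \<Rightarrow> real^2 \<Rightarrow> real^3" where
  "slice A w v = real_line (A (\<chi> i. Complex (Re (w$i)) (v$i)))"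

definition Im_vec :: "complex^2 \<Rightarrow> real^2" where
  "Im_vec w = (\<chi> i. Im (w$i))"

lemma Im_vec_nth [simp]: "Im_vec w $ i = Im (w $ i)"
  by (simp add: Im_vec_def)

lemma Im_vec_0_iff: "Im_vec w = 0 \<longleftrightarrow> Im (w$1) = 0 \<and> Im (w$2) = 0"
  by (simp add: vec2_eq_iff)

lemma slice_Im_vec: "slice A w (Im_vec w) = real_line (A w)"
proof -
  have "(\<chi> i. Complex (Re (w$i)) (Im_vec w $ i)) = w" by (simp add: vec_eq_iff)
  then show ?thesis by (simp add: slice_def)
qed

lemma slice_linear:
  "A \<in> chart_lifts \<Longrightarrow> slice A w (s *\<^sub>R a + t *\<^sub>R b) = s *\<^sub>R slice A w a + t *\<^sub>R slice A w b"
  unfolding chart_lifts_def by (auto simp: slice_def vec3_eq_iff algebra_simps)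

lemma slice_scale: "A \<in> chart_lifts \<Longrightarrow> slice A w (s *\<^sub>R a) = s *\<^sub>R slice A w a"
  using slice_linear[of A w s a 0 0] by simp

lemma slice_0_iff: "A \<in> chart_lifts \<Longrightarrow> slice A w v = 0 \<longleftrightarrow> v = 0"
  unfolding slice_def by (subst real_line_lift_0_iff) (auto simp: vec2_eq_iff)

lemma polyfun_slice:
  assumes "A \<in> chart_lifts"
  shows "real_polynomial_function (\<lambda>w. slice A w v $ i)"
proof -
  have "i = 1 \<or> i = 2 \<or> i = 3" by (rule exhaust_3)
  then show ?thesis
    using assms unfolding chart_lifts_def slice_def
    by (elim disjE insertE emptyE) (auto intro!: polyfun_intros)
qed

lemma continuous_on_slice [continuous_intros]:
  assumes "A \<in> chart_lifts"
  shows "continuous_on S (\<lambda>x. slice A (fst x) (snd x) $ i)"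
proof -
  have "i = 1 \<or> i = 2 \<or> i = 3" by (rule exhaust_3)
  then show ?thesis
    using assms unfolding chart_lifts_def slice_def
    by (elim disjE insertE emptyE) (auto intro!: continuous_intros)
qed

lemma web_chart_iff:
  assumes "A \<in> chart_lifts" "\<sigma> \<in> {-1, 1}"
  shows "w \<in> (\<lambda>w. hpoint (A w)) -` web {\<sigma>} \<longleftrightarrow>
    Im_vec w = 0 \<or> cubic (slice A w (Im_vec w)) = 0 \<and> sgn (separator (slice A w (Im_vec w))) = \<sigma>"
  using vimage_chart_web[OF assms(1)] real_line_lift_0_iff[OF assms(1)]
  by (auto simp: web_cone_def slice_Im_vec Im_vec_0_iff)

lemma tube_positive:
  fixes h :: "'a::euclidean_space \<Rightarrow> 'b::euclidean_space \<Rightarrow> real"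
  assumes "open U" "p \<in> U" "continuous_on (U \<times> UNIV) (\<lambda>x. h (fst x) (snd x))" "compact K"
    "\<And>v. v \<in> K \<Longrightarrow> h p v > 0"
  obtains V where "open V" "p \<in> V" "V \<subseteq> U" "\<And>w v. w \<in> V \<Longrightarrow> v \<in> K \<Longrightarrow> h w v > 0"
proof -
  have op: "open (U \<times> UNIV \<inter> (\<lambda>x. h (fst x) (snd x)) -` {0<..})"
    by (rule continuous_open_preimage[OF assms(3)]) (use assms(1) in \<open>auto simp: open_Times\<close>)
  have "{p} \<times> K \<subseteq> U \<times> UNIV \<inter> (\<lambda>x. h (fst x) (snd x)) -` {0<..}"
    using assms by auto
  from Elementary_Topology.tube_lemma[OF assms(4) op this]
  obtain V where "open V" "p \<in> V" "V \<times> K \<subseteq> U \<times> UNIV \<inter> (\<lambda>x. h (fst x) (snd x)) -` {0<..}"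
    by blast
  then have V: "V \<times> K \<subseteq> U \<times> UNIV \<inter> (\<lambda>x. h (fst x) (snd x)) -` {0<..}" by blast
  show ?thesis
  proof (cases "K = {}")
    case True
    then show ?thesis using that[of U] assms by auto
  next
    case False
    then show ?thesis using V that[OF \<open>open V\<close> \<open>p \<in> V\<close>] by fastforce
  qed
qed

text \<open>
  For unit vectors \<open>v\<close>, the statement is that the function \<open>h\<close> of the proof is positive; this is an open
  condition by compactness of the circle, and homogeneity extends it to all \<open>v\<close>.
\<close>

lemma sign_persists:
  assumes A: "A \<in> chart_lifts" and \<sigma>: "\<sigma> \<in> {-1, 1}" and U: "open U" "p \<in> U"
    and Q: "continuous_on (U \<times> UNIV) (\<lambda>x. Q (fst x) (snd x))"
      "\<And>w v c. Q w (c *\<^sub>R v) = c ^ n * Q w v"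
    and sgn: "\<And>v. v \<noteq> 0 \<Longrightarrow> Q p v = 0 \<Longrightarrow> sgn (separator (slice A p v)) = \<sigma>"
  obtains V where "open V" "p \<in> V" "V \<subseteq> U"
    "\<And>w v. w \<in> V \<Longrightarrow> v \<noteq> 0 \<Longrightarrow> Q w v = (0::real) \<Longrightarrow> sgn (separator (slice A w v)) = \<sigma>"
proof -
  define h where "h w v = \<bar>Q w v\<bar> + max 0 (\<sigma> * separator (slice A w v))" for w v
  have \<sigma>s: "sgn x = \<sigma> \<longleftrightarrow> \<sigma> * x > 0" for x using \<sigma> by (auto simp: sgn_real_def)
  have pos: "h p v > 0" if "v \<in> sphere 0 1" for v
  proof (cases "Q p v = 0")
    case True
    then have "\<sigma> * separator (slice A p v) > 0" using sgn[of v] that \<sigma>s by fastforce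
    then show ?thesis by (simp add: h_def)
  qed (simp add: h_def add_pos_nonneg)
  have cont: "continuous_on (U \<times> UNIV) (\<lambda>x. h (fst x) (snd x))"
    unfolding h_def separator_def
    by (intro continuous_intros Q(1) continuous_on_slice[OF A]) auto
  obtain V where V: "open V" "p \<in> V" "V \<subseteq> U" "\<And>w v. w \<in> V \<Longrightarrow> v \<in> sphere 0 1 \<Longrightarrow> h w v > 0"
    using tube_positive[OF U cont compact_sphere pos] by blast
  show ?thesis
  proof (rule that[OF V(1-3)])
    fix w v assume w: "w \<in> V" and v: "v \<noteq> 0" "Q w v = 0"
    define u where "u = inverse (norm v) *\<^sub>R v"
    have u: "u \<in> sphere 0 1" using v(1) by (simp add: u_def)
    have "Q w u = 0" using Q(2)[of w "inverse (norm v)" v] v(2) by (simp add: u_def)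
    then have "\<sigma> * separator (slice A w u) > 0"
      using V(4)[OF w u] by (auto simp: h_def max_def split: if_splits)
    then have "sgn (separator (slice A w u)) = \<sigma>" by (simp only: \<sigma>s)
    moreover have "separator (slice A w u) = (inverse (norm v))\<^sup>2 * separator (slice A w v)"
      by (simp only: u_def slice_scale[OF A] separator_scale)
    ultimately show "sgn (separator (slice A w v)) = \<sigma>"
      using sgn_square_mult[of "inverse (norm v)" "separator (slice A w v)"] v(1) by simp
  qed
qed

section \<open>Each piece is a real-analytic subvariety\<close>

text \<open>
  The polarisation of the cubic form, linear in \<open>k\<close>.
\<close>

definition cubic_polar :: "real^3 \<Rightarrow> real^3 \<Rightarrow> real" where
  "cubic_polar m k = 2 * m$2 * k$2 * m$3 + (m$2)\<^sup>2 * k$3 - 3 * (m$1)\<^sup>2 * k$1 + k$1 * (m$3)\<^sup>2 + 2 * m$1 * m$3 * k$3"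

lemma cubic_combination:
  "cubic (s *\<^sub>R m + t *\<^sub>R k) = s^3 * cubic m + s\<^sup>2 * t * cubic_polar m k + s * t\<^sup>2 * cubic_polar k m + t^3 * cubic k"
  by (simp add: cubic_def cubic_polar_def power2_eq_square power3_eq_cube algebra_simps)

lemma sgn_pm_iff: "\<sigma> \<in> {-1, 1} \<Longrightarrow> sgn x = \<sigma> \<longleftrightarrow> \<sigma> * x > (0::real)"
  by (auto simp: sgn_real_def)

lemma continuous_on_cubic_slice:
  assumes "A \<in> chart_lifts"
  shows "continuous_on S (\<lambda>x. cubic (slice A (fst x) (snd x)))"
  unfolding cubic_def by (intro continuous_intros continuous_on_slice[OF assms])

lemma analytic_real_points:
  assumes "open U" "p \<in> U" "\<And>w. w \<in> U \<Longrightarrow> w \<in> X \<longleftrightarrow> Im_vec w = 0"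
  shows "analytic_set_near X p"
proof (rule analytic_set_nearI[where F = "{\<lambda>w. Im_vec w $ 1, \<lambda>w. Im_vec w $ 2}", OF assms(1,2)])
  fix f :: "complex^2 \<Rightarrow> real" assume "f \<in> {\<lambda>w. Im_vec w $ 1, \<lambda>w. Im_vec w $ 2}"
  then show "real_analytic_on f U" by (elim insertE emptyE) (auto intro!: real_analytic_on_polyfun polyfun_intros)
qed (use assms(3) in \<open>auto simp: Im_vec_0_iff\<close>)

text \<open>
  If all leaves through the real point \<open>p\<close> belong to the component \<open>\<sigma>\<close>, the same is true nearby.  So
  near \<open>p\<close> the cubic equation defines one piece, and the other piece consists of real points only.
\<close>

lemma web_analytic_unmixed:
  assumes A: "A \<in> chart_lifts" and \<sigma>: "\<sigma> \<in> {-1, 1}" and \<sigma>': "\<sigma>' \<in> {-1, 1}"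
    and sgn: "\<And>v. v \<noteq> 0 \<Longrightarrow> cubic (slice A p v) = 0 \<Longrightarrow> sgn (separator (slice A p v)) = \<sigma>"
  shows "analytic_set_near ((\<lambda>w. hpoint (A w)) -` web {\<sigma>'}) p"
proof -
  have c: "continuous_on (UNIV \<times> UNIV) (\<lambda>x. cubic (slice A (fst x) (snd x)))"
    by (rule continuous_on_cubic_slice[OF A])
  obtain V where V: "open V" "p \<in> V"
    "\<And>w v. w \<in> V \<Longrightarrow> v \<noteq> 0 \<Longrightarrow> cubic (slice A w v) = 0 \<Longrightarrow> sgn (separator (slice A w v)) = \<sigma>"
    by (rule sign_persists[OF A \<sigma> open_UNIV UNIV_I c _ sgn, where n = 3])
      (auto simp: slice_scale[OF A] cubic_scale)
  show ?thesis
  proof (cases "\<sigma>' = \<sigma>")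
    case True
    show ?thesis
    proof (rule analytic_set_nearI[where F = "{\<lambda>w. cubic (real_line (A w))}", OF V(1,2)])
      fix w assume w: "w \<in> V"
      show "w \<in> (\<lambda>w. hpoint (A w)) -` web {\<sigma>'} \<longleftrightarrow> (\<forall>f\<in>{\<lambda>w. cubic (real_line (A w))}. f w = 0)"
        unfolding web_chart_iff[OF A \<sigma>'] slice_Im_vec[symmetric]
        using V(3)[OF w, of "Im_vec w"] True slice_0_iff[OF A, of w "Im_vec w"] by (cases "Im_vec w = 0") auto
    qed (use real_analytic_on_polyfun[OF polyfun_cubic_lift[OF A]] in auto)
  next
    case False
    show ?thesis
    proof (rule analytic_real_points[OF V(1,2)])
      show "w \<in> (\<lambda>w. hpoint (A w)) -` web {\<sigma>'} \<longleftrightarrow> Im_vec w = 0" if "w \<in> V" for w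
        unfolding web_chart_iff[OF A \<sigma>'] using V(3)[OF that, of "Im_vec w"] False by auto
    qed
  qed
qed

text \<open>
  In the coordinates \<open>S\<close>, \<open>T\<close> of \<open>v\<close> with respect to \<open>v0\<close>, \<open>v1\<close> the cubic form has the simple root \<open>T = 0\<close>
  at \<open>p\<close>.  It continues to an analytic root \<open>T = \<tau> S\<close>, and dividing by the linear factor \<open>L\<close> leaves a quadratic
  form \<open>Q\<close>.  The zeros of \<open>L\<close> keep the sign \<open>\<sigma>\<close>, those of \<open>Q\<close> keep the sign \<open>- \<sigma>\<close>.
\<close>

lemma web_analytic_split:
  assumes A: "A \<in> chart_lifts" and \<sigma>: "\<sigma> \<in> {-1, 1}" and p: "Im_vec p = 0"
    and det: "v0$1 * v1$2 - v0$2 * v1$1 \<noteq> 0"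
    and root: "cubic (slice A p v0) = 0" "sgn (separator (slice A p v0)) = \<sigma>"
    and simple: "cubic_polar (slice A p v0) (slice A p v1) \<noteq> 0"
    and other: "\<And>s t. t \<noteq> 0 \<Longrightarrow> cubic (slice A p (s *\<^sub>R v0 + t *\<^sub>R v1)) = 0 \<Longrightarrow>
        sgn (separator (slice A p (s *\<^sub>R v0 + t *\<^sub>R v1))) = - \<sigma>"
    and \<sigma>': "\<sigma>' \<in> {-1, 1}"
  shows "analytic_set_near ((\<lambda>w. hpoint (A w)) -` web {\<sigma>'}) p"
proof -
  define d where "d = v0$1 * v1$2 - v0$2 * v1$1"
  have d: "d \<noteq> 0" using det by (simp add: d_def)
  define S T :: "real^2 \<Rightarrow> real" where "S v = (v$1 * v1$2 - v$2 * v1$1) / d"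
    and "T v = (v0$1 * v$2 - v0$2 * v$1) / d" for v
  have v_eq: "v = S v *\<^sub>R v0 + T v *\<^sub>R v1" for v
  proof -
    have "d * v$1 = (v$1 * v1$2 - v$2 * v1$1) * v0$1 + (v0$1 * v$2 - v0$2 * v$1) * v1$1"
      "d * v$2 = (v$1 * v1$2 - v$2 * v1$1) * v0$2 + (v0$1 * v$2 - v0$2 * v$1) * v1$2"
      unfolding d_def by (simp_all add: algebra_simps)
    then have "v$1 = ((v$1 * v1$2 - v$2 * v1$1) * v0$1 + (v0$1 * v$2 - v0$2 * v$1) * v1$1) / d"
      "v$2 = ((v$1 * v1$2 - v$2 * v1$1) * v0$2 + (v0$1 * v$2 - v0$2 * v$1) * v1$2) / d"
      using d by (simp_all add: nonzero_eq_divide_eq mult.commute)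
    then show ?thesis by (simp add: vec2_eq_iff S_def T_def add_divide_distrib)
  qed
  have ST_scale: "S (c *\<^sub>R v) = c * S v" "T (c *\<^sub>R v) = c * T v" for c v
    by (simp_all add: S_def T_def algebra_simps)
  have ST0: "v = 0" if "S v = 0" "T v = 0" for v using v_eq[of v] that by simp
  define m k where "m w = slice A w v0" and "k w = slice A w v1" for w
  define e0 e1 e2 e3 where "e0 w = cubic (m w)" and "e1 w = cubic_polar (m w) (k w)"
    and "e2 w = cubic_polar (k w) (m w)" and "e3 w = cubic (k w)" for w
  have e_poly: "real_polynomial_function e0" "real_polynomial_function e1"
    "real_polynomial_function e2" "real_polynomial_function e3"
    unfolding e0_def e1_def e2_def e3_def m_def k_def cubic_def cubic_polar_def
    by (intro polyfun_intros polyfun_slice[OF A])+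
  have cubic_eq: "cubic (slice A w v) = S v ^ 3 * e0 w + (S v)\<^sup>2 * T v * e1 w + S v * (T v)\<^sup>2 * e2 w + T v ^ 3 * e3 w" for w v
    by (subst v_eq[of v], subst slice_linear[OF A], subst cubic_combination)
      (simp add: e0_def e1_def e2_def e3_def m_def k_def)
  obtain \<tau> U0 where \<tau>: "real_analytic_at \<tau> p" "\<tau> p = 0" "open U0" "p \<in> U0"
    "\<And>x. x \<in> U0 \<Longrightarrow> e0 x + e1 x * \<tau> x + e2 x * \<tau> x ^ 2 + e3 x * \<tau> x ^ 3 = 0"
  proof (rule real_analytic_simple_root[of e0 p e1 e2 e3])
    show "e0 p = 0" "e1 p \<noteq> 0" using root simple by (auto simp: e0_def e1_def m_def k_def)
  qed (use e_poly real_analytic_at_polynomial in blast)+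
  obtain \<rho> where \<rho>: "\<rho> > 0" "\<And>q. q \<in> ball p \<rho> \<Longrightarrow> real_analytic_at \<tau> q"
    using real_analytic_at_near[OF \<tau>(1)] by blast
  define U1 where "U1 = U0 \<inter> ball p \<rho>"
  have U1: "open U1" "p \<in> U1" using \<tau> \<rho> by (auto simp: U1_def)
  have \<tau>an: "real_analytic_at \<tau> q" if "q \<in> U1" for q using \<rho>(2) that by (auto simp: U1_def)
  have \<tau>c: "continuous_on U1 \<tau>"
    by (intro continuous_at_imp_continuous_on ballI real_analytic_at_imp_continuous \<tau>an)
  define L where "L w v = T v - \<tau> w * S v" for w v
  define Q where "Q w v = e3 w * (T v)\<^sup>2 + (e2 w + e3 w * \<tau> w) * S v * T v
      + (e1 w + e2 w * \<tau> w + e3 w * (\<tau> w)\<^sup>2) * (S v)\<^sup>2" for w v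
  have factor: "cubic (slice A w v) = L w v * Q w v" if "w \<in> U1" for w v
  proof -
    have "cubic (slice A w v) - L w v * Q w v
        = S v ^ 3 * (e0 w + e1 w * \<tau> w + e2 w * \<tau> w ^ 2 + e3 w * \<tau> w ^ 3)"
      unfolding cubic_eq L_def Q_def by (simp add: power2_eq_square power3_eq_cube algebra_simps)
    then show ?thesis using \<tau>(5)[of w] that by (simp add: U1_def)
  qed
  have Qc: "continuous_on (U1 \<times> UNIV) (\<lambda>x. Q (fst x) (snd x))"
  proof -
    have t: "continuous_on (U1 \<times> UNIV) (\<lambda>x. \<tau> (fst x))"
      by (rule continuous_on_compose2[OF \<tau>c]) (auto intro!: continuous_intros)
    have e: "continuous_on (U1 \<times> UNIV) (\<lambda>x. f (fst x))" if "real_polynomial_function f" for f :: "complex^2 \<Rightarrow> real"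
      by (rule continuous_on_compose2[OF continuous_on_polyfun[OF that, of UNIV]]) (auto intro!: continuous_intros)
    have st: "continuous_on (U1 \<times> UNIV) (\<lambda>x. S (snd x))" "continuous_on (U1 \<times> UNIV) (\<lambda>x. T (snd x))"
      unfolding S_def T_def divide_inverse by (intro continuous_intros)+
    show ?thesis
      unfolding Q_def
      by (intro continuous_on_add continuous_on_mult continuous_on_power t st e e_poly)
  qed
  obtain V where V: "open V" "p \<in> V" "V \<subseteq> U1"
    "\<And>w v. w \<in> V \<Longrightarrow> v \<noteq> 0 \<Longrightarrow> Q w v = 0 \<Longrightarrow> sgn (separator (slice A w v)) = - \<sigma>"
  proof (rule sign_persists[OF A _ U1 Qc, where n = 2 and \<sigma> = "- \<sigma>"])
    show "- \<sigma> \<in> {-1, 1}" using \<sigma> by auto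
    show "Q w (c *\<^sub>R v) = c\<^sup>2 * Q w v" for w v c
      unfolding Q_def ST_scale by (simp add: power2_eq_square algebra_simps)
    fix v :: "real^2" assume v: "v \<noteq> 0" "Q p v = 0"
    have "T v \<noteq> 0"
    proof
      assume "T v = 0"
      then have "S v \<noteq> 0" using ST0 v(1) by blast
      then show False using v(2) \<open>T v = 0\<close> simple by (simp add: Q_def \<tau>(2) e1_def m_def k_def)
    qed
    moreover have "cubic (slice A p v) = 0" using factor[OF U1(2)] v(2) by simp
    ultimately show "sgn (separator (slice A p v)) = - \<sigma>"
      using other[of "T v" "S v"] v_eq[of v] by simp
  qed blast
  have sep_cont: "continuous_on U1 (\<lambda>w. \<sigma> * separator (m w + \<tau> w *\<^sub>R k w))"
    unfolding separator_def m_def k_def vector_add_component vector_scaleR_component real_scaleR_def divide_inverse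
    by (intro continuous_on_add continuous_on_mult continuous_on_diff continuous_on_power
        continuous_on_const \<tau>c continuous_on_polyfun[OF polyfun_slice[OF A]])
  define W where "W = V \<inter> (U1 \<inter> (\<lambda>w. \<sigma> * separator (m w + \<tau> w *\<^sub>R k w)) -` {0<..})"
  have W: "open W" "p \<in> W"
    unfolding W_def using V U1 continuous_open_preimage[OF sep_cont U1(1), of "{0<..}"] root(2) sgn_pm_iff[OF \<sigma>]
    by (auto simp: \<tau>(2) m_def)
  have Lsign: "sgn (separator (slice A w v)) = \<sigma>" if w: "w \<in> W" and v: "v \<noteq> 0" "L w v = 0" for w v
  proof -
    have T: "T v = \<tau> w * S v" using v(2) by (simp add: L_def)
    then have S0: "S v \<noteq> 0" using ST0[of v] v(1) by auto
    have "slice A w v = S v *\<^sub>R (m w + \<tau> w *\<^sub>R k w)"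
      by (subst v_eq[of v], subst slice_linear[OF A]) (simp add: T m_def k_def algebra_simps)
    then have "sgn (separator (slice A w v)) = sgn (separator (m w + \<tau> w *\<^sub>R k w))"
      using sgn_square_mult[OF S0] by (simp add: separator_scale)
    then show ?thesis using w sgn_pm_iff[OF \<sigma>] by (simp add: W_def)
  qed
  have Qsign: "sgn (separator (slice A w v)) = - \<sigma>" if "w \<in> W" "v \<noteq> 0" "Q w v = 0" for w v
    using V(4) that by (simp add: W_def)
  have fac: "cubic (slice A w v) = 0 \<longleftrightarrow> L w v = 0 \<or> Q w v = 0" if "w \<in> W" for w v
    using factor[of w v] that by (simp add: W_def)
  have \<sigma>0: "\<sigma> \<noteq> - \<sigma>" using \<sigma> by auto
  have L0: "L w 0 = 0" "Q w 0 = 0" for w by (simp_all add: L_def Q_def S_def T_def)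
  have rpfST: "real_polynomial_function (\<lambda>w. S (Im_vec w))" "real_polynomial_function (\<lambda>w. T (Im_vec w))"
    unfolding S_def T_def Im_vec_nth by (intro polyfun_intros)+
  have an_parts: "real_analytic_at (\<lambda>w. S (Im_vec w)) q" "real_analytic_at (\<lambda>w. T (Im_vec w)) q"
    "real_analytic_at e1 q" "real_analytic_at e2 q" "real_analytic_at e3 q" for q
    using rpfST e_poly real_analytic_at_polynomial by blast+
  have anL: "real_analytic_on (\<lambda>w. L w (Im_vec w)) W"
    unfolding real_analytic_on_def L_def
    by (intro ballI real_analytic_intros an_parts \<tau>an) (auto simp: W_def)
  have anQ: "real_analytic_on (\<lambda>w. Q w (Im_vec w)) W"
    unfolding real_analytic_on_def Q_def
    by (intro ballI real_analytic_intros an_parts \<tau>an) (auto simp: W_def)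
  consider "\<sigma>' = \<sigma>" | "\<sigma>' = - \<sigma>" using \<sigma> \<sigma>' by auto
  then show ?thesis
  proof cases
    case 1
    show ?thesis
    proof (rule analytic_set_nearI[where F = "{\<lambda>w. L w (Im_vec w)}", OF W])
      fix w assume w: "w \<in> W"
      show "w \<in> (\<lambda>w. hpoint (A w)) -` web {\<sigma>'} \<longleftrightarrow> (\<forall>f\<in>{\<lambda>w. L w (Im_vec w)}. f w = 0)"
        unfolding web_chart_iff[OF A \<sigma>']
        using fac[OF w, of "Im_vec w"] Lsign[OF w, of "Im_vec w"] Qsign[OF w, of "Im_vec w"] \<sigma>0 L0 1
        by (cases "Im_vec w = 0") auto
    qed (use anL in auto)
  next
    case 2
    show ?thesis
    proof (rule analytic_set_nearI[where F = "{\<lambda>w. Q w (Im_vec w)}", OF W])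
      fix w assume w: "w \<in> W"
      show "w \<in> (\<lambda>w. hpoint (A w)) -` web {\<sigma>'} \<longleftrightarrow> (\<forall>f\<in>{\<lambda>w. Q w (Im_vec w)}. f w = 0)"
        unfolding web_chart_iff[OF A \<sigma>']
        using fac[OF w, of "Im_vec w"] Lsign[OF w, of "Im_vec w"] Qsign[OF w, of "Im_vec w"] \<sigma>0 L0 2
        by (cases "Im_vec w = 0") auto
    qed (use anQ in auto)
  qed
qed

text \<open>
  With \<open>v0\<close> and \<open>v1\<close> as basis, the binary cubic is \<open>s t (\<kappa> s + \<mu> t)\<close>.  So its third root is
  \<open>(\<mu>, - \<kappa>)\<close>, and \<open>v0\<close> is a simple root unless \<open>\<kappa> = 0\<close>, in which case the third root would be \<open>v0\<close> itself.
\<close>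

lemma web_analytic_mixed:
  assumes A: "A \<in> chart_lifts" and p: "Im_vec p = 0" and \<sigma>: "\<sigma> \<in> {-1, 1}"
    and v0: "cubic (slice A p v0) = 0" "sgn (separator (slice A p v0)) = \<sigma>"
    and v1: "cubic (slice A p v1) = 0" "sgn (separator (slice A p v1)) = - \<sigma>"
    and v2: "sgn (separator (slice A p (cubic_polar (slice A p v1) (slice A p v0) *\<^sub>R v0
        - cubic_polar (slice A p v0) (slice A p v1) *\<^sub>R v1))) = - \<sigma>"
    and det: "v0$1 * v1$2 - v0$2 * v1$1 \<noteq> 0"
    and \<sigma>': "\<sigma>' \<in> {-1, 1}"
  shows "analytic_set_near ((\<lambda>w. hpoint (A w)) -` web {\<sigma>'}) p"
proof -
  define \<kappa> \<mu> where "\<kappa> = cubic_polar (slice A p v0) (slice A p v1)" and "\<mu> = cubic_polar (slice A p v1) (slice A p v0)"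
  have v2': "sgn (separator (slice A p (\<mu> *\<^sub>R v0 - \<kappa> *\<^sub>R v1))) = - \<sigma>" using v2 by (simp add: \<kappa>_def \<mu>_def)
  have \<sigma>0: "\<sigma> \<noteq> - \<sigma>" "\<sigma> \<noteq> 0" using \<sigma> by auto
  have scale: "sgn (separator (slice A p (c *\<^sub>R v))) = sgn (separator (slice A p v))" if "c \<noteq> 0" for c v
    using sgn_square_mult[OF that] by (simp add: slice_scale[OF A] separator_scale)
  have "\<kappa> \<noteq> 0"
  proof
    assume \<kappa>: "\<kappa> = 0"
    show False
    proof (cases "\<mu> = 0")
      case True
      then show False using v2' \<kappa> \<sigma>0 by (simp add: slice_def[symmetric] slice_0_iff[OF A, THEN iffD2] separator_def)
    next
      case False
      then show False using v2' \<kappa> scale[OF False, of v0] v0(2) \<sigma>0 by simp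
    qed
  qed
  show ?thesis
  proof (rule web_analytic_split[OF A \<sigma> p det v0 _ _ \<sigma>'])
    show "cubic_polar (slice A p v0) (slice A p v1) \<noteq> 0" using \<open>\<kappa> \<noteq> 0\<close> by (simp add: \<kappa>_def)
    fix s t :: real assume t: "t \<noteq> 0" and z: "cubic (slice A p (s *\<^sub>R v0 + t *\<^sub>R v1)) = 0"
    have "s * t * (\<kappa> * s + \<mu> * t) = 0"
      using z v0(1) v1(1) unfolding slice_linear[OF A] cubic_combination
      by (simp add: \<kappa>_def \<mu>_def power2_eq_square algebra_simps)
    then consider "s = 0" | "\<kappa> * s + \<mu> * t = 0" using t by auto
    then show "sgn (separator (slice A p (s *\<^sub>R v0 + t *\<^sub>R v1))) = - \<sigma>"
    proof cases
      case 1
      then show ?thesis using scale[OF t, of v1] v1(2) by simp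
    next
      case 2
      then have s: "s = (- t / \<kappa>) * \<mu>" using \<open>\<kappa> \<noteq> 0\<close> by (simp add: field_simps)
      have "s *\<^sub>R v0 + t *\<^sub>R v1 = (- t / \<kappa>) *\<^sub>R (\<mu> *\<^sub>R v0 - \<kappa> *\<^sub>R v1)"
        unfolding s using \<open>\<kappa> \<noteq> 0\<close> by (simp add: scaleR_diff_right)
      then show ?thesis using scale[of "- t / \<kappa>"] v2' t \<open>\<kappa> \<noteq> 0\<close> by (metis divide_eq_0_iff neg_equal_0_iff_equal)
    qed
  qed
qed

text \<open>
  If both components contribute leaves at \<open>p\<close>, then the third root of the cubic form is real and belongs
  to one of them; the other component has the simple root.
\<close>

lemma web_analytic_real_point:
  assumes A: "A \<in> chart_lifts" and p: "Im_vec p = 0" and \<sigma>': "\<sigma>' \<in> {-1, 1}"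
  shows "analytic_set_near ((\<lambda>w. hpoint (A w)) -` web {\<sigma>'}) p"
proof (cases "\<exists>\<sigma>\<in>{-1, 1}. \<forall>v. v \<noteq> 0 \<longrightarrow> cubic (slice A p v) = 0 \<longrightarrow> sgn (separator (slice A p v)) = \<sigma>")
  case True
  then show ?thesis using web_analytic_unmixed[OF A _ \<sigma>'] by blast
next
  case False
  have pm: "sgn (separator (slice A p v)) = 1 \<or> sgn (separator (slice A p v)) = -1"
    if "v \<noteq> 0" "cubic (slice A p v) = 0" for v
    using separator_nonzero[OF that(2)] that(1) slice_0_iff[OF A] by (auto simp: sgn_real_def)
  from False obtain a where a: "a \<noteq> 0" "cubic (slice A p a) = 0" "sgn (separator (slice A p a)) = 1"
    using pm by force
  from False obtain b where b: "b \<noteq> 0" "cubic (slice A p b) = 0" "sgn (separator (slice A p b)) = -1"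
    using pm by force
  define \<kappa> \<mu> where "\<kappa> = cubic_polar (slice A p a) (slice A p b)" and "\<mu> = cubic_polar (slice A p b) (slice A p a)"
  have scale: "sgn (separator (slice A p (c *\<^sub>R v))) = sgn (separator (slice A p v))" if "c \<noteq> 0" for c v
    using sgn_square_mult[OF that] by (simp add: slice_scale[OF A] separator_scale)
  have ab: "s = 0 \<and> t = 0" if "s *\<^sub>R a + t *\<^sub>R b = 0" for s t
  proof (rule ccontr)
    assume n: "\<not> (s = 0 \<and> t = 0)"
    have eq: "s *\<^sub>R a = (- t) *\<^sub>R b" using that by (simp add: eq_neg_iff_add_eq_0)
    then have "s \<noteq> 0" "t \<noteq> 0" using n a(1) b(1) by auto
    then show False using scale[of s a] scale[of "- t" b] eq a(3) b(3) by simp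
  qed
  have det: "a$1 * b$2 - a$2 * b$1 \<noteq> 0"
  proof
    assume d: "a$1 * b$2 - a$2 * b$1 = 0"
    have "(b$2) *\<^sub>R a + (- (a$2)) *\<^sub>R b = 0" "(b$1) *\<^sub>R a + (- (a$1)) *\<^sub>R b = 0"
      using d by (auto simp: vec2_eq_iff algebra_simps)
    then show False using ab[of "b$2" "- (a$2)"] ab[of "b$1" "- (a$1)"] a(1) by (auto simp: vec2_eq_iff)
  qed
  have nz: "\<mu> *\<^sub>R a - \<kappa> *\<^sub>R b \<noteq> 0"
  proof
    assume "\<mu> *\<^sub>R a - \<kappa> *\<^sub>R b = 0"
    then have z: "\<mu> = 0" "\<kappa> = 0" using ab[of \<mu> "- \<kappa>"] by auto
    have all0: "cubic (slice A p (s *\<^sub>R a + t *\<^sub>R b)) = 0" for s t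
      unfolding slice_linear[OF A] cubic_combination using a(2) b(2) z by (simp add: \<kappa>_def \<mu>_def)
    \<comment> \<open>If the cubic form vanished identically, the segment from \<open>b\<close> to \<open>a\<close> would lie on the curve and join
      points of different sign.\<close>
    define f where "f \<theta> = separator (slice A p ((1 - \<theta>) *\<^sub>R b + \<theta> *\<^sub>R a))" for \<theta>
    have "continuous_on {0..1} f"
      unfolding f_def slice_linear[OF A] separator_def by (auto intro!: continuous_intros)
    moreover have "f 0 \<le> 0" "0 \<le> f 1" using a(3) b(3) by (auto simp: f_def sgn_real_def split: if_splits)
    ultimately obtain \<theta> where \<theta>: "f \<theta> = 0" using IVT'[of f 0 0 1] by auto
    have "(1 - \<theta>) *\<^sub>R b + \<theta> *\<^sub>R a \<noteq> 0" using ab[of \<theta> "1 - \<theta>"] by (auto simp: add.commute)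
    then have "slice A p ((1 - \<theta>) *\<^sub>R b + \<theta> *\<^sub>R a) \<noteq> 0" using slice_0_iff[OF A] by blast
    then show False using separator_nonzero all0[of \<theta> "1 - \<theta>"] \<theta> by (auto simp: f_def add.commute)
  qed
  have c2: "cubic (slice A p (\<mu> *\<^sub>R a - \<kappa> *\<^sub>R b)) = 0"
  proof -
    have "\<mu> *\<^sub>R a - \<kappa> *\<^sub>R b = \<mu> *\<^sub>R a + (- \<kappa>) *\<^sub>R b" by simp
    then show ?thesis
      using a(2) b(2)
      by (simp only: slice_linear[OF A] cubic_combination \<kappa>_def[symmetric] \<mu>_def[symmetric])
        (simp add: power2_eq_square algebra_simps)
  qed
  from pm[OF nz c2] show ?thesis
  proof
    assume "sgn (separator (slice A p (\<mu> *\<^sub>R a - \<kappa> *\<^sub>R b))) = -1"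
    then show ?thesis
      by (intro web_analytic_mixed[OF A p, of 1 a b] a b det \<sigma>') (use b in \<open>auto simp: \<kappa>_def \<mu>_def\<close>)
  next
    assume "sgn (separator (slice A p (\<mu> *\<^sub>R a - \<kappa> *\<^sub>R b))) = 1"
    moreover have "\<kappa> *\<^sub>R b - \<mu> *\<^sub>R a = (-1) *\<^sub>R (\<mu> *\<^sub>R a - \<kappa> *\<^sub>R b)" by simp
    ultimately have "sgn (separator (slice A p (\<kappa> *\<^sub>R b - \<mu> *\<^sub>R a))) = 1"
      using scale[of "-1"] by (metis zero_neq_neg_one)
    then show ?thesis
      by (intro web_analytic_mixed[OF A p, of "-1" b a] a b \<sigma>') (use a det in \<open>auto simp: \<kappa>_def \<mu>_def mult.commute\<close>)
  qed
qed

text \<open>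
  On the cubic the separator does not vanish, so near \<open>p\<close> its sign is constant: the cubic equation defines
  the piece there, or the piece is empty near \<open>p\<close>.
\<close>

lemma web_analytic_nonreal_point:
  assumes A: "A \<in> chart_lifts" and p: "Im_vec p \<noteq> 0" and \<sigma>: "\<sigma> \<in> {-1, 1}"
  shows "analytic_set_near ((\<lambda>w. hpoint (A w)) -` web {\<sigma>}) p"
proof -
  define f g where "f w = cubic (real_line (A w))" and "g w = separator (real_line (A w))" for w
  have fg: "real_polynomial_function f" "real_polynomial_function g"
    unfolding f_def g_def using polyfun_cubic_lift[OF A] polyfun_separator_lift[OF A] by auto
  have mem: "w \<in> (\<lambda>w. hpoint (A w)) -` web {\<sigma>} \<longleftrightarrow> f w = 0 \<and> 0 \<le> \<sigma> * g w" for w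
    unfolding vimage_chart_web[OF A] using web_cone_single[OF \<sigma>] by (simp add: f_def g_def)
  then have mem': "hpoint (A w) \<in> web {\<sigma>} \<longleftrightarrow> f w = 0 \<and> 0 \<le> \<sigma> * g w" for w by simp
  have nz: "real_line (A p) \<noteq> 0" using p real_line_lift_0_iff[OF A] by (simp add: Im_vec_0_iff)
  have op: "open {w. h w \<noteq> 0}" "open {w. h w > 0}" if "real_polynomial_function h" for h :: "complex^2 \<Rightarrow> real"
    using continuous_on_polyfun[OF that, of UNIV] by (auto intro!: open_Collect_neq open_Collect_less continuous_intros)
  have poly\<sigma>: "real_polynomial_function (\<lambda>w. \<sigma> * g w)" "real_polynomial_function (\<lambda>w. - \<sigma> * g w)"
    by (intro polyfun_intros fg)+
  have one: "analytic_set_near X p" if "open U" "p \<in> U" "X \<inter> U = {}" for U and X :: "(complex^2) set"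
    by (rule analytic_set_nearI[where F = "{\<lambda>_. 1}", OF that(1,2)])
      (use that(3) in \<open>auto intro!: real_analytic_on_polyfun polyfun_intros\<close>)
  have "f p \<noteq> 0 \<or> \<sigma> * g p > 0 \<or> - \<sigma> * g p > 0"
    using separator_nonzero[OF _ nz] \<sigma> by (force simp: f_def g_def)
  then consider "f p \<noteq> 0" | "\<sigma> * g p > 0" | "- \<sigma> * g p > 0" by blast
  then show ?thesis
  proof cases
    case 1
    then show ?thesis by (intro one[OF op(1)[OF fg(1)]]) (auto simp: mem')
  next
    case 2
    show ?thesis
    proof (rule analytic_set_nearI[where F = "{f}", OF op(2)[OF poly\<sigma>(1)]])
      show "p \<in> {w. 0 < \<sigma> * g w}" using 2 by simp
    qed (use mem fg in \<open>auto intro!: real_analytic_on_polyfun\<close>)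
  next
    case 3
    then show ?thesis by (intro one[OF op(2)[OF poly\<sigma>(2)]]) (auto simp: mem')
  qed
qed

lemma web_analytic:
  assumes "J \<in> {{-1}, {1}, {-1, 1}}"
  shows "real_analytic_subvariety (web J)"
  unfolding real_analytic_subvariety_def
proof (intro conjI ballI allI)
  show "closed (web J)"
    unfolding web_def by (rule closed_locus[OF web_cone_invariant closed_web_cone[OF assms]])
  fix \<phi> w assume "\<phi> \<in> affine_charts"
  then obtain A where A: "A \<in> chart_lifts" "\<phi> = (\<lambda>w. hpoint (A w))" by (auto simp: affine_charts_eq_lifts)
  have single: "analytic_set_near (\<phi> -` web {\<sigma>}) w" if "\<sigma> \<in> {-1, 1}" for \<sigma>
    using web_analytic_real_point[OF A(1) _ that] web_analytic_nonreal_point[OF A(1) _ that] A(2)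
    by (cases "Im_vec w = 0") auto
  have all: "analytic_set_near (\<phi> -` web {-1, 1}) w"
  proof (rule analytic_set_nearI[where F = "{\<lambda>w. cubic (real_line (A w))}" and U = UNIV])
    show "x \<in> \<phi> -` web {-1, 1} \<longleftrightarrow> (\<forall>f\<in>{\<lambda>w. cubic (real_line (A w))}. f x = 0)" for x
      unfolding A(2) vimage_chart_web[OF A(1)] by (simp add: web_cone_all)
  qed (use polyfun_cubic_lift[OF A(1)] in \<open>auto intro: real_analytic_on_polyfun\<close>)
  show "analytic_set_near (\<phi> -` web J) w" using assms single all by auto
qed

section \<open>Pulling subvarieties back\<close>

lemma real_analytic_at_chart_component:
  fixes ch_map :: "'a::euclidean_space \<Rightarrow> complex^2"
  assumes "\<And>i. real_analytic_at (\<lambda>x. Re (ch_map x $ i)) p" "\<And>i. real_analytic_at (\<lambda>x. Im (ch_map x $ i)) p"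
  shows "real_analytic_at (\<lambda>x. ch_map x \<bullet> b) p"
proof -
  have "ch_map x \<bullet> b = (\<Sum>i\<in>UNIV. Re (ch_map x $ i) * Re (b $ i) + Im (ch_map x $ i) * Im (b $ i))" for x
    by (simp add: inner_vec_def inner_complex_def)
  then show ?thesis by (simp only:) (intro real_analytic_intros assms)
qed

text \<open>
  Locally the map factors through one of the charts, by dividing by a coordinate that does not
  vanish.
\<close>

lemma pullback_analytic:
  fixes \<Psi> :: "'a::euclidean_space \<Rightarrow> complex^3"
  assumes M: "open M" and \<Psi>: "\<And>i x. x \<in> M \<Longrightarrow> real_analytic_at (\<lambda>x. Re (\<Psi> x $ i)) x"
      "\<And>i x. x \<in> M \<Longrightarrow> real_analytic_at (\<lambda>x. Im (\<Psi> x $ i)) x"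
    and nz: "\<And>x. x \<in> M \<Longrightarrow> \<Psi> x \<noteq> 0" and Y: "real_analytic_subvariety Y" and m: "m \<in> M"
  shows "analytic_set_near {x \<in> M. hpoint (\<Psi> x) \<in> Y} m"
proof -
  obtain k i j A where k: "A \<in> chart_lifts" "\<Psi> m $ k \<noteq> 0"
    and A: "\<And>z :: complex^3. z $ k \<noteq> 0 \<Longrightarrow> z = (z $ k) *s A (vector [z $ i / z $ k, z $ j / z $ k])"
  proof -
    consider "\<Psi> m $ 1 \<noteq> 0" | "\<Psi> m $ 2 \<noteq> 0" | "\<Psi> m $ 3 \<noteq> 0" using nz[OF m] by (auto simp: vec3_eq_iff)
    then show ?thesis
    proof cases
      case 1
      then show ?thesis
        by (intro that[of "\<lambda>w. vector [1, w$1, w$2]" 1 2 3]) (auto simp: chart_lifts_def vec3_eq_iff)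
    next
      case 2
      then show ?thesis
        by (intro that[of "\<lambda>w. vector [w$1, 1, w$2]" 2 1 3]) (auto simp: chart_lifts_def vec3_eq_iff)
    next
      case 3
      then show ?thesis
        by (intro that[of "\<lambda>w. vector [w$1, w$2, 1]" 3 1 2]) (auto simp: chart_lifts_def vec3_eq_iff)
    qed
  qed
  define ch_map :: "'a \<Rightarrow> complex^2" where "ch_map x = vector [\<Psi> x $ i / \<Psi> x $ k, \<Psi> x $ j / \<Psi> x $ k]" for x
  have cont: "continuous_on M (\<lambda>x. \<Psi> x $ l)" for l
  proof -
    have "continuous_on M (\<lambda>x. Complex (Re (\<Psi> x $ l)) (Im (\<Psi> x $ l)))"
      unfolding Complex_eq using \<Psi>
      by (intro continuous_intros continuous_at_imp_continuous_on ballI real_analytic_at_imp_continuous)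
    then show ?thesis by simp
  qed
  define U0 where "U0 = M \<inter> (\<lambda>x. \<Psi> x $ k) -` (- {0})"
  have U0: "open U0" "m \<in> U0"
    unfolding U0_def using k(2) m continuous_open_preimage[OF cont M, of "- {0}" k] by auto
  have an_ch_map: "real_analytic_at (\<lambda>x. Re (ch_map x $ l)) q" "real_analytic_at (\<lambda>x. Im (ch_map x $ l)) q" if "q \<in> U0" for q l
  proof -
    have q: "q \<in> M" "\<Psi> q $ k \<noteq> 0" using that by (auto simp: U0_def)
    have den: "(Re (\<Psi> q $ k))\<^sup>2 + (Im (\<Psi> q $ k))\<^sup>2 \<noteq> 0"
      using q(2) by (simp add: complex_eq_iff sum_power2_eq_zero_iff)
    have "l = 1 \<or> l = 2" by (rule exhaust_2)
    then show "real_analytic_at (\<lambda>x. Re (ch_map x $ l)) q"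
      unfolding ch_map_def by (elim disjE)
        (auto simp only: vector_2 Re_divide intro!: real_analytic_intros \<Psi> q den)
    from \<open>l = 1 \<or> l = 2\<close> show "real_analytic_at (\<lambda>x. Im (ch_map x $ l)) q"
      unfolding ch_map_def by (elim disjE)
        (auto simp only: vector_2 Im_divide intro!: real_analytic_intros \<Psi> q den)
  qed
  have cont_ch_map: "continuous_on U0 ch_map"
  proof -
    have "continuous_on U0 (\<lambda>x. ch_map x $ l)" for l
    proof -
      have "l = 1 \<or> l = 2" by (rule exhaust_2)
      then show ?thesis unfolding ch_map_def
        by (elim disjE) (auto intro!: continuous_intros continuous_on_subset[OF cont] simp: U0_def)
    qed
    then have "continuous_on U0 (\<lambda>x. \<chi> l. ch_map x $ l)" by (rule continuous_on_vec_lambda)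
    then show ?thesis by simp
  qed
  have hp: "hpoint (\<Psi> x) = hpoint (A (ch_map x))" if "x \<in> U0" for x
  proof -
    have x: "\<Psi> x $ k \<noteq> 0" using that by (simp add: U0_def)
    have "hpoint ((\<Psi> x $ k) *s A (ch_map x)) = hpoint (A (ch_map x))"
      by (rule hpoint_scale[OF lift_nonzero[OF k(1)] x])
    then show ?thesis using A[OF x] by (simp add: ch_map_def)
  qed
  have "analytic_set_near ((\<lambda>w. hpoint (A w)) -` Y) (ch_map m)"
    using Y k(1) unfolding real_analytic_subvariety_def affine_charts_eq_lifts by blast
  then obtain V F where V: "open V" "ch_map m \<in> V" "\<And>f. f \<in> F \<Longrightarrow> real_analytic_on f V"
    "(\<lambda>w. hpoint (A w)) -` Y \<inter> V = {x \<in> V. \<forall>f\<in>F. f x = 0}"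
    unfolding analytic_set_near_def by blast
  define U1 where "U1 = U0 \<inter> ch_map -` V"
  have U1: "open U1" "m \<in> U1"
    unfolding U1_def using continuous_open_preimage[OF cont_ch_map U0(1) V(1)] U0 V(2) by auto
  show ?thesis
  proof (rule analytic_set_nearI[where F = "(\<lambda>f x. f (ch_map x)) ` F", OF U1])
    fix g assume "g \<in> (\<lambda>f x. f (ch_map x)) ` F"
    then obtain f where f: "f \<in> F" "g = (\<lambda>x. f (ch_map x))" by blast
    show "real_analytic_on g U1"
      unfolding real_analytic_on_def f(2)
    proof
      fix q assume q: "q \<in> U1"
      show "real_analytic_at (\<lambda>x. f (ch_map x)) q"
        by (rule real_analytic_at_compose[where \<Psi> = ch_map])
          (use V(3)[OF f(1)] q in \<open>auto simp: U1_def real_analytic_on_def intro!: real_analytic_at_chart_component an_ch_map\<close>)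
    qed
  next
    fix x assume x: "x \<in> U1"
    then have "x \<in> M" "x \<in> U0" "ch_map x \<in> V" by (auto simp: U1_def U0_def)
    then have "x \<in> {x \<in> M. hpoint (\<Psi> x) \<in> Y} \<longleftrightarrow> ch_map x \<in> (\<lambda>w. hpoint (A w)) -` Y \<inter> V"
      using hp by auto
    then show "x \<in> {x \<in> M. hpoint (\<Psi> x) \<in> Y} \<longleftrightarrow> (\<forall>f\<in>(\<lambda>f x. f (ch_map x)) ` F. f x = 0)"
      unfolding V(4) using \<open>ch_map x \<in> V\<close> by auto
  qed
qed

section \<open>Irreducibility of the pieces\<close>

text \<open>
  A connected range of parameters on which the third coordinate of the leaf does not vanish.
\<close>

definition leaf_range :: "real \<Rightarrow> real set" where
  "leaf_range \<sigma> = (if \<sigma> = 1 then {- (pi / 2) <..< pi / 2} else UNIV)"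

definition leaf_x :: "real \<Rightarrow> real \<Rightarrow> real" where "leaf_x \<sigma> t = leaf \<sigma> t $ 1 / leaf \<sigma> t $ 3"
definition leaf_y :: "real \<Rightarrow> real \<Rightarrow> real" where "leaf_y \<sigma> t = leaf \<sigma> t $ 2 / leaf \<sigma> t $ 3"

text \<open>
  The points of the line with coefficients \<open>(x, y, 1)\<close>, parametrised by their first two coordinates.
\<close>

definition line_point :: "real \<Rightarrow> real \<Rightarrow> complex^2 \<Rightarrow> complex^3" where
  "line_point x y w = vector [w$1, w$2, - (of_real x * w$1 + of_real y * w$2)]"

lemma line_point_nth [simp]:
  "line_point x y w $ 1 = w$1" "line_point x y w $ 2 = w$2"
  "line_point x y w $ 3 = - (of_real x * w$1 + of_real y * w$2)"
  by (simp_all add: line_point_def)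

lemma leaf_3_nonzero: "t \<in> leaf_range \<sigma> \<Longrightarrow> leaf \<sigma> t $ 3 \<noteq> 0"
  using cos_gt_zero_pi[of t] by (auto simp: leaf_range_def leaf_def split: if_splits)

lemma line_point_on_leaf: "leaf \<sigma> t $ 3 \<noteq> 0 \<Longrightarrow> line_form (leaf \<sigma> t) (line_point (leaf_x \<sigma> t) (leaf_y \<sigma> t) w) = 0"
  by (simp add: line_form_def leaf_x_def leaf_y_def field_simps)

lemma line_point_complete:
  assumes "line_form a z = 0" "a $ 3 \<noteq> 0"
  shows "z = line_point (a$1 / a$3) (a$2 / a$3) (vector [z$1, z$2])"
proof -
  have "of_real (a$3) * z$3 = - (of_real (a$1) * z$1 + of_real (a$2) * z$2)"
    using assms(1) by (simp add: line_form_def add_eq_0_iff2 add.commute)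
  then have "z$3 = - (of_real (a$1) * z$1 + of_real (a$2) * z$2) / of_real (a$3)"
    using assms(2) by (simp add: nonzero_eq_divide_eq mult.commute)
  then show ?thesis by (simp add: vec3_eq_iff add_divide_distrib diff_divide_distrib)
qed

lemma real_analytic_at_leaf:
  fixes f :: "'a::euclidean_space \<Rightarrow> real"
  assumes f: "real_analytic_at f p"
  shows "real_analytic_at (\<lambda>x. leaf \<sigma> (f x) $ i) p"
proof -
  have c: "real_analytic_at (\<lambda>x. cos (f x)) p"
    using real_analytic_at_Re_holomorphic[OF f, of cos UNIV] by (simp add: holomorphic_on_cos cos_of_real)
  have s: "real_analytic_at (\<lambda>x. sin (f x)) p"
    using real_analytic_at_Re_holomorphic[OF f, of sin UNIV] by (simp add: holomorphic_on_sin sin_of_real)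
  have r: "real_analytic_at (\<lambda>x. sqrt (1 + (cos (f x))\<^sup>2)) p"
  proof -
    have c2: "real_analytic_at (\<lambda>x. 1 + (cos (f x))\<^sup>2) p" by (intro real_analytic_intros c)
    have "real_analytic_at (\<lambda>x. Re (csqrt (of_real (1 + (cos (f x))\<^sup>2)))) p"
    proof (rule real_analytic_at_Re_holomorphic[OF c2, of csqrt "- \<real>\<^sub>\<le>\<^sub>0"])
      show "csqrt holomorphic_on - \<real>\<^sub>\<le>\<^sub>0" by (rule holomorphic_on_csqrt)
      have "0 < 1 + (cos (f p))\<^sup>2" by (simp add: add_pos_nonneg)
      then show "complex_of_real (1 + (cos (f p))\<^sup>2) \<in> - \<real>\<^sub>\<le>\<^sub>0"
        by (metis Compl_iff complex_nonpos_Reals_iff Re_complex_of_real not_le)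
    qed (simp add: open_Compl)
    moreover have "Re (csqrt (of_real (1 + (cos t)\<^sup>2))) = sqrt (1 + (cos t)\<^sup>2)" for t :: real
      by (subst csqrt_of_real_nonneg) auto
    ultimately show ?thesis by (simp only:)
  qed
  have "i = 1 \<or> i = 2 \<or> i = 3" by (rule exhaust_3)
  then show ?thesis
    unfolding leaf_def by (cases "\<sigma> = 1"; elim disjE)
      (auto intro!: real_analytic_intros c s r)
qed

lemma not_in_closed_nearby:
  assumes "closed Y" "z \<noteq> 0" "hpoint z \<notin> Y" "Z \<longlonglongrightarrow> z"
  shows "\<forall>\<^sub>F n in sequentially. Z n \<noteq> 0 \<and> hpoint (Z n) \<notin> Y"
proof -
  have "open {z. z \<noteq> 0 \<and> hpoint z \<in> - Y}"
    using assms(1) by (simp add: closed_def open_projective_plane_def)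
  moreover have "z \<in> {z. z \<noteq> 0 \<and> hpoint z \<in> - Y}" using assms by simp
  ultimately have "\<forall>\<^sub>F n in sequentially. Z n \<in> {z. z \<noteq> 0 \<and> hpoint z \<in> - Y}"
    using topological_tendstoD[OF assms(4)] by blast
  then show ?thesis by simp
qed

lemma real_point_cases:
  assumes "z \<noteq> 0" "real_line z = 0"
  obtains c v where "c \<noteq> 0" "v \<noteq> (0::real^3)" "z = c *s (\<chi> i. of_real (v $ i))"
proof -
  obtain A w c where A: "A \<in> chart_lifts" "c \<noteq> 0" "z = c *s A w" using lift_cases[OF assms(1)] .
  have "real_line (A w) = 0" using assms(2) A(2) by (simp add: A(3) real_line_scale)
  then have "Im (w$1) = 0" "Im (w$2) = 0" using real_line_lift_0_iff[OF A(1)] by auto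
  then have "Im (A w $ i) = 0" for i
    using A(1) exhaust_3[of i] unfolding chart_lifts_def by auto
  then have eq: "A w = (\<chi> i. of_real ((\<chi> i. Re (A w $ i)) $ i))"
    by (simp add: vec_eq_iff complex_eq_iff)
  moreover have "(\<chi> i. Re (A w $ i)) \<noteq> 0"
  proof
    assume "(\<chi> i. Re (A w $ i)) = 0"
    then have "A w = 0" by (subst eq) (simp add: vec_eq_iff)
    then show False using lift_nonzero[OF A(1)] by blast
  qed
  ultimately show ?thesis using that[OF A(2)] A(3) by metis
qed

text \<open>
  Three steps enlarge the set of points of the piece that are known to lie in \<open>Y\<close>: other parameters are
  reached by periodicity, the leaf at infinity by closedness, and the real points by the
  identity theorem, since by the intermediate value theorem an open set of them lies on leaves.
\<close>

lemma web_single_subset: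
  assumes \<sigma>: "\<sigma> \<in> {-1, 1}" and Y: "real_analytic_subvariety Y"
    and pts: "\<And>t w. t \<in> leaf_range \<sigma> \<Longrightarrow> w \<noteq> 0 \<Longrightarrow> hpoint (line_point (leaf_x \<sigma> t) (leaf_y \<sigma> t) w) \<in> Y"
  shows "web {\<sigma>} \<subseteq> Y"
proof -
  have cl: "closed Y" using Y by (simp add: real_analytic_subvariety_def)
  have aff: "hpoint z \<in> Y" if z: "z \<noteq> 0" "line_form (leaf \<sigma> t) z = 0" "leaf \<sigma> t $ 3 \<noteq> 0" for t z
  proof -
    obtain s k where s: "s \<in> leaf_range \<sigma>" "k \<noteq> 0" "leaf \<sigma> t = k *\<^sub>R leaf \<sigma> s"
    proof (cases "\<sigma> = 1")
      case False
      then show ?thesis using that[of t 1] by (simp add: leaf_range_def)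
    next
      case True
      obtain s k where sr: "- (pi / 2) \<le> s" "s < pi / 2" and k: "k \<noteq> 0" "leaf \<sigma> t = k *\<^sub>R leaf \<sigma> s"
        using leaf_reduce[of 0 \<sigma> t] by auto
      have "leaf \<sigma> t $ 3 = k * leaf \<sigma> s $ 3" by (simp add: k(2))
      then have "cos s \<noteq> 0" using z(3) True by auto
      then have "s \<noteq> - (pi / 2)" by auto
      then have "s \<in> leaf_range \<sigma>" using sr True by (simp add: leaf_range_def)
      then show ?thesis using k that by blast
    qed
    have ls: "line_form (leaf \<sigma> s) z = 0" using z(2) s(2,3) by (simp add: line_form_scale)
    have l3: "leaf \<sigma> s $ 3 \<noteq> 0" using leaf_3_nonzero[OF s(1)] .
    have eq: "z = line_point (leaf_x \<sigma> s) (leaf_y \<sigma> s) (vector [z$1, z$2])"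
      using line_point_complete[OF ls l3] by (simp add: leaf_x_def leaf_y_def)
    have "(vector [z$1, z$2] :: complex^2) \<noteq> 0"
    proof
      assume 0: "(vector [z$1, z$2] :: complex^2) = 0"
      have "z = 0" by (subst eq, subst 0) (simp add: vec3_eq_iff)
      then show False using z(1) by blast
    qed
    then show ?thesis by (subst eq) (rule pts[OF s(1)])
  qed
  have on_leaf: "hpoint z \<in> Y" if z: "z \<noteq> 0" "line_form (leaf \<sigma> t) z = 0" for t z
  proof (cases "leaf \<sigma> t $ 3 = 0")
    case True
    then have \<sigma>1: "\<sigma> = 1" and ct: "cos t = 0" using \<sigma> by auto
    then have st: "sin t \<noteq> 0" by (metis sin_zero_abs_cos_one zero_neq_one abs_zero)
    have z2: "z$2 = 0" using z(2) ct st \<sigma>1 by (simp add: line_form_def)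
    define R where "R s = sin s * sqrt (1 + (cos s)\<^sup>2)" for s
    define Z where "Z s = (vector [z$1, - (of_real (cos s) * z$1 + of_real ((cos s)^3) * z$3) / of_real (R s), z$3] :: complex^3)" for s
    have Rt: "R t \<noteq> 0" using st ct by (simp add: R_def)
    have Zt: "Z t = z" by (simp add: Z_def ct vec3_eq_iff z2)
    \<comment> \<open>\<open>Z s\<close> lies on the leaf at \<open>s\<close> and tends to \<open>z\<close>; these leaves are in the range treated before.\<close>
    define s where "s n = t + inverse (real (Suc n))" for n
    have s_lim: "s \<longlonglongrightarrow> t"
      unfolding s_def using tendsto_add[OF tendsto_const LIMSEQ_inverse_real_of_nat, of t] by simp
    have "isCont R t" unfolding R_def by (intro continuous_intros)
    have Zlim: "(\<lambda>n. Z (s n)) \<longlonglongrightarrow> Z t"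
    proof (rule vec_tendstoI)
      fix i :: 3
      have "(\<lambda>n. R (s n)) \<longlonglongrightarrow> R t" by (rule isCont_tendsto_compose[OF \<open>isCont R t\<close> s_lim])
      moreover have "i = 1 \<or> i = 2 \<or> i = 3" by (rule exhaust_3)
      ultimately show "(\<lambda>n. Z (s n) $ i) \<longlonglongrightarrow> Z t $ i"
        unfolding Z_def using Rt by (elim disjE) (auto intro!: tendsto_intros s_lim)
    qed
    show ?thesis
    proof (rule ccontr)
      assume "hpoint z \<notin> Y"
      from not_in_closed_nearby[OF cl z(1) this, of "\<lambda>n. Z (s n)"] Zlim
      have "\<forall>\<^sub>F n in sequentially. Z (s n) \<noteq> 0 \<and> hpoint (Z (s n)) \<notin> Y" by (simp add: Zt)
      moreover have "\<forall>\<^sub>F n in sequentially. R (s n) \<noteq> 0"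
        by (rule tendsto_imp_eventually_ne[OF isCont_tendsto_compose[OF \<open>isCont R t\<close> s_lim] Rt])
      ultimately have "\<forall>\<^sub>F n in sequentially. R (s n) \<noteq> 0 \<and> Z (s n) \<noteq> 0 \<and> hpoint (Z (s n)) \<notin> Y"
        by eventually_elim auto
      then obtain n where n: "R (s n) \<noteq> 0" "Z (s n) \<noteq> 0" "hpoint (Z (s n)) \<notin> Y"
        using eventually_happens by force
      have "0 < inverse (real (Suc n))" "inverse (real (Suc n)) \<le> 1" by (auto simp: field_simps)
      then have "sin (inverse (real (Suc n))) > 0" using pi_gt3 by (intro sin_gt_zero) linarith+
      then have "cos (s n) \<noteq> 0" using ct st by (simp add: s_def cos_add)
      moreover have "line_form (leaf \<sigma> (s n)) (Z (s n)) = 0"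
        using n(1) by (simp add: \<sigma>1 line_form_def Z_def R_def)
      ultimately show False using aff[OF n(2), of "s n"] n(3) \<sigma>1 by simp
    qed
  qed (use aff z in blast)
  have on_real: "hpoint z \<in> Y" if z: "z \<noteq> 0" "real_line z = 0" for z
  proof -
    define \<Psi> :: "real^3 \<Rightarrow> complex^3" where "\<Psi> v = (\<chi> i. of_real (v $ i))" for v
    define T where "T = {v \<in> - {0}. hpoint (\<Psi> v) \<in> Y}"
    have \<Psi>0: "\<Psi> v \<noteq> 0" if "v \<noteq> 0" for v using that by (auto simp: \<Psi>_def vec_eq_iff)
    have ld: "line_form a (\<Psi> v) = of_real (a \<bullet> v)" for a v
      by (simp add: line_form_def \<Psi>_def inner_vec_def sum_3)
    obtain v0 t1 t2 where v0: "leaf \<sigma> t1 \<bullet> v0 < 0" "0 < leaf \<sigma> t2 \<bullet> v0"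
    proof (cases "\<sigma> = 1")
      case True
      then show ?thesis
        by (intro that[of pi "vector [1, 0, 0]" 0]) (simp_all add: inner_vec_def sum_3)
    next
      case False
      then have "\<sigma> = -1" using \<sigma> by simp
      then show ?thesis
        by (intro that[of 0 "vector [1, 0, 1/2]" "pi / 2"]) (simp_all add: inner_vec_def sum_3)
    qed
    \<comment> \<open>Every real point of \<open>W\<close> lies on some leaf between \<open>t1\<close> and \<open>t2\<close>.\<close>
    define W where "W = {v. leaf \<sigma> t1 \<bullet> v < 0} \<inter> {v. 0 < leaf \<sigma> t2 \<bullet> v}"
    have W: "open W" "v0 \<in> W"
      using v0 by (auto simp: W_def intro!: open_Int open_Collect_less continuous_intros)
    have "W \<subseteq> T"
    proof
      fix v assume v: "v \<in> W"
      have cont: "continuous_on UNIV (\<lambda>t. leaf \<sigma> t \<bullet> v)"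
        unfolding inner_vec_def sum_3 inner_real_def
        by (intro continuous_on_add continuous_on_mult continuous_on_const
            continuous_at_imp_continuous_on ballI DERIV_isCont[OF leaf_has_derivative])
      then have "\<exists>t. leaf \<sigma> t \<bullet> v = 0"
      proof (cases "t1 \<le> t2")
        case True
        then show ?thesis
          using IVT'[of "\<lambda>t. leaf \<sigma> t \<bullet> v" t1 0 t2] v continuous_on_subset[OF cont] by (force simp: W_def)
      next
        case False
        then show ?thesis
          using IVT2'[of "\<lambda>t. leaf \<sigma> t \<bullet> v" t1 0 t2] v continuous_on_subset[OF cont] by (force simp: W_def)
      qed
      then obtain t where "line_form (leaf \<sigma> t) (\<Psi> v) = 0" using ld by auto
      moreover have "v \<noteq> 0" using v by (auto simp: W_def)
      ultimately show "v \<in> T" using on_leaf \<Psi>0 by (auto simp: T_def)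
    qed
    then have "interior T \<noteq> {}" using W by (metis empty_iff interior_maximal subsetD)
    moreover have "analytic_set_near T v" if "v \<in> - {0}" for v
      unfolding T_def
    proof (rule pullback_analytic[OF _ _ _ _ Y that])
      show "real_analytic_at (\<lambda>x. Re (\<Psi> x $ i)) x" for i x
        by (simp add: \<Psi>_def real_analytic_at_linear bounded_linear_vec_nth)
      show "real_analytic_at (\<lambda>x. Im (\<Psi> x $ i)) x" for i x
        by (simp add: \<Psi>_def real_analytic_at_const)
    qed (use \<Psi>0 in auto)
    ultimately have T: "T = - {0}"
      by (intro analytic_set_identity) (auto simp: T_def connected_punctured_universe)
    obtain c v where cv: "c \<noteq> 0" "v \<noteq> 0" "z = c *s \<Psi> v"
      using real_point_cases[OF z] unfolding \<Psi>_def by blast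
    then have "hpoint z = hpoint (\<Psi> v)" using \<Psi>0 hpoint_scale by blast
    moreover have "hpoint (\<Psi> v) \<in> Y" using T cv(2) unfolding T_def by blast
    ultimately show ?thesis by simp
  qed
  show ?thesis
    unfolding projective_set_subset_iff
  proof (intro allI impI)
    fix z assume z: "z \<noteq> 0" "hpoint z \<in> web {\<sigma>}"
    then have "z \<in> web_cone {\<sigma>}" by (simp add: hpoint_in_web)
    then show "hpoint z \<in> Y"
      using web_cone_iff_leaf[of "{\<sigma>}" z] \<sigma> on_leaf[OF z(1)] on_real[OF z(1)] by auto
  qed
qed

lemma line_point_in_web:
  assumes \<sigma>: "\<sigma> \<in> {-1, 1}" and t: "t \<in> leaf_range \<sigma>" and w: "w \<noteq> 0"
  shows "line_point (leaf_x \<sigma> t) (leaf_y \<sigma> t) w \<noteq> 0"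
    "hpoint (line_point (leaf_x \<sigma> t) (leaf_y \<sigma> t) w) \<in> web {\<sigma>}"
proof -
  show nz: "line_point (leaf_x \<sigma> t) (leaf_y \<sigma> t) w \<noteq> 0"
    using w by (auto simp: vec3_eq_iff vec2_eq_iff)
  have "line_form (leaf \<sigma> t) (line_point (leaf_x \<sigma> t) (leaf_y \<sigma> t) w) = 0"
    by (rule line_point_on_leaf[OF leaf_3_nonzero[OF t]])
  then show "hpoint (line_point (leaf_x \<sigma> t) (leaf_y \<sigma> t) w) \<in> web {\<sigma>}"
    using web_cone_iff_leaf[of "{\<sigma>}"] \<sigma> by (auto simp: hpoint_in_web[OF nz])
qed

text \<open>
  If the interior of one of two closed sets that cover \<open>M\<close> is empty, then the other one contains the
  nonempty open complement; so one of the two pullbacks has interior points and is all of \<open>M\<close>.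
\<close>

lemma web_indecomposable:
  assumes \<sigma>: "\<sigma> \<in> {-1, 1}" and Y: "real_analytic_subvariety Y" and Z: "real_analytic_subvariety Z"
    and cov: "web {\<sigma>} \<subseteq> Y \<union> Z"
  shows "web {\<sigma>} \<subseteq> Y \<or> web {\<sigma>} \<subseteq> Z"
proof -
  define M :: "(real \<times> (complex^2)) set" where "M = leaf_range \<sigma> \<times> - {0}"
  define \<Psi> where "\<Psi> m = line_point (leaf_x \<sigma> (fst m)) (leaf_y \<sigma> (fst m)) (snd m)" for m
  have M: "open M" "connected M" "M \<noteq> {}"
  proof -
    have "open (leaf_range \<sigma>)" "connected (leaf_range \<sigma>)" "0 \<in> leaf_range \<sigma>" by (auto simp: leaf_range_def)
    moreover have "connected (- {0} :: (complex^2) set)"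
      by (rule connected_punctured_universe) (simp add: DIM_complex)
    moreover have "(1 :: complex^2) \<in> - {0}" by (simp add: vec_eq_iff)
    ultimately show "open M" "connected M" "M \<noteq> {}" unfolding M_def
      by (auto intro!: open_Times connected_Times open_Compl)
  qed
  have inM: "fst m \<in> leaf_range \<sigma>" "snd m \<noteq> 0" if "m \<in> M" for m using that by (auto simp: M_def)
  have an: "real_analytic_at (\<lambda>x. Re (\<Psi> x $ i)) m" "real_analytic_at (\<lambda>x. Im (\<Psi> x $ i)) m" if "m \<in> M" for m i
  proof -
    have f: "real_analytic_at (\<lambda>m :: real \<times> (complex^2). fst m) m"
      by (intro real_analytic_at_linear bounded_linear_fst)
    have l3: "leaf \<sigma> (fst m) $ 3 \<noteq> 0" using leaf_3_nonzero inM(1)[OF that] by blast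
    have xy: "real_analytic_at (\<lambda>m :: real \<times> (complex^2). leaf_x \<sigma> (fst m)) m"
      "real_analytic_at (\<lambda>m :: real \<times> (complex^2). leaf_y \<sigma> (fst m)) m"
      unfolding leaf_x_def leaf_y_def
      by (intro real_analytic_intros real_analytic_at_leaf f l3)+
    have w: "real_analytic_at (\<lambda>m :: real \<times> (complex^2). Re (snd m $ j)) m"
      "real_analytic_at (\<lambda>m :: real \<times> (complex^2). Im (snd m $ j)) m" for j
      by (intro real_analytic_at_linear bounded_linear_compose[OF bounded_linear_Re_nth bounded_linear_snd]
            bounded_linear_compose[OF bounded_linear_Im_nth bounded_linear_snd])+
    have "i = 1 \<or> i = 2 \<or> i = 3" by (rule exhaust_3)
    then show "real_analytic_at (\<lambda>x. Re (\<Psi> x $ i)) m" "real_analytic_at (\<lambda>x. Im (\<Psi> x $ i)) m"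
      unfolding \<Psi>_def by (elim disjE; auto intro!: real_analytic_intros xy w)+
  qed
  have main: "web {\<sigma>} \<subseteq> Y'" if Y': "real_analytic_subvariety Y'" and int: "interior {m \<in> M. hpoint (\<Psi> m) \<in> Y'} \<noteq> {}" for Y'
  proof -
    have "{m \<in> M. hpoint (\<Psi> m) \<in> Y'} = M"
    proof (rule analytic_set_identity[OF M(1,2) _ _ int])
      show "analytic_set_near {m \<in> M. hpoint (\<Psi> m) \<in> Y'} m" if "m \<in> M" for m
        by (rule pullback_analytic[OF M(1) an _ Y' that])
          (use line_point_in_web(1)[OF \<sigma>] inM in \<open>auto simp: \<Psi>_def\<close>)
    qed blast
    then have all: "hpoint (\<Psi> m) \<in> Y'" if "m \<in> M" for m using that by blast
    have "hpoint (line_point (leaf_x \<sigma> t) (leaf_y \<sigma> t) w) \<in> Y'" if "t \<in> leaf_range \<sigma>" "w \<noteq> 0" for t w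
      using all[of "(t, w)"] that by (simp add: M_def \<Psi>_def)
    then show ?thesis by (rule web_single_subset[OF \<sigma> Y'])
  qed
  show ?thesis
  proof (cases "interior {m \<in> M. hpoint (\<Psi> m) \<in> Y} = {}")
    case False
    then show ?thesis using main[OF Y] by blast
  next
    case True
    define W where "W = M - {m \<in> M. hpoint (\<Psi> m) \<in> Y}"
    have oW: "open W"
      unfolding open_contains_ball
    proof
      fix m assume m: "m \<in> W"
      have "analytic_set_near {m \<in> M. hpoint (\<Psi> m) \<in> Y} m"
        by (rule pullback_analytic[OF M(1) an _ Y])
          (use line_point_in_web(1)[OF \<sigma>] inM m in \<open>auto simp: \<Psi>_def W_def\<close>)
      moreover have "m \<notin> {m \<in> M. hpoint (\<Psi> m) \<in> Y}" using m by (simp add: W_def)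
      ultimately obtain e where e: "e > 0" "ball m e \<inter> {m \<in> M. hpoint (\<Psi> m) \<in> Y} = {}"
        using analytic_set_near_separated by blast
      obtain e' where "e' > 0" "ball m e' \<subseteq> M" using M(1) m by (auto simp: W_def elim: openE)
      then show "\<exists>e>0. ball m e \<subseteq> W"
        using e by (intro exI[of _ "min e e'"]) (auto simp: W_def)
    qed
    have "W \<noteq> {}"
    proof
      assume "W = {}"
      then have "M \<subseteq> interior {m \<in> M. hpoint (\<Psi> m) \<in> Y}"
        by (intro interior_maximal M) (auto simp: W_def)
      then show False using True M(3) by blast
    qed
    have "W \<subseteq> {m \<in> M. hpoint (\<Psi> m) \<in> Z}"
      using cov line_point_in_web(2)[OF \<sigma>] inM by (fastforce simp: W_def \<Psi>_def)
    then have "W \<subseteq> interior {m \<in> M. hpoint (\<Psi> m) \<in> Z}" using oW by (rule interior_maximal)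
    then have "interior {m \<in> M. hpoint (\<Psi> m) \<in> Z} \<noteq> {}" using \<open>W \<noteq> {}\<close> by blast
    then show ?thesis using main[OF Z] by blast
  qed
qed

lemma web_irreducible:
  assumes "\<sigma> \<in> {-1, 1}"
  shows "irreducible_among real_analytic_subvariety (web {\<sigma>})"
  unfolding irreducible_among_def
proof (intro conjI notI)
  show "real_analytic_subvariety (web {\<sigma>})" by (rule web_analytic) (use assms in auto)
  assume "\<exists>Y Z. real_analytic_subvariety Y \<and> real_analytic_subvariety Z \<and> Y \<subset> web {\<sigma>} \<and> Z \<subset> web {\<sigma>} \<and> web {\<sigma>} = Y \<union> Z"
  then show False using web_indecomposable[OF assms] by (metis order_refl psubset_eq subset_antisym)
qed

section \<open>Mixed polynomials\<close>

definition mixed_monomial :: "(3 \<Rightarrow> nat) \<times> (3 \<Rightarrow> nat) \<Rightarrow> complex^3 \<Rightarrow> complex" where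
  "mixed_monomial e z = (\<Prod>j\<in>UNIV. (z $ j) ^ fst e j) * (\<Prod>j\<in>UNIV. (cnj (z $ j)) ^ snd e j)"

definition mixed_poly :: "(complex^3 \<Rightarrow> complex) \<Rightarrow> bool" where
  "mixed_poly f \<longleftrightarrow> (\<exists>A c. finite A \<and> f = mixed_polynomial A c)"

lemma mixed_polynomial_alt: "mixed_polynomial A c z = (\<Sum>e\<in>A. c e * mixed_monomial e z)"
  by (simp add: mixed_polynomial_def mixed_monomial_def case_prod_beta mult.assoc)

lemma mixed_polyI:
  assumes "finite I" "\<And>z. f z = (\<Sum>i\<in>I. k i * mixed_monomial (e i) z)"
  shows "mixed_poly f"
proof -
  define c where "c x = (\<Sum>i\<in>{i \<in> I. e i = x}. k i)" for x
  have "f z = mixed_polynomial (e ` I) c z" for z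
  proof -
    have "f z = (\<Sum>x\<in>e ` I. \<Sum>i\<in>{i \<in> I. e i = x}. k i * mixed_monomial (e i) z)"
      unfolding assms(2) by (rule sum.image_gen[OF assms(1)])
    also have "\<dots> = (\<Sum>x\<in>e ` I. c x * mixed_monomial x z)"
      unfolding c_def sum_distrib_right by (intro sum.cong refl) auto
    finally show ?thesis by (simp add: mixed_polynomial_alt)
  qed
  then show ?thesis unfolding mixed_poly_def using assms(1) by (intro exI[of _ "e ` I"] exI[of _ c]) auto
qed

lemma mixed_polyE:
  assumes "mixed_poly f"
  obtains A c where "finite A" "\<And>z. f z = (\<Sum>e\<in>A. c e * mixed_monomial e z)"
  using assms unfolding mixed_poly_def by (auto simp: mixed_polynomial_alt)

text \<open>
  Any class of functions that contains the constants and is closed under sums and products admits the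
  evaluation of mixed polynomials.
\<close>

lemma mixed_poly_eval:
  assumes "mixed_poly \<rho>" and const: "\<And>k. C (\<lambda>_. k)"
    and add: "\<And>f g. C f \<Longrightarrow> C g \<Longrightarrow> C (\<lambda>x. f x + g x)"
    and mult: "\<And>f g. C f \<Longrightarrow> C g \<Longrightarrow> C (\<lambda>x. f x * g x)"
    and Z: "\<And>j. C (\<lambda>x. Z x $ j)" "\<And>j. C (\<lambda>x. cnj (Z x $ j))"
  shows "C (\<lambda>x. \<rho> (Z x))"
proof -
  obtain B c where \<rho>: "finite B" "\<And>z. \<rho> z = (\<Sum>e\<in>B. c e * mixed_monomial e z)" using assms(1) by (rule mixed_polyE) blast
  have power: "C (\<lambda>x. f x ^ n)" if "C f" for f n by (induction n) (auto intro: const mult that)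
  have prod: "C (\<lambda>x. \<Prod>j\<in>J. f j x)" if "\<And>j. C (f j)" for f and J :: "3 set"
    by (induction J rule: infinite_finite_induct) (auto intro: const mult that)
  have sum: "C (\<lambda>x. \<Sum>e\<in>E. f e x)" if "\<And>e. C (f e)" for f and E :: "((3 \<Rightarrow> nat) \<times> (3 \<Rightarrow> nat)) set"
    by (induction E rule: infinite_finite_induct) (auto intro: const add that)
  show ?thesis
    unfolding \<rho> mixed_monomial_def by (intro sum mult const prod power Z)
qed

lemma mixed_poly_const: "mixed_poly (\<lambda>_. k)"
  by (rule mixed_polyI[of "{()}" _ "\<lambda>_. k" "\<lambda>_. (\<lambda>_. 0, \<lambda>_. 0)"]) (auto simp: mixed_monomial_def)

lemma mixed_poly_nth: "mixed_poly (\<lambda>z. z $ i)"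
proof (rule mixed_polyI[of "{()}" _ "\<lambda>_. 1" "\<lambda>_. (\<lambda>j. if j = i then 1 else 0, \<lambda>_. 0)"])
  have "(\<Prod>j\<in>UNIV. (z $ j) ^ (if j = i then 1 else 0)) = (\<Prod>j\<in>UNIV. if j = i then z $ j else 1)" for z :: "complex^3"
    by (rule prod.cong) auto
  then show "z $ i = (\<Sum>_\<in>{()}. 1 * mixed_monomial (\<lambda>j. if j = i then 1 else 0, \<lambda>_. 0) z)" for z :: "complex^3"
    by (simp add: mixed_monomial_def)
qed simp

lemma mixed_poly_cnj_nth: "mixed_poly (\<lambda>z. cnj (z $ i))"
proof (rule mixed_polyI[of "{()}" _ "\<lambda>_. 1" "\<lambda>_. (\<lambda>_. 0, \<lambda>j. if j = i then 1 else 0)"])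
  have "(\<Prod>j\<in>UNIV. (cnj (z $ j)) ^ (if j = i then 1 else 0)) = (\<Prod>j\<in>UNIV. if j = i then cnj (z $ j) else 1)" for z :: "complex^3"
    by (rule prod.cong) auto
  then show "cnj (z $ i) = (\<Sum>_\<in>{()}. 1 * mixed_monomial (\<lambda>_. 0, \<lambda>j. if j = i then 1 else 0) z)" for z :: "complex^3"
    by (simp add: mixed_monomial_def)
qed simp

lemma mixed_poly_add:
  assumes "mixed_poly f" "mixed_poly g"
  shows "mixed_poly (\<lambda>z. f z + g z)"
proof -
  obtain A c where f: "finite A" "\<And>z. f z = (\<Sum>e\<in>A. c e * mixed_monomial e z)" using assms(1) by (rule mixed_polyE) blast
  obtain B d where g: "finite B" "\<And>z. g z = (\<Sum>e\<in>B. d e * mixed_monomial e z)" using assms(2) by (rule mixed_polyE) blast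
  show ?thesis
    by (rule mixed_polyI[of "A <+> B" _ "case_sum c d" "case_sum (\<lambda>e. e) (\<lambda>e. e)"])
      (simp_all add: f g sum.Plus)
qed

lemma mixed_poly_mult:
  assumes "mixed_poly f" "mixed_poly g"
  shows "mixed_poly (\<lambda>z. f z * g z)"
proof -
  obtain A c where f: "finite A" "\<And>z. f z = (\<Sum>e\<in>A. c e * mixed_monomial e z)" using assms(1) by (rule mixed_polyE) blast
  obtain B d where g: "finite B" "\<And>z. g z = (\<Sum>e\<in>B. d e * mixed_monomial e z)" using assms(2) by (rule mixed_polyE) blast
  define e where "e p = ((\<lambda>j. fst (fst p) j + fst (snd p) j), (\<lambda>j. snd (fst p) j + snd (snd p) j))"
    for p :: "((3 \<Rightarrow> nat) \<times> (3 \<Rightarrow> nat)) \<times> ((3 \<Rightarrow> nat) \<times> (3 \<Rightarrow> nat))"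
  have e: "mixed_monomial (e p) z = mixed_monomial (fst p) z * mixed_monomial (snd p) z" for p z
    by (simp add: mixed_monomial_def e_def power_add prod.distrib mult_ac)
  show ?thesis
  proof (rule mixed_polyI[of "A \<times> B" _ "\<lambda>p. c (fst p) * d (snd p)" e])
    show "finite (A \<times> B)" using f g by simp
    show "f z * g z = (\<Sum>p\<in>A \<times> B. c (fst p) * d (snd p) * mixed_monomial (e p) z)" for z
      unfolding f g sum_product sum.cartesian_product e
      by (rule sum.cong) (auto simp: mult_ac)
  qed
qed

lemma mixed_poly_power: "mixed_poly f \<Longrightarrow> mixed_poly (\<lambda>z. f z ^ n)"
  by (induction n) (auto intro: mixed_poly_const mixed_poly_mult)

lemma mixed_poly_diff:
  assumes "mixed_poly f" "mixed_poly g"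
  shows "mixed_poly (\<lambda>z. f z - g z)"
  using mixed_poly_add[OF assms(1) mixed_poly_mult[OF mixed_poly_const[of "-1"] assms(2)]] by simp

lemmas mixed_poly_intros = mixed_poly_const mixed_poly_nth mixed_poly_cnj_nth mixed_poly_add mixed_poly_mult mixed_poly_power mixed_poly_diff

lemma mixed_poly_real_line: "mixed_poly (\<lambda>z. of_real (real_line z $ i))"
proof -
  have im: "of_real (Im (cnj a * b)) = (cnj a * b - a * cnj b) * Complex 0 (-1/2)" for a b
    by (simp add: complex_eq_iff field_simps)
  have "i = 1 \<or> i = 2 \<or> i = 3" by (rule exhaust_3)
  then show ?thesis
    by (elim disjE) (simp_all only: real_line_nth im, (intro mixed_poly_intros)+)
qed

lemma real_algebraic_web: "real_algebraic (web {-1, 1})"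
  unfolding real_algebraic_def
proof (intro exI conjI)
  let ?\<rho> = "\<lambda>z. complex_of_real (cubic (real_line z))"
  show "bihomogeneous_polynomial ?\<rho>"
    unfolding bihomogeneous_polynomial_def
  proof
    have "mixed_poly ?\<rho>"
      unfolding cubic_def of_real_add of_real_diff of_real_mult of_real_power
      by (intro mixed_poly_intros mixed_poly_real_line)
    then show "\<exists>A c. finite A \<and> ?\<rho> = mixed_polynomial A c" by (simp add: mixed_poly_def)
    show "\<exists>k::nat. \<forall>l z. ?\<rho> (l *s z) = of_real (cmod l ^ (2 * k)) * ?\<rho> z"
      by (rule exI[of _ 3]) (simp add: real_line_scale cubic_scale flip: power_mult)
  qed
  show "web {-1, 1} = hpoint ` {z. z \<noteq> 0 \<and> ?\<rho> z = 0}"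
    by (simp add: web_def locus_def web_cone_all)
qed

section \<open>Real-algebraic sets are subvarieties\<close>

text \<open>
  A complex-valued function on a chart whose real and imaginary parts are polynomials.
\<close>

definition complex_polyfun :: "(complex^2 \<Rightarrow> complex) \<Rightarrow> bool" where
  "complex_polyfun f \<longleftrightarrow> real_polynomial_function (\<lambda>w. Re (f w)) \<and> real_polynomial_function (\<lambda>w. Im (f w))"

lemma complex_polyfun_mixed_poly:
  assumes "mixed_poly \<rho>" "A \<in> chart_lifts"
  shows "complex_polyfun (\<lambda>w. \<rho> (A w))"
  by (rule mixed_poly_eval[OF assms(1), where C = complex_polyfun])
    (auto simp: complex_polyfun_def intro!: polyfun_intros polyfun_lift[OF assms(2)])

lemma mixed_poly_continuous:
  assumes "mixed_poly \<rho>" shows "continuous_on S \<rho>"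
  by (rule mixed_poly_eval[OF assms, where C = "continuous_on S" and Z = "\<lambda>z. z"]) (intro continuous_intros; assumption)+

lemma real_algebraicE:
  assumes "real_algebraic Y"
  obtains \<rho> where "mixed_poly \<rho>" "scale_invariant {z. \<rho> z = 0}" "Y = locus {z. \<rho> z = 0}"
proof -
  obtain \<rho> k where \<rho>: "mixed_poly \<rho>" "\<And>l z. \<rho> (l *s z) = of_real (cmod l ^ (2 * k)) * \<rho> z"
    "Y = hpoint ` {z. z \<noteq> 0 \<and> \<rho> z = 0}"
    using assms unfolding real_algebraic_def bihomogeneous_polynomial_def mixed_poly_def by blast
  show ?thesis
    by (rule that[OF \<rho>(1)]) (auto simp: scale_invariant_def locus_def \<rho>)
qed

lemma real_algebraic_imp_analytic:
  assumes "real_algebraic Y"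
  shows "real_analytic_subvariety Y"
proof -
  obtain \<rho> where \<rho>: "mixed_poly \<rho>" "scale_invariant {z. \<rho> z = 0}" "Y = locus {z. \<rho> z = 0}"
    using real_algebraicE[OF assms] .
  show ?thesis
    unfolding real_analytic_subvariety_def
  proof (intro conjI ballI allI)
    have "closed {z. \<rho> z = 0}"
      by (intro closed_Collect_eq mixed_poly_continuous \<rho> continuous_on_const)
    then show "closed Y" unfolding \<rho>(3) by (rule closed_locus[OF \<rho>(2)])
    fix \<phi> w assume "\<phi> \<in> affine_charts"
    then obtain A where A: "A \<in> chart_lifts" "\<phi> = (\<lambda>w. hpoint (A w))" by (auto simp: affine_charts_eq_lifts)
    have p: "real_polynomial_function (\<lambda>w. Re (\<rho> (A w)))" "real_polynomial_function (\<lambda>w. Im (\<rho> (A w)))"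
      using complex_polyfun_mixed_poly[OF \<rho>(1) A(1)] by (auto simp: complex_polyfun_def)
    show "analytic_set_near (\<phi> -` Y) w"
    proof (rule analytic_set_nearI[where F = "{\<lambda>w. Re (\<rho> (A w)), \<lambda>w. Im (\<rho> (A w))}" and U = UNIV])
      show "x \<in> \<phi> -` Y \<longleftrightarrow> (\<forall>f\<in>{\<lambda>w. Re (\<rho> (A w)), \<lambda>w. Im (\<rho> (A w))}. f x = 0)" for x
        unfolding A(2) \<rho>(3) vimage_chart_locus[OF \<rho>(2) A(1)] by (simp add: complex_eq_iff)
    qed (use p in \<open>auto intro: real_analytic_on_polyfun\<close>)
  qed
qed

section \<open>The algebraic closure of a piece\<close>

text \<open>
  Functions that agree on the curve \<open>y\<^sup>2 = x\<^sup>3 - x\<close> with an element of its coordinate ring, in normal form.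
\<close>

definition curve_poly :: "(real \<times> real \<Rightarrow> complex) \<Rightarrow> bool" where
  "curve_poly f \<longleftrightarrow> (\<exists>a b. \<forall>x y. y\<^sup>2 = x^3 - x \<longrightarrow>
     f (x, y) = poly a (of_real x) + of_real y * poly b (of_real x))"

lemma curve_polyI:
  assumes "\<And>x y. y\<^sup>2 = x^3 - x \<Longrightarrow> f (x, y) = poly a (of_real x) + of_real y * poly b (of_real x)"
  shows "curve_poly f"
  using assms unfolding curve_poly_def by blast

lemma curve_poly_const: "curve_poly (\<lambda>_. k)"
  by (rule curve_polyI[of _ "[:k:]" 0]) simp

lemma curve_poly_x: "curve_poly (\<lambda>v. of_real (fst v))"
  by (rule curve_polyI[of _ "[:0, 1:]" 0]) simp

lemma curve_poly_y: "curve_poly (\<lambda>v. of_real (snd v))"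
  by (rule curve_polyI[of _ 0 "[:1:]"]) simp

lemma curve_poly_add:
  assumes "curve_poly f" "curve_poly g" shows "curve_poly (\<lambda>v. f v + g v)"
proof -
  obtain a b where f: "\<And>x y. y\<^sup>2 = x^3 - x \<Longrightarrow> f (x, y) = poly a (of_real x) + of_real y * poly b (of_real x)"
    using assms(1) unfolding curve_poly_def by blast
  obtain c d where g: "\<And>x y. y\<^sup>2 = x^3 - x \<Longrightarrow> g (x, y) = poly c (of_real x) + of_real y * poly d (of_real x)"
    using assms(2) unfolding curve_poly_def by blast
  show ?thesis
    by (rule curve_polyI[of _ "a + c" "b + d"]) (simp add: f g algebra_simps)
qed

lemma curve_poly_mult:
  assumes "curve_poly f" "curve_poly g" shows "curve_poly (\<lambda>v. f v * g v)"
proof -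
  obtain a b where f: "\<And>x y. y\<^sup>2 = x^3 - x \<Longrightarrow> f (x, y) = poly a (of_real x) + of_real y * poly b (of_real x)"
    using assms(1) unfolding curve_poly_def by blast
  obtain c d where g: "\<And>x y. y\<^sup>2 = x^3 - x \<Longrightarrow> g (x, y) = poly c (of_real x) + of_real y * poly d (of_real x)"
    using assms(2) unfolding curve_poly_def by blast
  show ?thesis
  proof (rule curve_polyI)
    fix x y :: real assume y: "y\<^sup>2 = x^3 - x"
    define X Y where "X = complex_of_real x" and "Y = complex_of_real y"
    have YY: "Y * Y = X ^ 3 - X"
      unfolding X_def Y_def by (metis y of_real_diff of_real_mult of_real_power power2_eq_square)
    have "f (x, y) * g (x, y) = (poly a X + Y * poly b X) * (poly c X + Y * poly d X)"
      using f[OF y] g[OF y] by (simp add: X_def Y_def)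
    also have "\<dots> = poly a X * poly c X + (Y * Y) * poly b X * poly d X + Y * (poly a X * poly d X + poly b X * poly c X)"
      by (simp add: algebra_simps)
    also have "\<dots> = poly (a * c + [:0, -1, 0, 1:] * b * d) X + Y * poly (a * d + b * c) X"
      unfolding YY by (simp add: algebra_simps power3_eq_cube)
    finally show "f (x, y) * g (x, y) = poly (a * c + [:0, -1, 0, 1:] * b * d) (of_real x) + of_real y * poly (a * d + b * c) (of_real x)"
      by (simp add: X_def Y_def)
  qed
qed

lemma curve_poly_mixed_poly:
  assumes "mixed_poly \<rho>"
  shows "curve_poly (\<lambda>v. \<rho> (line_point (fst v) (snd v) w))"
proof (rule mixed_poly_eval[OF assms, where C = curve_poly, OF curve_poly_const curve_poly_add curve_poly_mult])
  have minus: "curve_poly (\<lambda>v. - f v)" if "curve_poly f" for f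
    using curve_poly_mult[OF curve_poly_const[of "-1"] that] by simp
  note intros = curve_poly_const curve_poly_add curve_poly_mult minus curve_poly_x curve_poly_y
  fix j :: 3
  have "j = 1 \<or> j = 2 \<or> j = 3" by (rule exhaust_3)
  then show "curve_poly (\<lambda>v. line_point (fst v) (snd v) w $ j)"
    by (elim disjE) (simp_all only: line_point_nth, (intro intros)+)
  from \<open>j = 1 \<or> j = 2 \<or> j = 3\<close> show "curve_poly (\<lambda>v. cnj (line_point (fst v) (snd v) w $ j))"
    by (elim disjE) (simp_all only: line_point_nth complex_cnj_minus complex_cnj_add complex_cnj_mult
        complex_cnj_complex_of_real, (intro intros)+)
qed

lemma line_point_in_web_cone:
  assumes "y\<^sup>2 = x^3 - x" "sgn (x^3 - 1/2) = \<sigma>" "\<sigma> \<in> {-1, 1}"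
  shows "line_point x y w \<in> web_cone {\<sigma>}"
proof -
  define v :: "real^3" where "v = vector [x, y, 1]"
  have v: "v \<noteq> 0" "cubic v = 0" "sgn (separator v) = \<sigma>"
    using assms by (auto simp: v_def vec3_eq_iff cubic_def separator_def)
  obtain t k where k: "k \<noteq> 0" "v = k *\<^sub>R leaf \<sigma> t"
    using leaf_iff[OF assms(3) v(1)] v by blast
  have "line_form v (line_point x y w) = 0" by (simp add: line_form_def v_def)
  then have "line_form (leaf \<sigma> t) (line_point x y w) = 0" using k by (simp add: line_form_scale)
  then show ?thesis using web_cone_iff_leaf[of "{\<sigma>}"] assms(3) by auto
qed

text \<open>
  Over an interval of values \<open>x\<close>, the piece contains both points \<open>(x, \<plusminus> y)\<close> with \<open>y \<noteq> 0\<close>, so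
  \<open>A(x) + y B(x) = A(x) - y B(x) = 0\<close> for infinitely many \<open>x\<close>.
\<close>

lemma algebraic_contains_both:
  assumes Y: "real_algebraic Y" and \<sigma>: "\<sigma> \<in> {-1, 1}" "\<sigma>' \<in> {-1, 1}" and sub: "web {\<sigma>} \<subseteq> Y"
  shows "web {\<sigma>'} \<subseteq> Y"
proof -
  obtain \<rho> where \<rho>: "mixed_poly \<rho>" "scale_invariant {z. \<rho> z = 0}" "Y = locus {z. \<rho> z = 0}"
    using real_algebraicE[OF Y] .
  have van: "\<rho> (line_point x y w) = 0" if w: "w \<noteq> 0" and xy: "y\<^sup>2 = x^3 - x" for x y w
  proof -
    obtain a b where ab: "\<And>x y. y\<^sup>2 = x^3 - x \<Longrightarrow> \<rho> (line_point x y w) = poly a (of_real x) + of_real y * poly b (of_real x)"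
      using curve_poly_mixed_poly[OF \<rho>(1), of w] unfolding curve_poly_def by auto
    \<comment> \<open>Values \<open>x\<close> over which the component \<open>\<sigma>\<close> has two distinct points.\<close>
    define I :: "real set" where "I = (if \<sigma> = 1 then {1<..<2} else {-1<..<0})"
    have "infinite I" by (simp add: I_def)
    have z: "poly a (of_real x) = 0 \<and> poly b (of_real x) = 0" if x: "x \<in> I" for x
    proof -
      have pos: "0 < x^3 - x" and sg: "sgn (x^3 - 1/2) = \<sigma>"
      proof -
        have f: "x^3 - x = x * (x - 1) * (x + 1)" by (simp add: power3_eq_cube algebra_simps)
        show "0 < x^3 - x" using x unfolding f by (auto simp: I_def zero_less_mult_iff mult_less_0_iff split: if_splits)
        show "sgn (x^3 - 1/2) = \<sigma>"
        proof (cases "\<sigma> = 1")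
          case True
          then have "1 < x" using x by (simp add: I_def)
          then have "1 < x^3" by (rule one_less_power) simp
          then show ?thesis using True by simp
        next
          case False
          then have "x < 0" using x by (simp add: I_def)
          then have "x^3 < 0" by (simp add: power3_eq_cube mult_less_0_iff zero_less_mult_iff)
          then have "x^3 - 1/2 < 0" by linarith
          then show ?thesis using False \<sigma>(1) by (simp only: sgn_neg) simp
        qed
      qed
      have "\<rho> (line_point x y w) = 0" if y: "y\<^sup>2 = x^3 - x" for y
      proof -
        have nz: "line_point x y w \<noteq> 0" using w by (auto simp: vec3_eq_iff vec2_eq_iff)
        have "hpoint (line_point x y w) \<in> web {\<sigma>}"
          using line_point_in_web_cone[OF y sg \<sigma>(1)] by (simp add: hpoint_in_web[OF nz])
        then have "hpoint (line_point x y w) \<in> locus {z. \<rho> z = 0}" using sub \<rho>(3) by blast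
        then show ?thesis using hpoint_in_locus[OF \<rho>(2) nz] by simp
      qed
      then have "poly a (of_real x) + of_real y * poly b (of_real x) = 0" if "y\<^sup>2 = x^3 - x" for y
        using ab[OF that] that by simp
      from this[of "sqrt (x^3 - x)"] this[of "- sqrt (x^3 - x)"] pos
      have "poly a (of_real x) + of_real (sqrt (x^3 - x)) * poly b (of_real x) = 0"
        "poly a (of_real x) - of_real (sqrt (x^3 - x)) * poly b (of_real x) = 0" by auto
      then have "poly a (of_real x) = 0" "of_real (sqrt (x^3 - x)) * poly b (of_real x) = 0" by algebra+
      then show ?thesis using pos by auto
    qed
    have inf: "infinite (complex_of_real ` I)"
      using \<open>infinite I\<close> by (simp add: finite_image_iff inj_on_def)
    have "a = 0"
    proof (rule ccontr)
      assume "a \<noteq> 0"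
      then have "finite {u. poly a u = 0}" by (rule poly_roots_finite)
      moreover have "complex_of_real ` I \<subseteq> {u. poly a u = 0}" using z by auto
      ultimately show False using inf finite_subset by blast
    qed
    moreover have "b = 0"
    proof (rule ccontr)
      assume "b \<noteq> 0"
      then have "finite {u. poly b u = 0}" by (rule poly_roots_finite)
      moreover have "complex_of_real ` I \<subseteq> {u. poly b u = 0}" using z by auto
      ultimately show False using inf finite_subset by blast
    qed
    ultimately show ?thesis using ab[OF xy] by simp
  qed
  show ?thesis
  proof (rule web_single_subset[OF \<sigma>(2) real_algebraic_imp_analytic[OF Y]])
    fix t and w :: "complex^2" assume t: "t \<in> leaf_range \<sigma>'" and w: "w \<noteq> 0"
    have l3: "leaf \<sigma>' t $ 3 \<noteq> 0" using leaf_3_nonzero[OF t] .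
    have "(leaf_y \<sigma>' t)\<^sup>2 = leaf_x \<sigma>' t ^ 3 - leaf_x \<sigma>' t"
    proof -
      have "(leaf \<sigma>' t $ 2)\<^sup>2 * leaf \<sigma>' t $ 3 = (leaf \<sigma>' t $ 1)^3 - leaf \<sigma>' t $ 1 * (leaf \<sigma>' t $ 3)\<^sup>2"
        using leaf_cubic[OF \<sigma>(2), of t] by (simp add: cubic_def)
      then have "(b * c)\<^sup>2 * c = (a * c)^3 - (a * c) * c\<^sup>2"
        if "leaf \<sigma>' t $ 1 = a * c" "leaf \<sigma>' t $ 2 = b * c" "leaf \<sigma>' t $ 3 = c" for a b c
        using that by simp
      from this[of "leaf_x \<sigma>' t" "leaf \<sigma>' t $ 3" "leaf_y \<sigma>' t"] l3
      have "leaf \<sigma>' t $ 3 ^ 3 * ((leaf_y \<sigma>' t)\<^sup>2 - (leaf_x \<sigma>' t ^ 3 - leaf_x \<sigma>' t)) = 0"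
        by (simp add: leaf_x_def[symmetric] leaf_y_def[symmetric] power2_eq_square power3_eq_cube algebra_simps)
          (simp add: leaf_x_def leaf_y_def)
      then show ?thesis using l3 by simp
    qed
    from van[OF w this] have "\<rho> (line_point (leaf_x \<sigma>' t) (leaf_y \<sigma>' t) w) = 0" .
    then show "hpoint (line_point (leaf_x \<sigma>' t) (leaf_y \<sigma>' t) w) \<in> Y"
      using hpoint_in_locus[OF \<rho>(2) line_point_in_web(1)[OF \<sigma>(2) t w]] \<rho>(3) by simp
  qed
qed

lemma web_union: "web {-1, 1} = web {-1} \<union> web {1}"
  unfolding web_def locus_def web_cone_def by auto

lemma web_not_subset: "\<not> web {-1} \<subseteq> web {1}" "\<not> web {1} \<subseteq> web {-1}"
proof -
  \<comment> \<open>Points on the leaf \<open>(0, 0, 1)\<close> of the oval and on the leaf \<open>(1, 0, 1)\<close> of the other component.\<close>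
  define z1 z2 :: "complex^3" where "z1 = vector [1, \<i>, 0]" and "z2 = vector [1, \<i>, -1]"
  have nz: "z1 \<noteq> 0" "z2 \<noteq> 0" by (auto simp: z1_def z2_def vec3_eq_iff)
  have r: "real_line z1 = vector [0, 0, 1]" "real_line z2 = vector [1, 0, 1]"
    by (auto simp: z1_def z2_def vec3_eq_iff)
  have c: "real_line z1 \<noteq> 0" "real_line z2 \<noteq> 0" by (auto simp: r vec3_eq_iff)
  have "z1 \<in> web_cone {-1}" "z1 \<notin> web_cone {1}" "z2 \<in> web_cone {1}" "z2 \<notin> web_cone {-1}"
    using c unfolding web_cone_def mem_Collect_eq r by (auto simp: cubic_def separator_def)
  then show "\<not> web {-1} \<subseteq> web {1}" "\<not> web {1} \<subseteq> web {-1}"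
    using hpoint_in_web[OF nz(1)] hpoint_in_web[OF nz(2)] by blast+
qed

text \<open>
  The oval piece lies in one of the two algebraic parts by its analytic irreducibility, and the other
  piece follows into the same part.
\<close>

lemma web_algebraic_irreducible: "irreducible_among real_algebraic (web {-1, 1})"
  unfolding irreducible_among_def
proof (intro conjI notI real_algebraic_web)
  assume "\<exists>Y Z. real_algebraic Y \<and> real_algebraic Z \<and> Y \<subset> web {-1, 1} \<and> Z \<subset> web {-1, 1} \<and> web {-1, 1} = Y \<union> Z"
  then obtain Y Z where YZ: "real_algebraic Y" "real_algebraic Z" "Y \<subset> web {-1, 1}" "Z \<subset> web {-1, 1}"
    "web {-1, 1} = Y \<union> Z" by blast
  have "web {-1} \<subseteq> Y \<union> Z" using YZ(5) web_union by blast
  then have "web {-1} \<subseteq> Y \<or> web {-1} \<subseteq> Z"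
    using web_indecomposable[of "-1"] real_algebraic_imp_analytic YZ(1,2) by blast
  then have "web {-1, 1} \<subseteq> Y \<or> web {-1, 1} \<subseteq> Z"
    using algebraic_contains_both[OF YZ(1), of "-1" 1] algebraic_contains_both[OF YZ(2), of "-1" 1] web_union by auto
  then show False using YZ(3,4) by blast
qed

lemma web_not_algebraic: "\<not> real_algebraic (web {-1})"
  using algebraic_contains_both[of "web {-1}" "-1" 1] web_not_subset(2) by auto

lemma web_analytic_reducible: "\<not> irreducible_among real_analytic_subvariety (web {-1, 1})"
proof -
  have "web {-1} \<subset> web {-1, 1}" "web {1} \<subset> web {-1, 1}"
    using web_union web_not_subset by auto
  moreover have "real_analytic_subvariety (web {-1})" "real_analytic_subvariety (web {1})"
    by (intro web_analytic; simp)+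
  ultimately show ?thesis unfolding irreducible_among_def using web_union by blast
qed

lemma web_semialgebraic:
  assumes \<sigma>: "\<sigma> \<in> {-1, 1}"
  shows "semialgebraic (web {\<sigma>})"
  unfolding semialgebraic_def
proof
  fix \<phi> assume "\<phi> \<in> affine_charts"
  then obtain A where A: "A \<in> chart_lifts" "\<phi> = (\<lambda>w. hpoint (A w))" by (auto simp: affine_charts_eq_lifts)
  define f g h where "f w = cubic (real_line (A w))" and "g w = separator (real_line (A w))"
    and "h w = \<sigma> * separator (real_line (A w))" for w
  have p: "real_polynomial_function f" "real_polynomial_function g" "real_polynomial_function h"
    unfolding f_def g_def h_def by (intro polyfun_intros polyfun_cubic_lift polyfun_separator_lift A)+
  have "\<phi> -` web {\<sigma>} = {w. f w = 0 \<and> 0 \<le> h w}"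
    unfolding A(2) vimage_chart_web[OF A(1)] f_def h_def using web_cone_single[OF \<sigma>] by auto
  also have "\<dots> = (\<Union>(P, Q)\<in>{({f, g}, {}), ({f}, {h})}. {x. (\<forall>f\<in>P. f x = 0) \<and> (\<forall>f\<in>Q. f x > 0)})"
    using \<sigma> by (auto simp: g_def h_def)
  finally show "semialgebraic_set (\<phi> -` web {\<sigma>})"
    unfolding semialgebraic_set_def
    by (intro exI[of _ "{({f, g}, {}), ({f}, {h})}"]) (auto simp: p)
qed

section \<open>Regular points and the leaves through them\<close>

text \<open>
  For dimension \<open>3\<close> in the real dimension \<open>4\<close> of the chart, there is a single defining function.
\<close>

lemma regular_iff:
  fixes X :: "(complex^2) set"
  shows "p \<in> regular_points X \<longleftrightarrow> p \<in> X \<and>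
    (\<exists>U g v. open U \<and> p \<in> U \<and> real_analytic_on g U \<and> (g has_derivative (\<lambda>h. h \<bullet> v)) (at p) \<and>
        v \<noteq> 0 \<and> X \<inter> U = {x \<in> U. g x = 0})" (is "?L \<longleftrightarrow> p \<in> X \<and> ?R")
proof
  assume ?L
  then obtain n U g v where n: "n + 3 = DIM(complex^2)" "p \<in> X" "open U" "p \<in> U"
     "\<forall>i<n. real_analytic_on (g i) U \<and> (g i has_derivative (\<lambda>h. h \<bullet> v i)) (at p)"
     "inj_on v {..<n}" "independent (v ` {..<n})" "X \<inter> U = {x \<in> U. \<forall>i<n. g i x = 0}"
    unfolding regular_points_def analytic_submanifold_near_def by blast
  have "n = 1" using n(1) by simp
  then have "v 0 \<noteq> 0" using n(7) dependent_zero[of "v ` {..<n}"] by force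
  then show "p \<in> X \<and> ?R"
    using n \<open>n = 1\<close> by (intro conjI exI[of _ U] exI[of _ "g 0"] exI[of _ "v 0"]) auto
next
  assume "p \<in> X \<and> ?R"
  then obtain U g v where g: "p \<in> X" "open U" "p \<in> U" "real_analytic_on g U" "(g has_derivative (\<lambda>h. h \<bullet> v)) (at p)"
     "v \<noteq> 0" "X \<inter> U = {x \<in> U. g x = 0}" by blast
  show ?L
    unfolding regular_points_def analytic_submanifold_near_def mem_Collect_eq
  proof (intro conjI exI[of _ "1::nat"] exI[of _ U] exI[of _ "\<lambda>_. g"] exI[of _ "\<lambda>_. v"])
    have "{..<1::nat} = {0}" by auto
    then show "independent ((\<lambda>_. v) ` {..<1::nat})" "inj_on (\<lambda>_. v) {..<1::nat}"
      using g(6) by auto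
  qed (use g in auto)
qed

lemma real_analytic_has_gradient:
  "real_analytic_at f p \<Longrightarrow> \<exists>u. (f has_derivative (\<lambda>h. h \<bullet> u)) (at p)"
  by (erule real_analytic_strict_gradient) blast

text \<open>
  The gradient of a defining function stays nonzero near \<open>p\<close> by continuity.
\<close>

lemma regular_near:
  fixes X :: "(complex^2) set"
  assumes "p \<in> regular_points X"
  obtains e where "e > 0" "X \<inter> ball p e \<subseteq> regular_points X"
proof -
  obtain U g v where g: "p \<in> X" "open U" "p \<in> U" "real_analytic_on g U" "(g has_derivative (\<lambda>h. h \<bullet> v)) (at p)"
     "v \<noteq> 0" "X \<inter> U = {x \<in> U. g x = 0}" using assms unfolding regular_iff by blast
  have gp: "real_analytic_at g p" using g(3,4) by (simp add: real_analytic_on_def)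
  obtain d where d: "d > 0"
    "\<And>q w. q \<in> ball p d \<Longrightarrow> (g has_derivative (\<lambda>h. h \<bullet> w)) (at q) \<Longrightarrow> norm (w - v) \<le> norm v / 2"
    using real_analytic_gradient_continuous[OF gp g(5), of "norm v / 2"] g(6) by auto
  obtain e where e: "e > 0" "ball p e \<subseteq> U" using g(2,3) by (meson openE)
  have "x \<in> regular_points X" if x: "x \<in> X" "x \<in> ball p (min d e)" for x
  proof -
    have xU: "x \<in> U" "x \<in> ball p d" using x e(2) by auto
    then have "real_analytic_at g x" using g(4) by (simp add: real_analytic_on_def)
    then obtain w where w: "(g has_derivative (\<lambda>h. h \<bullet> w)) (at x)" using real_analytic_has_gradient by blast
    have "w \<noteq> 0" using d(2)[OF xU(2) w] g(6) by auto
    then show ?thesis unfolding regular_iff using x(1) g xU w by blast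
  qed
  then have "X \<inter> ball p (min d e) \<subseteq> regular_points X" by blast
  moreover have "min d e > 0" using d(1) e(1) by simp
  ultimately show ?thesis by (rule that[rotated])
qed

text \<open>
  All three charts look alike if the coordinate that is set to \<open>1\<close> is called \<open>k\<close>.
\<close>

lemma lift_index:
  assumes "A \<in> chart_lifts"
  shows "\<exists>k i j. (\<forall>l. l = k \<or> l = i \<or> l = (j :: 3)) \<and>
    (\<forall>a w. line_form a (A w) = of_real (a$k) + of_real (a$i) * w$1 + of_real (a$j) * w$2)"
proof -
  consider "A = (\<lambda>w. vector [1, w$1, w$2])" | "A = (\<lambda>w. vector [w$1, 1, w$2])" | "A = (\<lambda>w. vector [w$1, w$2, 1])"
    using assms by (auto simp: chart_lifts_def)
  then show ?thesis
  proof cases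
    case 1
    show ?thesis by (rule exI[of _ 1], rule exI[of _ 2], rule exI[of _ 3])
        (use exhaust_3 in \<open>auto simp: 1 line_form_def\<close>)
  next
    case 2
    show ?thesis by (rule exI[of _ 2], rule exI[of _ 1], rule exI[of _ 3])
        (use exhaust_3 in \<open>auto simp: 2 line_form_def\<close>)
  next
    case 3
    show ?thesis by (rule exI[of _ 3], rule exI[of _ 1], rule exI[of _ 2])
        (use exhaust_3 in \<open>auto simp: 3 line_form_def\<close>)
  qed
qed

lemma eq_scaleR_index:
  assumes "\<And>l. l = k \<or> l = i \<or> l = (j :: 3)" "a$k = c * b$k" "a$i = c * b$i" "a$j = c * (b$j :: real)"
  shows "a = c *\<^sub>R b"
proof -
  have "a $ l = (c *\<^sub>R b) $ l" for l using assms(1)[of l] assms(2-4) by auto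
  then show ?thesis by (simp add: vec_eq_iff)
qed

text \<open>
  Parallel affine lines with a common point coincide.
\<close>

lemma transversal_lines:
  assumes idx: "\<And>l. l = k \<or> l = i \<or> l = (j :: 3)"
    "\<And>a w. line_form a (A w) = of_real (a$k) + of_real (a$i) * w$1 + of_real (a$j) * w$2"
    and a: "line_form a (A p) = 0" and b: "line_form b (A p) = 0" "b \<noteq> 0" and ab: "\<And>c. a \<noteq> c *\<^sub>R b"
  shows "a$i * b$j - a$j * b$i \<noteq> 0"
proof
  assume d: "a$i * b$j - a$j * b$i = 0"
  have b0: "b$i \<noteq> 0 \<or> b$j \<noteq> 0"
  proof (rule ccontr)
    assume "\<not> (b$i \<noteq> 0 \<or> b$j \<noteq> 0)"
    then have "b$k = 0" "b$i = 0" "b$j = 0" using b(1) by (auto simp: idx(2))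
    then have "b = 0 *\<^sub>R b" by (intro eq_scaleR_index[OF idx(1)]) auto
    then show False using b(2) by simp
  qed
  define c where "c = (if b$i \<noteq> 0 then a$i / b$i else a$j / b$j)"
  have cij: "a$i = c * b$i" "a$j = c * b$j" using d b0 by (auto simp: c_def field_simps)
  have "complex_of_real (a$k) = of_real (c * b$k)"
  proof -
    have "complex_of_real (a$k) = - (of_real (a$i) * p$1 + of_real (a$j) * p$2)"
      using a by (simp add: idx(2) add_eq_0_iff2 add.assoc)
    also have "\<dots> = of_real c * (- (of_real (b$i) * p$1 + of_real (b$j) * p$2))"
      by (simp add: cij algebra_simps)
    also have "- (of_real (b$i) * p$1 + of_real (b$j) * p$2) = complex_of_real (b$k)"
      using b(1) by (simp add: idx(2) add_eq_0_iff2 add.assoc)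
    finally show ?thesis by simp
  qed
  then have "a$k = c * b$k" by (simp only: of_real_eq_iff)
  then have "a = c *\<^sub>R b" using cij by (intro eq_scaleR_index[OF idx(1)])
  then show False using ab by blast
qed

lemma directional_derivative:
  fixes g :: "'a::euclidean_space \<Rightarrow> real"
  assumes "(g has_derivative (\<lambda>h. h \<bullet> w)) (at x)"
  shows "((\<lambda>s. g (x + s *\<^sub>R d)) has_real_derivative d \<bullet> w) (at 0)"
proof -
  have "((\<lambda>s. x + s *\<^sub>R d) has_derivative (\<lambda>s. s *\<^sub>R d)) (at (0::real))"
    by (auto intro!: derivative_eq_intros)
  then have "((\<lambda>s. g (x + s *\<^sub>R d)) has_derivative (\<lambda>s. (s *\<^sub>R d) \<bullet> w)) (at (0::real))"
    using assms by (intro has_derivative_compose[where g = g and f = "\<lambda>s. x + s *\<^sub>R d"]) auto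
  then show ?thesis by (simp add: has_field_derivative_def mult.commute[of _ "d \<bullet> w"])
qed

lemma gradient_orthogonal:
  fixes g :: "'a::euclidean_space \<Rightarrow> real"
  assumes "(g has_derivative (\<lambda>h. h \<bullet> w)) (at x)" "open U" "x \<in> U" "\<And>s::real. x + s *\<^sub>R d \<in> U \<Longrightarrow> g (x + s *\<^sub>R d) = 0"
  shows "d \<bullet> w = 0"
proof -
  have "((\<lambda>s. g (x + s *\<^sub>R d)) has_real_derivative 0) (at 0)"
  proof (rule has_field_derivative_transform_within_open[OF DERIV_const])
    have "continuous_on UNIV (\<lambda>s. x + s *\<^sub>R d)" by (intro continuous_intros)
    then show "open ((\<lambda>s. x + s *\<^sub>R d) -` U)" using assms(2) open_vimage by blast
  qed (use assms in auto)
  then show ?thesis by (rule DERIV_unique[OF directional_derivative[OF assms(1)]])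
qed

text \<open>
  The tangent directions of two different complex lines through a point span the whole tangent
  space, and the function vanishes along both.
\<close>

lemma two_lines_gradient_zero:
  assumes A: "A \<in> chart_lifts" and idx: "\<And>a w. line_form a (A w) = of_real (a$k) + of_real (a$i) * w$1 + of_real (a$j) * w$2"
    and X: "\<And>w. line_form a (A w) = 0 \<or> line_form b (A w) = 0 \<Longrightarrow> w \<in> X"
    and g: "open U" "x \<in> U" "X \<inter> U = {x \<in> U. g x = 0}" "(g has_derivative (\<lambda>h. h \<bullet> w)) (at x)"
    and ab: "line_form a (A x) = 0" "line_form b (A x) = 0" "a$i * b$j - a$j * b$i \<noteq> 0"
  shows "w = 0"
proof -
  have dir: "d \<bullet> w = 0" if "c \<in> {a, b}" "of_real (c$i) * d$1 + of_real (c$j) * d$2 = 0" for c d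
  proof (rule gradient_orthogonal[OF g(4) g(1,2)])
    fix s assume s: "x + s *\<^sub>R d \<in> U"
    have "line_form c (A (x + s *\<^sub>R d)) = line_form c (A x) + of_real s * (of_real (c$i) * d$1 + of_real (c$j) * d$2)"
      unfolding idx vector_add_component vector_scaleR_component
      unfolding scaleR_conv_of_real by (simp add: algebra_simps)
    also have "\<dots> = 0" using that ab by auto
    finally have "x + s *\<^sub>R d \<in> X" using X that(1) by auto
    then show "g (x + s *\<^sub>R d) = 0" using g(3) s by blast
  qed
  define D where "D = complex_of_real (a$i * b$j - a$j * b$i)"
  have D: "D \<noteq> 0" using ab(3) unfolding D_def of_real_eq_0_iff .
  \<comment> \<open>Cramer's rule decomposes the gradient \<open>w\<close> itself along the directions of the two lines.\<close>
  define \<alpha> \<beta> where "\<alpha> = - (of_real (b$i) * w$1 + of_real (b$j) * w$2) / D"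
    and "\<beta> = (of_real (a$i) * w$1 + of_real (a$j) * w$2) / D"
  define da db :: "complex^2" where "da = vector [of_real (a$j) * \<alpha>, - of_real (a$i) * \<alpha>]"
    and "db = vector [of_real (b$j) * \<beta>, - of_real (b$i) * \<beta>]"
  have "da \<bullet> w = 0" by (rule dir[of a]) (auto simp: da_def)
  moreover have "db \<bullet> w = 0" by (rule dir[of b]) (auto simp: db_def)
  moreover have "da + db = w"
  proof -
    have "D * (da + db) $ 1 = D * w$1" "D * (da + db) $ 2 = D * w$2"
      using D by (simp_all add: da_def db_def \<alpha>_def \<beta>_def distrib_left divide_simps) (simp_all add: D_def algebra_simps)
    then show ?thesis using D by (simp add: vec2_eq_iff)
  qed
  ultimately have "w \<bullet> w = 0" by (metis add.right_neutral inner_add_left)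
  then show ?thesis by simp
qed

lemma web_chart_leafI:
  assumes "A \<in> chart_lifts" "J \<subseteq> {-1, 1}" "\<sigma> \<in> J" "line_form (leaf \<sigma> t) (A w) = 0"
  shows "w \<in> (\<lambda>w. hpoint (A w)) -` web J"
  unfolding vimage_chart_web[OF assms(1)] using web_cone_iff_leaf[OF assms(2)] assms(3,4) by blast

lemma continuous_on_line_form_leaf:
  assumes "A \<in> chart_lifts"
  shows "continuous_on S (\<lambda>x. line_form (leaf \<sigma> (snd x)) (A (fst x)))"
proof -
  obtain k i j where "\<And>l. l = k \<or> l = i \<or> l = (j :: 3)"
    and idx: "\<And>a w. line_form a (A w) = of_real (a$k) + of_real (a$i) * w$1 + of_real (a$j) * w$2"
    using lift_index[OF assms] by blast
  have "continuous_on UNIV (\<lambda>t. leaf \<sigma> t $ l)" for l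
    by (intro continuous_at_imp_continuous_on ballI DERIV_isCont[OF leaf_has_derivative])
  then have cl: "continuous_on S (\<lambda>x. leaf \<sigma> (snd x) $ l)" for l and S :: "((complex^2) \<times> real) set"
    by (rule continuous_on_compose2) (auto intro!: continuous_intros)
  show ?thesis
    unfolding idx
    by (intro continuous_on_add continuous_on_mult continuous_on_of_real cl) (intro continuous_intros)+
qed

text \<open>
  On the compact set of parameters within half a period of \<open>t0\<close> but not within \<open>\<delta>\<close>, no leaf passes through \<open>p\<close>;
  so none passes through nearby points.
\<close>

lemma nearby_leaves:
  assumes A: "A \<in> chart_lifts" and J: "J \<subseteq> {-1, 1}" and \<delta>: "\<delta> > 0"
    and sol: "\<And>\<sigma>' t. \<sigma>' \<in> J \<Longrightarrow> line_form (leaf \<sigma>' t) (A p) = 0 \<Longrightarrow> \<sigma>' = \<sigma> \<and> sin (t - t0) = 0"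
  obtains V where "open V" "p \<in> V"
    "\<And>w \<sigma>' t. w \<in> V \<Longrightarrow> \<sigma>' \<in> J \<Longrightarrow> line_form (leaf \<sigma>' t) (A w) = 0 \<Longrightarrow>
       \<sigma>' = \<sigma> \<and> (\<exists>s. \<bar>s - t0\<bar> < \<delta> \<and> line_form (leaf \<sigma> s) (A w) = 0)"
proof -
  define C where "C \<sigma>' = (if \<sigma>' = \<sigma> then {t0 - pi / 2 .. t0 + pi / 2} - {t0 - \<delta> <..< t0 + \<delta>}
      else {t0 - pi / 2 .. t0 + pi / 2})" for \<sigma>'
  have C: "compact (C \<sigma>')" for \<sigma>' by (auto simp: C_def intro!: compact_diff)
  have pos: "cmod (line_form (leaf \<sigma>' t) (A p)) > 0" if "\<sigma>' \<in> J" "t \<in> C \<sigma>'" for \<sigma>' t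
  proof (rule ccontr)
    assume "\<not> cmod (line_form (leaf \<sigma>' t) (A p)) > 0"
    then have z: "\<sigma>' = \<sigma>" "sin (t - t0) = 0" using sol[OF that(1)] by auto
    have "t0 - pi / 2 \<le> t" "t \<le> t0 + pi / 2" using that(2) by (auto simp: C_def split: if_splits)
    then have "\<bar>t - t0\<bar> < pi" using pi_gt_zero by linarith
    then have "t - t0 = 0" using z(2) sin_eq_0_pi[of "t - t0"] by linarith
    then show False using that(2) z(1) \<delta> by (simp add: C_def)
  qed
  have cont: "continuous_on (UNIV \<times> UNIV) (\<lambda>x. cmod (line_form (leaf \<sigma>' (snd x)) (A (fst x))))" for \<sigma>'
    by (intro continuous_on_norm continuous_on_line_form_leaf[OF A])
  have "\<exists>V. open V \<and> p \<in> V \<and> (\<forall>w\<in>V. \<forall>t\<in>C \<sigma>'. cmod (line_form (leaf \<sigma>' t) (A w)) > 0)" if "\<sigma>' \<in> J" for \<sigma>'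
    by (rule tube_positive[OF open_UNIV UNIV_I cont C pos[OF that]]) blast+
  then obtain V where V: "\<And>\<sigma>'. \<sigma>' \<in> J \<Longrightarrow> open (V \<sigma>')" "\<And>\<sigma>'. \<sigma>' \<in> J \<Longrightarrow> p \<in> V \<sigma>'"
    "\<And>\<sigma>' w t. \<sigma>' \<in> J \<Longrightarrow> w \<in> V \<sigma>' \<Longrightarrow> t \<in> C \<sigma>' \<Longrightarrow> line_form (leaf \<sigma>' t) (A w) \<noteq> 0"
    by (metis norm_zero less_irrefl)
  have "finite J" using J finite_subset by blast
  show ?thesis
  proof (rule that[of "\<Inter>\<sigma>'\<in>J. V \<sigma>'"])
    show "open (\<Inter>\<sigma>'\<in>J. V \<sigma>')" using \<open>finite J\<close> V(1) by blast
    show "p \<in> (\<Inter>\<sigma>'\<in>J. V \<sigma>')" using V(2) by blast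
    fix w \<sigma>' t assume w: "w \<in> (\<Inter>\<sigma>'\<in>J. V \<sigma>')" and \<sigma>': "\<sigma>' \<in> J" and z: "line_form (leaf \<sigma>' t) (A w) = 0"
    obtain s k where sr: "t0 - pi / 2 \<le> s" "s \<le> t0 + pi / 2" and k: "k \<noteq> 0" "leaf \<sigma>' t = k *\<^sub>R leaf \<sigma>' s"
      using leaf_reduce[of t0 \<sigma>' t] less_imp_le by blast
    have zs: "line_form (leaf \<sigma>' s) (A w) = 0" using z k by (simp add: line_form_scale)
    then have "s \<notin> C \<sigma>'" using V(3)[OF \<sigma>'] w \<sigma>' by blast
    then have "\<sigma>' = \<sigma>" "\<bar>s - t0\<bar> < \<delta>" using sr by (auto simp: C_def split: if_splits)
    then show "\<sigma>' = \<sigma> \<and> (\<exists>s. \<bar>s - t0\<bar> < \<delta> \<and> line_form (leaf \<sigma> s) (A w) = 0)" using zs by blast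
  qed
qed

lemma norm_rotation:
  "(C * a - S * b)\<^sup>2 + (C * b + S * a)\<^sup>2 = (S\<^sup>2 + C\<^sup>2) * (a\<^sup>2 + b\<^sup>2)" for a b C S :: real
  by (simp add: power2_eq_square algebra_simps)

text \<open>
  Otherwise the web near \<open>p\<close> consists of the real points, which have codimension two and cannot
  separate the positive from the negative values of a defining function \<open>g\<close>: with \<open>y\<close> the imaginary
  part of its gradient, half a circle in the imaginary directions joins points on both sides.
\<close>

lemma real_leaf_exists:
  assumes A: "A \<in> chart_lifts" and J: "J \<subseteq> {-1, 1}" and p: "Im_vec p = 0"
    and reg: "p \<in> regular_points ((\<lambda>w. hpoint (A w)) -` web J)"
  shows "\<exists>\<sigma>\<in>J. \<exists>t. line_form (leaf \<sigma> t) (A p) = 0"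
proof (rule ccontr)
  assume none: "\<not> (\<exists>\<sigma>\<in>J. \<exists>t. line_form (leaf \<sigma> t) (A p) = 0)"
  define X where "X = (\<lambda>w. hpoint (A w)) -` web J"
  obtain V where V: "open V" "p \<in> V"
    "\<And>w \<sigma>' t. w \<in> V \<Longrightarrow> \<sigma>' \<in> J \<Longrightarrow> line_form (leaf \<sigma>' t) (A w) = 0 \<Longrightarrow> \<sigma>' = 0"
    using nearby_leaves[OF A J zero_less_one, of p 0 0] none by metis
  have XV: "w \<in> X \<longleftrightarrow> Im_vec w = 0" if "w \<in> V" for w
  proof -
    have "\<not> (\<exists>\<sigma>\<in>J. \<exists>t. line_form (leaf \<sigma> t) (A w) = 0)" using V(3)[OF that] J by force
    then show ?thesis
      unfolding X_def vimage_chart_web[OF A] using web_cone_iff_leaf[OF J] real_line_lift_0_iff[OF A]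
      by (auto simp: Im_vec_0_iff)
  qed
  obtain U g v where g: "p \<in> X" "open U" "p \<in> U" "real_analytic_on g U" "(g has_derivative (\<lambda>h. h \<bullet> v)) (at p)"
     "v \<noteq> 0" "X \<inter> U = {x \<in> U. g x = 0}" using reg unfolding X_def[symmetric] regular_iff by blast
  \<comment> \<open>The part of the gradient that is orthogonal to the real points.\<close>
  define y :: "complex^2" where "y = (\<chi> l. \<i> * of_real (Im (v $ l)))"
  have yv: "y \<bullet> v = (Im (v$1))\<^sup>2 + (Im (v$2))\<^sup>2"
    by (simp add: y_def inner_vec_def sum_2 inner_complex_def power2_eq_square)
  have Im_vec_ne: "Im (v$1) \<noteq> 0 \<or> Im (v$2) \<noteq> 0"
  proof (rule ccontr)
    assume "\<not> (Im (v$1) \<noteq> 0 \<or> Im (v$2) \<noteq> 0)"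
    then have v0: "Im_vec (p + s *\<^sub>R v) = 0" for s using p by (simp add: Im_vec_0_iff)
    have "v \<bullet> v = 0"
    proof (rule gradient_orthogonal[OF g(5), of "U \<inter> V"])
      show "g (p + s *\<^sub>R v) = 0" if "p + s *\<^sub>R v \<in> U \<inter> V" for s
        using XV[of "p + s *\<^sub>R v"] v0 that g(7) by blast
    qed (use g V in auto)
    then show False using g(6) by simp
  qed
  then have pos: "y \<bullet> v > 0" unfolding yv by (simp add: sum_power2_gt_zero_iff)
  define y' :: "complex^2" where "y' = vector [- \<i> * of_real (Im (v$2)), \<i> * of_real (Im (v$1))]"
  have line: "((\<lambda>s. g (p + s *\<^sub>R y)) has_real_derivative y \<bullet> v) (at 0)"
    by (rule directional_derivative[OF g(5)])
  have gp: "g p = 0" using g(1,3,7) by blast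
  obtain d1 where d1: "d1 > 0" "\<And>h. 0 < h \<Longrightarrow> h < d1 \<Longrightarrow> g (p + h *\<^sub>R y) > 0"
    using DERIV_pos_inc_right[OF line pos] gp by auto
  obtain d2 where d2: "d2 > 0" "\<And>h. 0 < h \<Longrightarrow> h < d2 \<Longrightarrow> g (p - h *\<^sub>R y) < 0"
    using DERIV_pos_inc_left[OF line pos] gp by auto
  obtain r where r: "r > 0" "ball p r \<subseteq> U \<inter> V" using g(2,3) V(1,2) by (meson IntI openE open_Int)
  have ny: "norm y + norm y' + 1 > 0" by (simp add: add_nonneg_pos)
  define r' where "r' = r / (norm y + norm y' + 1)"
  have r': "r' > 0" using r(1) ny by (simp add: r'_def)
  define h where "h = min (min d1 d2) r' / 2"
  have h: "h > 0" "h < d1" "h < d2" "h < r / (norm y + norm y' + 1)"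
    using d1(1) d2(1) r' unfolding h_def r'_def[symmetric] by auto
  \<comment> \<open>The half circle from \<open>p + h y\<close> to \<open>p - h y\<close>; none of its points is real.\<close>
  define q where "q \<theta> = p + h *\<^sub>R (cos \<theta> *\<^sub>R y + sin \<theta> *\<^sub>R y')" for \<theta>
  have q_in: "q \<theta> \<in> ball p r" for \<theta>
  proof -
    have "norm (cos \<theta> *\<^sub>R y + sin \<theta> *\<^sub>R y') \<le> norm y + norm y'"
    proof -
      have "norm (cos \<theta> *\<^sub>R y + sin \<theta> *\<^sub>R y') \<le> \<bar>cos \<theta>\<bar> * norm y + \<bar>sin \<theta>\<bar> * norm y'"
        by (metis norm_scaleR norm_triangle_ineq)
      also have "\<dots> \<le> 1 * norm y + 1 * norm y'" by (intro add_mono mult_right_mono) auto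
      finally show ?thesis by simp
    qed
    then have "h * norm (cos \<theta> *\<^sub>R y + sin \<theta> *\<^sub>R y') \<le> h * (norm y + norm y' + 1)"
      using h(1) by (intro mult_left_mono) auto
    also have "\<dots> < r" using h(4) ny by (simp add: pos_less_divide_eq)
    finally show ?thesis using h(1) by (simp add: q_def dist_norm)
  qed
  have nz: "g (q \<theta>) \<noteq> 0" for \<theta>
  proof
    assume "g (q \<theta>) = 0"
    then have "q \<theta> \<in> X" using q_in r(2) g(7) by blast
    then have "Im_vec (q \<theta>) = 0" using XV q_in r(2) by blast
    then have "cos \<theta> * Im (v$1) - sin \<theta> * Im (v$2) = 0" "cos \<theta> * Im (v$2) + sin \<theta> * Im (v$1) = 0"
      using p h(1) by (auto simp: Im_vec_0_iff q_def y_def y'_def)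
    then have "(cos \<theta> * Im (v$1) - sin \<theta> * Im (v$2))\<^sup>2 + (cos \<theta> * Im (v$2) + sin \<theta> * Im (v$1))\<^sup>2 = 0" by simp
    moreover have "(cos \<theta> * Im (v$1) - sin \<theta> * Im (v$2))\<^sup>2 + (cos \<theta> * Im (v$2) + sin \<theta> * Im (v$1))\<^sup>2
        = ((sin \<theta>)\<^sup>2 + (cos \<theta>)\<^sup>2) * ((Im (v$1))\<^sup>2 + (Im (v$2))\<^sup>2)"
      by (rule norm_rotation)
    ultimately show False using pos yv by simp
  qed
  have cont: "continuous_on {0..pi} (\<lambda>\<theta>. g (q \<theta>))"
  proof (rule continuous_on_compose2[where t = "ball p r" and g = g])
    show "continuous_on (ball p r) g"
      using g(4) r(2) by (intro continuous_at_imp_continuous_on ballI real_analytic_at_imp_continuous)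
        (auto simp: real_analytic_on_def)
    show "continuous_on {0..pi} q" unfolding q_def by (intro continuous_intros)
  qed (use q_in in blast)
  have "g (q 0) > 0" "g (q pi) < 0" using d1(2)[OF h(1,2)] d2(2)[OF h(1,3)] by (auto simp: q_def)
  then show False using IVT2'[of "\<lambda>\<theta>. g (q \<theta>)" pi 0 0] cont nz by fastforce
qed

text \<open>
  Two distinct leaves through \<open>p\<close> would force the gradient of a defining function to vanish at \<open>p\<close>.
\<close>

lemma leaf_unique_real:
  assumes A: "A \<in> chart_lifts" and J: "J \<subseteq> {-1, 1}"
    and reg: "p \<in> regular_points ((\<lambda>w. hpoint (A w)) -` web J)"
    and \<sigma>: "\<sigma> \<in> J" "line_form (leaf \<sigma> t) (A p) = 0" and \<sigma>': "\<sigma>' \<in> J" "line_form (leaf \<sigma>' t') (A p) = 0"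
  shows "\<sigma>' = \<sigma> \<and> sin (t' - t) = 0"
proof (rule ccontr)
  assume ne: "\<not> (\<sigma>' = \<sigma> \<and> sin (t' - t) = 0)"
  define X where "X = (\<lambda>w. hpoint (A w)) -` web J"
  obtain k i j where idx: "\<And>l. l = k \<or> l = i \<or> l = (j :: 3)"
    "\<And>a w. line_form a (A w) = of_real (a$k) + of_real (a$i) * w$1 + of_real (a$j) * w$2"
    using lift_index[OF A] by blast
  obtain U g v where g: "p \<in> X" "open U" "p \<in> U" "(g has_derivative (\<lambda>h. h \<bullet> v)) (at p)"
     "v \<noteq> 0" "X \<inter> U = {x \<in> U. g x = 0}" using reg unfolding X_def[symmetric] regular_iff by blast
  have nl: "leaf \<sigma>' t' \<noteq> c *\<^sub>R leaf \<sigma> t" for c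
    using leaf_inj[of \<sigma>' \<sigma> t' c t] ne \<sigma>(1) \<sigma>'(1) J by blast
  have l0: "leaf \<sigma> t \<noteq> 0" using leaf_nonzero \<sigma>(1) J by blast
  have "leaf \<sigma>' t' $ i * leaf \<sigma> t $ j - leaf \<sigma>' t' $ j * leaf \<sigma> t $ i \<noteq> 0"
    by (rule transversal_lines[OF idx \<sigma>'(2) \<sigma>(2) l0 nl])
  then have "v = 0"
    using two_lines_gradient_zero[OF A idx(2) _ g(2,3,6,4) \<sigma>'(2) \<sigma>(2)]
      web_chart_leafI[OF A J \<sigma>(1)] web_chart_leafI[OF A J \<sigma>'(1)] unfolding X_def by blast
  then show False using g(5) by blast
qed

lemma tendsto_quotient_derivatives:
  fixes f g :: "real \<Rightarrow> real"
  assumes "(f has_real_derivative f') (at t)" "(g has_real_derivative g') (at t)" "f t = 0" "g t = 0" "g' \<noteq> 0"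
  shows "((\<lambda>s. f s / g s) \<longlongrightarrow> f' / g') (at t)"
proof -
  have "((\<lambda>s. ((f s - f t) / (s - t)) / ((g s - g t) / (s - t))) \<longlongrightarrow> f' / g') (at t)"
    using assms by (intro tendsto_divide) (auto simp: has_field_derivative_iff)
  moreover have "\<forall>\<^sub>F s in at t. ((f s - f t) / (s - t)) / ((g s - g t) / (s - t)) = f s / g s"
    unfolding eventually_at_filter using assms by (intro always_eventually) auto
  ultimately show ?thesis by (rule Lim_transform_eventually)
qed

text \<open>
  If the leaf at \<open>t\<close> has zero speed at \<open>p\<close>, then \<open>p\<close> is the limit of its intersection points \<open>x s\<close> with the leaves
  at \<open>s\<close>, as \<open>s\<close> tends to \<open>t\<close>.  At \<open>x s\<close> the gradient of a defining function vanishes, and by continuity it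
  vanishes at \<open>p\<close>.
\<close>

lemma leaf_simple_real:
  assumes A: "A \<in> chart_lifts" and J: "J \<subseteq> {-1, 1}" and p: "Im_vec p = 0"
    and reg: "p \<in> regular_points ((\<lambda>w. hpoint (A w)) -` web J)"
    and \<sigma>: "\<sigma> \<in> J" "line_form (leaf \<sigma> t) (A p) = 0"
  shows "line_form (leaf_deriv \<sigma> t) (A p) \<noteq> 0"
proof
  assume dbl: "line_form (leaf_deriv \<sigma> t) (A p) = 0"
  define X where "X = (\<lambda>w. hpoint (A w)) -` web J"
  obtain k i j where idx: "\<And>l. l = k \<or> l = i \<or> l = (j :: 3)"
    "\<And>a w. line_form a (A w) = of_real (a$k) + of_real (a$i) * w$1 + of_real (a$j) * w$2"
    using lift_index[OF A] by blast
  obtain U g v where g: "p \<in> X" "open U" "p \<in> U" "real_analytic_on g U" "(g has_derivative (\<lambda>h. h \<bullet> v)) (at p)"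
     "v \<noteq> 0" "X \<inter> U = {x \<in> U. g x = 0}" using reg unfolding X_def[symmetric] regular_iff by blast
  have gp: "real_analytic_at g p" using g(3,4) by (simp add: real_analytic_on_def)
  obtain d where d: "d > 0"
    "\<And>q w. q \<in> ball p d \<Longrightarrow> (g has_derivative (\<lambda>h. h \<bullet> w)) (at q) \<Longrightarrow> norm (w - v) \<le> norm v / 2"
    using real_analytic_gradient_continuous[OF gp g(5), of "norm v / 2"] g(6) by auto
  define a b where "a = leaf \<sigma> t" and "b = leaf_deriv \<sigma> t"
  have \<sigma>': "\<sigma> \<in> {-1, 1}" using \<sigma> J by blast
  have a0: "a \<noteq> 0" using leaf_nonzero[OF \<sigma>'] by (simp add: a_def)
  have ba: "b \<noteq> c *\<^sub>R a" for c
    using leaf_immersion[OF \<sigma>', of "- c" t 1] by (auto simp: a_def b_def)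
  have tr: "b$i * a$j - b$j * a$i \<noteq> 0"
    by (rule transversal_lines[OF idx _ _ a0 ba]) (use dbl \<sigma>(2) in \<open>simp_all add: a_def b_def\<close>)
  \<comment> \<open>Cramer's rule for the intersection of the leaves at \<open>t\<close> and \<open>s\<close>; all three determinants vanish at
    \<open>s = t\<close>, and their derivatives give the limit of the intersection point.\<close>
  define \<Delta> N1 N2 where "\<Delta> s = a$i * leaf \<sigma> s $ j - a$j * leaf \<sigma> s $ i"
    and "N1 s = a$j * leaf \<sigma> s $ k - a$k * leaf \<sigma> s $ j"
    and "N2 s = a$k * leaf \<sigma> s $ i - a$i * leaf \<sigma> s $ k" for s
  have der: "(\<Delta> has_real_derivative a$i * b$j - a$j * b$i) (at t)"
    "(N1 has_real_derivative a$j * b$k - a$k * b$j) (at t)"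
    "(N2 has_real_derivative a$k * b$i - a$i * b$k) (at t)"
    unfolding \<Delta>_def N1_def N2_def b_def by (auto intro!: derivative_eq_intros leaf_has_derivative)
  have at0: "\<Delta> t = 0" "N1 t = 0" "N2 t = 0" by (simp_all add: \<Delta>_def N1_def N2_def a_def)
  have \<Delta>': "a$i * b$j - a$j * b$i \<noteq> 0" using tr by (simp add: algebra_simps)
  have rp: "a$k + a$i * Re (p$1) + a$j * Re (p$2) = 0" "b$k + b$i * Re (p$1) + b$j * Re (p$2) = 0"
    using \<sigma>(2) dbl by (auto simp: idx(2) a_def b_def complex_eq_iff)
  have cr: "(a$j * b$k - a$k * b$j) / (a$i * b$j - a$j * b$i) = Re (p$1)"
    "(a$k * b$i - a$i * b$k) / (a$i * b$j - a$j * b$i) = Re (p$2)"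
  proof -
    have "a$j * b$k - a$k * b$j = Re (p$1) * (a$i * b$j - a$j * b$i)"
      "a$k * b$i - a$i * b$k = Re (p$2) * (a$i * b$j - a$j * b$i)" using rp by algebra+
    then show "(a$j * b$k - a$k * b$j) / (a$i * b$j - a$j * b$i) = Re (p$1)"
      "(a$k * b$i - a$i * b$k) / (a$i * b$j - a$j * b$i) = Re (p$2)" using \<Delta>' by (auto simp: divide_eq_eq)
  qed
  have lim: "((\<lambda>s. N1 s / \<Delta> s) \<longlongrightarrow> Re (p$1)) (at t)" "((\<lambda>s. N2 s / \<Delta> s) \<longlongrightarrow> Re (p$2)) (at t)"
    using tendsto_quotient_derivatives[OF der(2,1) at0(2,1) \<Delta>'] tendsto_quotient_derivatives[OF der(3,1) at0(3,1) \<Delta>']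
    unfolding cr by blast+
  define x :: "real \<Rightarrow> complex^2" where "x s = vector [of_real (N1 s / \<Delta> s), of_real (N2 s / \<Delta> s)]" for s
  have "(x \<longlongrightarrow> p) (at t)"
  proof (rule vec_tendstoI)
    fix l :: 2
    have pr: "p $ l = of_real (Re (p $ l))" for l
    proof -
      have "l = 1 \<or> l = 2" by (rule exhaust_2)
      then show ?thesis using p by (auto simp: complex_eq_iff Im_vec_0_iff)
    qed
    have "l = 1 \<or> l = 2" by (rule exhaust_2)
    then show "((\<lambda>s. x s $ l) \<longlongrightarrow> p $ l) (at t)"
      by (subst pr, unfold x_def, elim disjE) (auto intro!: tendsto_of_real lim simp del: of_real_divide)
  qed
  moreover have "open (U \<inter> ball p d)" "p \<in> U \<inter> ball p d" using g(2,3) d(1) by auto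
  ultimately have "\<forall>\<^sub>F s in at t. x s \<in> U \<inter> ball p d" by (rule topological_tendstoD)
  moreover have "\<forall>\<^sub>F s in at t. \<Delta> s \<noteq> 0"
  proof -
    have "((\<lambda>s. (\<Delta> s - \<Delta> t) / (s - t)) \<longlongrightarrow> a$i * b$j - a$j * b$i) (at t)"
      using der(1) by (simp add: has_field_derivative_iff)
    from tendsto_imp_eventually_ne[OF this \<Delta>'] show ?thesis
      by eventually_elim (auto simp: at0)
  qed
  ultimately have "\<forall>\<^sub>F s in at t. x s \<in> U \<inter> ball p d \<and> \<Delta> s \<noteq> 0" by eventually_elim auto
  then obtain s where s: "x s \<in> U" "x s \<in> ball p d" "\<Delta> s \<noteq> 0"
    using eventually_happens[of _ "at t"] by auto
  have on: "line_form a (A (x s)) = 0" "line_form (leaf \<sigma> s) (A (x s)) = 0"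
  proof -
    have "a$k * \<Delta> s + a$i * N1 s + a$j * N2 s = 0" "leaf \<sigma> s $ k * \<Delta> s + leaf \<sigma> s $ i * N1 s + leaf \<sigma> s $ j * N2 s = 0"
      by (simp_all add: \<Delta>_def N1_def N2_def algebra_simps)
    then have "a$k + a$i * (N1 s / \<Delta> s) + a$j * (N2 s / \<Delta> s) = 0"
      "leaf \<sigma> s $ k + leaf \<sigma> s $ i * (N1 s / \<Delta> s) + leaf \<sigma> s $ j * (N2 s / \<Delta> s) = 0"
      using s(3) by (simp_all add: field_simps)
    then have "complex_of_real (a$k + a$i * (N1 s / \<Delta> s) + a$j * (N2 s / \<Delta> s)) = 0"
      "complex_of_real (leaf \<sigma> s $ k + leaf \<sigma> s $ i * (N1 s / \<Delta> s) + leaf \<sigma> s $ j * (N2 s / \<Delta> s)) = 0"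
      by (simp_all only: of_real_0)
    then show "line_form a (A (x s)) = 0" "line_form (leaf \<sigma> s) (A (x s)) = 0"
      by (simp_all add: idx(2) x_def)
  qed
  have "real_analytic_at g (x s)" using g(4) s(1) by (simp add: real_analytic_on_def)
  then obtain w where w: "(g has_derivative (\<lambda>h. h \<bullet> w)) (at (x s))" using real_analytic_has_gradient by blast
  have "w = 0"
    using two_lines_gradient_zero[OF A idx(2) _ g(2) s(1) g(7) w on] web_chart_leafI[OF A J \<sigma>(1)] s(3)
    unfolding X_def a_def \<Delta>_def by blast
  then show False using d(2)[OF s(2) w] g(6) by simp
qed

text \<open>
  At a point that is not real, uniqueness and nonzero speed hold because all real lines
  through it are proportional.
\<close>

lemma regular_leaf:
  assumes A: "A \<in> chart_lifts" and J: "J \<subseteq> {-1, 1}"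
    and reg: "p \<in> regular_points ((\<lambda>w. hpoint (A w)) -` web J)"
  obtains \<sigma> t where "\<sigma> \<in> J" "line_form (leaf \<sigma> t) (A p) = 0" "line_form (leaf_deriv \<sigma> t) (A p) \<noteq> 0"
    "\<And>\<sigma>' t'. \<sigma>' \<in> J \<Longrightarrow> line_form (leaf \<sigma>' t') (A p) = 0 \<Longrightarrow> \<sigma>' = \<sigma> \<and> sin (t' - t) = 0"
proof (cases "Im_vec p = 0")
  case True
  obtain \<sigma> t where \<sigma>: "\<sigma> \<in> J" "line_form (leaf \<sigma> t) (A p) = 0" using real_leaf_exists[OF A J True reg] by blast
  show ?thesis
    by (rule that[OF \<sigma> leaf_simple_real[OF A J True reg \<sigma>]]) (rule leaf_unique_real[OF A J reg \<sigma>])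
next
  case False
  then have nz: "real_line (A p) \<noteq> 0" using real_line_lift_0_iff[OF A] by (simp add: Im_vec_0_iff)
  have "p \<in> (\<lambda>w. hpoint (A w)) -` web J" using reg unfolding regular_iff by blast
  then obtain \<sigma> t where \<sigma>: "\<sigma> \<in> J" "line_form (leaf \<sigma> t) (A p) = 0"
    unfolding vimage_chart_web[OF A] using web_cone_iff_leaf[OF J] nz by blast
  have \<sigma>': "\<sigma> \<in> {-1, 1}" using \<sigma>(1) J by blast
  obtain c where c: "leaf \<sigma> t = c *\<^sub>R real_line (A p)" using real_line_unique[OF nz \<sigma>(2)] .
  have c0: "c \<noteq> 0" using leaf_nonzero[OF \<sigma>', of t] c by auto
  show ?thesis
  proof (rule that[OF \<sigma>])
    show "line_form (leaf_deriv \<sigma> t) (A p) \<noteq> 0"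
    proof
      assume "line_form (leaf_deriv \<sigma> t) (A p) = 0"
      from real_line_unique[OF nz this] obtain c' where c': "leaf_deriv \<sigma> t = c' *\<^sub>R real_line (A p)" .
      have "c' *\<^sub>R leaf \<sigma> t + (- c) *\<^sub>R leaf_deriv \<sigma> t = 0" by (simp add: c c')
      then show False using leaf_immersion[OF \<sigma>'] c0 by fastforce
    qed
    fix \<sigma>2 t2 assume 2: "\<sigma>2 \<in> J" "line_form (leaf \<sigma>2 t2) (A p) = 0"
    obtain c2 where c2: "leaf \<sigma>2 t2 = c2 *\<^sub>R real_line (A p)" using real_line_unique[OF nz 2(2)] .
    have "leaf \<sigma>2 t2 = (c2 / c) *\<^sub>R leaf \<sigma> t" using c0 by (simp add: c c2)
    then show "\<sigma>2 = \<sigma> \<and> sin (t2 - t) = 0" using leaf_inj[of \<sigma>2 \<sigma>] 2(1) J \<sigma>' by blast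
  qed
qed

section \<open>Dimension\<close>

text \<open>
  The web contains no open set, as the cubic equation is a polynomial that does not vanish identically.
  The gradient of this polynomial is nonzero at a point of the leaf \<open>(0, 0, 1)\<close> of the oval and at a point of the leaf
  \<open>(1, 0, 1)\<close> of the other component.
\<close>

lemma web_dimension:
  assumes J: "J \<in> {{-1}, {1}, {-1, 1}}"
  shows "has_real_codimension (web J) 1"
proof -
  have no4: "\<not> analytic_submanifold_near d' (\<phi> -` web J) w" if d': "d' > 3" and \<phi>: "\<phi> \<in> affine_charts" for d' \<phi> w
  proof
    assume "analytic_submanifold_near d' (\<phi> -` web J) w"
    then obtain n :: nat and U g v where n: "n + d' = DIM(complex^2)" "open U" "w \<in> U"
        "\<phi> -` web J \<inter> U = {x \<in> U. \<forall>i<n. g i x = (0::real)}"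
      unfolding analytic_submanifold_near_def by blast
    have "n = 0" using n(1) d' by simp
    then have sub: "U \<subseteq> \<phi> -` web J" using n(4) by blast
    obtain A where A: "A \<in> chart_lifts" "\<phi> = (\<lambda>w. hpoint (A w))" using \<phi> by (auto simp: affine_charts_eq_lifts)
    have z: "cubic (real_line (A x)) = 0" if "x \<in> U" for x
      using that sub vimage_chart_web[OF A(1), of J] A(2) by (auto simp: web_cone_def)
    obtain e where e: "e > 0" "ball w e \<subseteq> U" using n(2,3) by (meson openE)
    have all: "cubic (real_line (A x)) = 0" for x
      by (rule real_analytic_identity_convex[OF convex_UNIV real_analytic_on_polyfun[OF polyfun_cubic_lift[OF A(1)]] UNIV_I e(1) _ UNIV_I])
        (use z e(2) in blast)
    \<comment> \<open>The point \<open>(1, 1 + \<i>, 1 - \<i>)\<close> lies in all three charts and off the web.\<close>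
    consider "A = (\<lambda>w. vector [1, w$1, w$2])" | "A = (\<lambda>w. vector [w$1, 1, w$2])" | "A = (\<lambda>w. vector [w$1, w$2, 1])"
      using A(1) by (auto simp: chart_lifts_def)
    then show False
    proof cases
      case 1
      show False using all[of "vector [Complex 1 1, Complex 1 (-1)]"] by (simp add: 1 cubic_def)
    next
      case 2
      show False using all[of "vector [Complex (1/2) (-1/2), Complex 0 (-1)]"] by (simp add: 2 cubic_def power2_eq_square power3_eq_cube)
    next
      case 3
      show False using all[of "vector [Complex (1/2) (1/2), Complex 0 1]"] by (simp add: 3 cubic_def power2_eq_square power3_eq_cube)
    qed
  qed
  define A where "A = (\<lambda>w :: complex^2. vector [1, w$1, w$2] :: complex^3)"
  have A: "A \<in> chart_lifts" by (simp add: A_def chart_lifts_def)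
  obtain \<sigma> where \<sigma>: "\<sigma> \<in> J" "\<sigma> \<in> {-1, 1}" using J by auto
  define p :: "complex^2" where "p = vector [\<i>, if \<sigma> = 1 then -1 else 0]"
  define g where "g w = cubic (real_line (A w))" for w
  define h where "h w = \<sigma> * separator (real_line (A w))" for w
  define U where "U = {w. 0 < h w}"
  have ph: "real_polynomial_function h" unfolding h_def by (intro polyfun_intros polyfun_separator_lift[OF A])
  have U: "open U" unfolding U_def by (intro open_Collect_less continuous_on_const continuous_on_polyfun[OF ph])
  have pU: "p \<in> U" using \<sigma>(2) by (auto simp: U_def h_def p_def A_def separator_def)
  have ga: "real_analytic_on g S" for S
    unfolding g_def by (rule real_analytic_on_polyfun[OF polyfun_cubic_lift[OF A]])
  obtain u where u: "(g has_derivative (\<lambda>h. h \<bullet> u)) (at p)"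
    using real_analytic_has_gradient[of g p] ga[of UNIV] by (auto simp: real_analytic_on_def)
  define d :: "complex^2" where "d = vector [0, 1]"
  have line: "((\<lambda>s. g (p + s *\<^sub>R d)) has_real_derivative d \<bullet> u) (at 0)"
    by (rule directional_derivative[OF u])
  have "u \<noteq> 0"
  proof
    assume "u = 0"
    then have 0: "((\<lambda>s. g (p + s *\<^sub>R d)) has_real_derivative 0) (at 0)" using line by simp
    show False
    proof (cases "\<sigma> = 1")
      case True
      have "(\<lambda>s. g (p + s *\<^sub>R d)) = (\<lambda>s. (1 - s) - (1 - s)^3)"
        by (simp add: fun_eq_iff g_def p_def d_def A_def cubic_def True)
      moreover have "((\<lambda>s::real. (1 - s) - (1 - s)^3) has_real_derivative 2) (at 0)"
        by (auto intro!: derivative_eq_intros)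
      ultimately show False using DERIV_unique[OF 0] by fastforce
    next
      case False
      have "(\<lambda>s. g (p + s *\<^sub>R d)) = (\<lambda>s. s^3 - s)"
        using False by (simp add: fun_eq_iff g_def p_def d_def A_def cubic_def)
      moreover have "((\<lambda>s::real. s^3 - s) has_real_derivative -1) (at 0)"
        by (auto intro!: derivative_eq_intros)
      ultimately show False using DERIV_unique[OF 0] by fastforce
    qed
  qed
  have XU: "x \<in> (\<lambda>w. hpoint (A w)) -` web J \<longleftrightarrow> g x = 0" if "x \<in> U" for x
  proof -
    have s: "0 < \<sigma> * separator (real_line (A x))" using that by (simp add: U_def h_def)
    then have "sgn (separator (real_line (A x))) = \<sigma>" using sgn_pm_iff[OF \<sigma>(2)] by blast
    moreover have "real_line (A x) \<noteq> 0"
    proof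
      assume "real_line (A x) = 0"
      then have "separator (real_line (A x)) = 0" by (simp only: separator_def) simp
      then show False using s by simp
    qed
    ultimately show ?thesis unfolding vimage_chart_web[OF A] using \<sigma>(1) by (simp add: web_cone_def g_def)
  qed
  have "p \<in> regular_points ((\<lambda>w. hpoint (A w)) -` web J)"
    unfolding regular_iff
  proof (intro conjI exI)
    have "g p = 0" using \<sigma>(2) by (auto simp: g_def p_def A_def cubic_def)
    then show "p \<in> (\<lambda>w. hpoint (A w)) -` web J" using XU[OF pU] by blast
    show "(\<lambda>w. hpoint (A w)) -` web J \<inter> U = {x \<in> U. g x = 0}" using XU by blast
  qed (use U pU ga u \<open>u \<noteq> 0\<close> in auto)
  then have "\<exists>\<phi>\<in>affine_charts. \<exists>w. analytic_submanifold_near 3 (\<phi> -` web J) w"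
    using A unfolding affine_charts_eq_lifts regular_points_def by blast
  then show ?thesis
    unfolding has_real_codimension_def has_real_dimension_def using no4 by (intro exI[of _ 3]) auto
qed

section \<open>Holomorphic coordinates along the leaves\<close>

text \<open>
  The inverse function theorem for a map with complex-linear derivative: the inverse of a complex-linear
  bijection is complex-linear.
\<close>

lemma holomorphic_inverse_coordinates:
  fixes \<psi> dS dO :: "complex^2 \<Rightarrow> complex^2"
  assumes U: "open U" "x0 \<in> U"
    and der: "\<And>v. v \<in> U \<Longrightarrow> (\<psi> has_derivative (\<lambda>h. (h$1) *s dS v + (h$2) *s dO v)) (at v)"
    and cont: "continuous_on U dS" "continuous_on U dO"
    and det: "dS x0 $ 1 * dO x0 $ 2 - dS x0 $ 2 * dO x0 $ 1 \<noteq> 0"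
  obtains V where "open V" "x0 \<in> V" "V \<subseteq> U" "inj_on \<psi> V"
    "\<And>W. W \<subseteq> V \<Longrightarrow> open W \<Longrightarrow> holomorphic_coordinates (inv_into V \<psi>) (\<psi> ` W)"
proof -
  define L :: "complex^2 \<Rightarrow> complex^2 \<Rightarrow> complex^2" where "L v h = (h$1) *s dS v + (h$2) *s dO v" for v h
  have linL: "bounded_linear (L v)" for v
    unfolding linear_conv_bounded_linear[symmetric]
    by (rule linearI) (auto simp: L_def vec2_eq_iff algebra_simps scaleR_conv_of_real[of _ "_ :: complex"])
  have apL: "blinfun_apply (Blinfun (L v)) = L v" for v
    by (rule bounded_linear_Blinfun_apply[OF linL])
  have contL: "continuous_on U (\<lambda>v. Blinfun (L v))"
  proof (rule continuous_on_blinfun_componentwise)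
    fix b :: "complex^2"
    show "continuous_on U (\<lambda>v. blinfun_apply (Blinfun (L v)) b)"
      unfolding apL L_def vector_scalar_mult_def by (intro continuous_intros cont)
  qed
  define D where "D = dS x0 $ 1 * dO x0 $ 2 - dS x0 $ 2 * dO x0 $ 1"
  define K :: "complex^2 \<Rightarrow> complex^2" where
    "K y = vector [(y$1 * dO x0 $ 2 - y$2 * dO x0 $ 1) / D, (dS x0 $ 1 * y$2 - dS x0 $ 2 * y$1) / D]" for y
  have linK: "bounded_linear K"
    unfolding linear_conv_bounded_linear[symmetric]
    by (rule linearI) (auto simp: K_def vec2_eq_iff diff_divide_distrib add_divide_distrib algebra_simps scaleR_conv_of_real[of _ "_ :: complex"])
  have KL: "K (L x0 h) = h" for h
  proof -
    have D0: "D \<noteq> 0" using det by (simp add: D_def)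
    have "(L x0 h $ 1 * dO x0 $ 2 - L x0 h $ 2 * dO x0 $ 1) = h$1 * D"
      "(dS x0 $ 1 * L x0 h $ 2 - dS x0 $ 2 * L x0 h $ 1) = h$2 * D"
      by (simp_all add: L_def D_def algebra_simps)
    then show ?thesis using D0 by (simp add: K_def vec2_eq_iff)
  qed
  have inv0: "Blinfun K o\<^sub>L Blinfun (L x0) = id_blinfun"
    by (rule blinfun_eqI) (simp add: apL bounded_linear_Blinfun_apply[OF linK] KL)
  have der': "(\<psi> has_derivative blinfun_apply (Blinfun (L v))) (at v)" if "v \<in> U" for v
    unfolding apL using der[OF that] by (simp add: L_def[abs_def])
  obtain V Y g g' where V: "open V" "V \<subseteq> U" "x0 \<in> V" "open Y" "homeomorphism V Y \<psi> g"
    "\<And>y. y \<in> Y \<Longrightarrow> (g has_derivative g' y) (at y)"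
    "\<And>y. y \<in> Y \<Longrightarrow> g' y = inv (L (g y))" "\<And>y. y \<in> Y \<Longrightarrow> bij (L (g y))"
  proof (rule inverse_function_theorem[OF U(1) der' contL U(2) inv0])
    fix U' V g g'
    assume "open U'" "U' \<subseteq> U" "x0 \<in> U'" "open V" "homeomorphism U' V \<psi> g"
      "\<And>y. y \<in> V \<Longrightarrow> (g has_derivative g' y) (at y)"
      "\<And>y. y \<in> V \<Longrightarrow> g' y = inv (blinfun_apply (Blinfun (L (g y))))"
      "\<And>y. y \<in> V \<Longrightarrow> bij (blinfun_apply (Blinfun (L (g y))))"
    then show thesis by (intro that[of U' V g g']) (simp_all add: apL)
  qed
  have Lc: "L v (c *s h) = c *s L v h" for v c h
    by (simp add: L_def vec2_eq_iff algebra_simps)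
  have gpsi: "g (\<psi> v) = v" if "v \<in> V" for v using V(5) that by (simp add: homeomorphism_def)
  have psig: "\<psi> (g y) = y" "g y \<in> V" if "y \<in> Y" for y using V(5) that by (auto simp: homeomorphism_def)
  have im: "\<psi> ` V = Y" using V(5) by (simp add: homeomorphism_def)
  have inj: "inj_on \<psi> V" using gpsi by (metis inj_onI)
  define \<zeta> where "\<zeta> = inv_into V \<psi>"
  have \<zeta>psi: "\<zeta> (\<psi> v) = v" if "v \<in> V" for v unfolding \<zeta>_def by (rule inv_into_f_f[OF inj that])
  have \<zeta>g: "\<zeta> y = g y" if "y \<in> Y" for y using \<zeta>psi psig that by metis
  show ?thesis
  proof (rule that[OF V(1,3,2) inj])
    fix W assume W: "W \<subseteq> V" "open W"
    have oW: "open (\<psi> ` W)"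
    proof -
      have "openin (top_of_set V) W" using W by (simp add: open_subset)
      then have "openin (top_of_set Y) (\<psi> ` W)" by (rule homeomorphism_imp_open_map[OF V(5)])
      then show ?thesis using V(4) openin_open_eq by blast
    qed
    have WY: "\<psi> ` W \<subseteq> Y" using W im by blast
    have \<zeta>W: "\<zeta> ` \<psi> ` W = W" using \<zeta>psi W by (force simp: image_image)
    have inj\<zeta>: "inj_on \<zeta> (\<psi> ` W)" unfolding \<zeta>_def by (rule inj_on_inv_into) (use W in blast)
    have h1: "holomorphic_map_on \<zeta> (\<psi> ` W)"
      unfolding holomorphic_map_on_def
    proof
      fix y assume y: "y \<in> \<psi> ` W"
      then have yY: "y \<in> Y" using WY by blast
      have "(\<zeta> has_derivative g' y) (at y)"
        by (rule has_derivative_transform_within_open[OF V(6)[OF yY] V(4) yY]) (simp add: \<zeta>g)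
      moreover have "g' y (c *s v) = c *s g' y v" for c v
      proof -
        have "L (g y) (c *s inv (L (g y)) v) = c *s v"
          using V(8)[OF yY] by (simp add: Lc bij_is_surj surj_f_inv_f)
        then show ?thesis using V(8)[OF yY] unfolding V(7)[OF yY] by (metis bij_inv_eq_iff)
      qed
      ultimately show "\<exists>D. (\<zeta> has_derivative D) (at y) \<and> (\<forall>c v. D (c *s v) = c *s D v)" by blast
    qed
    have h2: "holomorphic_map_on (inv_into (\<psi> ` W) \<zeta>) W"
      unfolding holomorphic_map_on_def
    proof
      fix x assume x: "x \<in> W"
      have eq: "\<psi> x = inv_into (\<psi> ` W) \<zeta> x" if "x \<in> W" for x
        using inv_into_f_f[OF inj\<zeta>, of "\<psi> x"] \<zeta>psi that W by auto
      have "(\<psi> has_derivative L x) (at x)" using der'[of x] x W V(2) unfolding apL by blast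
      then have "(inv_into (\<psi> ` W) \<zeta> has_derivative L x) (at x)"
        by (rule has_derivative_transform_within_open[OF _ W(2) x]) (simp add: eq)
      then show "\<exists>D. (inv_into (\<psi> ` W) \<zeta> has_derivative D) (at x) \<and> (\<forall>c v. D (c *s v) = c *s D v)"
        using Lc by blast
    qed
    show "holomorphic_coordinates (inv_into V \<psi>) (\<psi> ` W)"
      unfolding holomorphic_coordinates_def \<zeta>_def[symmetric] \<zeta>W using oW W inj\<zeta> h1 h2 by blast
  qed
qed

section \<open>Complexified leaves\<close>

text \<open>
  The parameters at which the principal root in the definition of the complexified leaf is holomorphic.
\<close>

definition leaf_domain :: "complex set" where
  "leaf_domain = {s. 1 + (cos s)\<^sup>2 \<notin> \<real>\<^sub>\<le>\<^sub>0}"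

definition complex_leaf :: "real \<Rightarrow> complex \<Rightarrow> complex^3" where
  "complex_leaf \<sigma> s = (if \<sigma> = 1 then vector [cos s, sin s * csqrt (1 + (cos s)\<^sup>2), (cos s)^3]
     else vector [- (cos s)\<^sup>2, sin s * cos s * csqrt (1 + (cos s)\<^sup>2), 1])"

lemma open_leaf_domain: "open leaf_domain"
proof -
  have "leaf_domain = (\<lambda>s. 1 + (cos s)\<^sup>2) -` (- \<real>\<^sub>\<le>\<^sub>0)" by (auto simp: leaf_domain_def)
  moreover have "open \<dots>" by (intro open_vimage continuous_intros) (simp add: open_Compl)
  ultimately show ?thesis by simp
qed

lemma real_in_leaf_domain: "complex_of_real t \<in> leaf_domain"
proof -
  have "0 < 1 + (cos t)\<^sup>2" by (simp add: add_pos_nonneg)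
  moreover have "1 + (cos (complex_of_real t))\<^sup>2 = of_real (1 + (cos t)\<^sup>2)" by (simp add: cos_of_real)
  ultimately show ?thesis unfolding leaf_domain_def mem_Collect_eq
    by (metis complex_nonpos_Reals_iff Re_complex_of_real not_le)
qed

lemma complex_leaf_holomorphic: "(\<lambda>s. complex_leaf \<sigma> s $ l) holomorphic_on leaf_domain"
proof -
  have r: "(\<lambda>s. csqrt (1 + (cos s)\<^sup>2)) holomorphic_on leaf_domain"
    by (rule holomorphic_on_csqrt') (auto intro!: holomorphic_intros simp: leaf_domain_def)
  have "l = 1 \<or> l = 2 \<or> l = 3" by (rule exhaust_3)
  then show ?thesis
    unfolding complex_leaf_def by (cases "\<sigma> = 1"; elim disjE) (auto intro!: holomorphic_intros r)
qed

lemma complex_leaf_of_real: "complex_leaf \<sigma> (of_real t) $ l = of_real (leaf \<sigma> t $ l)"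
proof -
  have "csqrt (1 + (cos (complex_of_real t))\<^sup>2) = of_real (sqrt (1 + (cos t)\<^sup>2))"
  proof -
    have "1 + (cos (complex_of_real t))\<^sup>2 = of_real (1 + (cos t)\<^sup>2)" by (simp add: cos_of_real)
    then show ?thesis by (simp only:) (subst csqrt_of_real_nonneg; simp)
  qed
  moreover have "l = 1 \<or> l = 2 \<or> l = 3" by (rule exhaust_3)
  ultimately show ?thesis
    unfolding complex_leaf_def leaf_def by (cases "\<sigma> = 1"; elim disjE) (auto simp: cos_of_real sin_of_real)
qed

lemma deriv_complex_leaf: "deriv (\<lambda>s. complex_leaf \<sigma> s $ l) (of_real t) = of_real (leaf_deriv \<sigma> t $ l)"
proof -
  have "((\<lambda>s. complex_leaf \<sigma> s $ l) has_field_derivative deriv (\<lambda>s. complex_leaf \<sigma> s $ l) (of_real t)) (at (of_real t))"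
    by (rule holomorphic_derivI[OF complex_leaf_holomorphic open_leaf_domain real_in_leaf_domain])
  then have "((\<lambda>t. complex_leaf \<sigma> (of_real t) $ l) has_vector_derivative deriv (\<lambda>s. complex_leaf \<sigma> s $ l) (of_real t)) (at t)"
    by (rule has_vector_derivative_real_field)
  then have "((\<lambda>t. complex_of_real (leaf \<sigma> t $ l)) has_vector_derivative deriv (\<lambda>s. complex_leaf \<sigma> s $ l) (of_real t)) (at t)"
    by (simp add: complex_leaf_of_real)
  moreover have "((\<lambda>t. complex_of_real (leaf \<sigma> t $ l)) has_vector_derivative of_real (leaf_deriv \<sigma> t $ l)) (at t)"
    using leaf_has_derivative[of \<sigma> l t] by (intro has_vector_derivative_of_real) (simp add: has_real_derivative_iff_has_vector_derivative)
  ultimately show ?thesis by (rule vector_derivative_unique_at)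
qed

lemma has_derivative_first_coordinate:
  assumes "G holomorphic_on D" "open D" "v $ 1 \<in> D"
  shows "((\<lambda>v :: complex^2. G (v $ 1)) has_derivative (\<lambda>h. deriv G (v $ 1) * h $ 1)) (at v)"
proof -
  have "(G has_derivative (*) (deriv G (v $ 1))) (at (v $ 1))"
    using holomorphic_derivI[OF assms] by (simp add: has_field_derivative_def)
  moreover have "((\<lambda>v :: complex^2. v $ 1) has_derivative (\<lambda>h. h $ 1)) (at v)"
    by (rule bounded_linear.has_derivative[OF bounded_linear_vec_nth has_derivative_ident])
  ultimately show ?thesis by (rule has_derivative_compose[rotated])
qed

text \<open>
  Let \<open>e\<close> be the conormal vector of the leaf at \<open>t0\<close> and \<open>f\<close> its direction.  The map \<open>\<psi>\<close> sends a complex parameter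
  \<open>s\<close> and a position \<open>\<omega>\<close> to the point \<open>p + \<omega> f - \<mu> e\<close> of the complexified leaf at \<open>s\<close>; here \<open>\<mu>\<close> is
  determined by a linear equation.  Its Jacobian at \<open>(t0, 0)\<close> is a multiple of the speed of
  the leaf at \<open>p\<close>, so its inverse provides coordinates, whose first component is the parameter \<open>s\<close>.
\<close>

lemma leaf_coordinates:
  assumes A: "A \<in> chart_lifts" and \<sigma>: "\<sigma> \<in> {-1, 1}"
    and p: "line_form (leaf \<sigma> t0) (A p) = 0" "line_form (leaf_deriv \<sigma> t0) (A p) \<noteq> 0"
    and X: "\<And>t w. line_form (leaf \<sigma> t) (A w) = 0 \<Longrightarrow> w \<in> X"
    and near: "\<And>\<delta>. \<delta> > 0 \<Longrightarrow> \<exists>V. open V \<and> p \<in> V \<and>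
        (\<forall>w\<in>V \<inter> X. \<exists>t. \<bar>t - t0\<bar> < \<delta> \<and> line_form (leaf \<sigma> t) (A w) = 0)"
    and R: "open R" "p \<in> R"
  shows "\<exists>U \<zeta>. p \<in> U \<and> U \<subseteq> R \<and> holomorphic_coordinates \<zeta> U \<and> X \<inter> U = {x \<in> U. Im (\<zeta> x $ 1) = 0}"
proof -
  obtain k i j where idx: "\<And>l. l = k \<or> l = i \<or> l = (j :: 3)"
    "\<And>a w. line_form a (A w) = of_real (a$k) + of_real (a$i) * w$1 + of_real (a$j) * w$2"
    using lift_index[OF A] by blast
  define e1 e2 where "e1 = complex_of_real (leaf \<sigma> t0 $ i)" and "e2 = complex_of_real (leaf \<sigma> t0 $ j)"
  \<comment> \<open>The coordinates of the conormal vector are real, so this is the square of its length.\<close>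
  define N where "N = e1 * e1 + e2 * e2"
  have N: "N \<noteq> 0"
  proof
    assume "N = 0"
    then have "complex_of_real ((leaf \<sigma> t0 $ i)\<^sup>2 + (leaf \<sigma> t0 $ j)\<^sup>2) = 0"
      by (simp add: N_def e1_def e2_def power2_eq_square)
    then have "(leaf \<sigma> t0 $ i)\<^sup>2 + (leaf \<sigma> t0 $ j)\<^sup>2 = 0" by (simp only: of_real_eq_0_iff)
    then have ij: "leaf \<sigma> t0 $ i = 0" "leaf \<sigma> t0 $ j = 0" by (simp_all add: sum_power2_eq_zero_iff)
    then have "leaf \<sigma> t0 $ k = 0" using p(1) by (simp add: idx(2))
    then have "leaf \<sigma> t0 = 0 *\<^sub>R leaf \<sigma> t0" using ij by (intro eq_scaleR_index[OF idx(1)]) auto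
    then show False using leaf_nonzero[OF \<sigma>, of t0] by simp
  qed
  define c where "c l s = complex_leaf \<sigma> s $ l" for l s
  have ch: "c l holomorphic_on leaf_domain" for l unfolding c_def by (rule complex_leaf_holomorphic)
  have cr: "c l (of_real t) = of_real (leaf \<sigma> t $ l)" for l t unfolding c_def by (rule complex_leaf_of_real)
  define g h n where "g s = c k s + c i s * p$1 + c j s * p$2" and "h s = c j s * e1 - c i s * e2"
    and "n s = c i s * e1 + c j s * e2" for s
  have hol: "g holomorphic_on leaf_domain" "h holomorphic_on leaf_domain" "n holomorphic_on leaf_domain"
    unfolding g_def h_def n_def by (intro holomorphic_intros ch)+
  define U where "U = {v :: complex^2. v$1 \<in> leaf_domain \<and> n (v$1) \<noteq> 0}"
  have "U = (\<lambda>v. v$1) -` (leaf_domain \<inter> n -` (- {0}))" by (auto simp: U_def)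
  moreover have "open (leaf_domain \<inter> n -` (- {0}))"
    by (rule continuous_open_preimage[OF holomorphic_on_imp_continuous_on[OF hol(3)] open_leaf_domain]) auto
  then have "open ((\<lambda>v :: complex^2. v$1) -` (leaf_domain \<inter> n -` (- {0})))"
    by (rule open_vimage) (intro continuous_intros)
  ultimately have oU: "open U" by (simp only:)
  define x0 :: "complex^2" where "x0 = vector [of_real t0, 0]"
  have n0: "n (of_real t0) = N" by (simp add: n_def cr N_def e1_def e2_def)
  have g0: "g (of_real t0) = 0" using p(1) by (simp add: g_def cr idx(2))
  have x0U: "x0 \<in> U" using N n0 by (simp add: U_def x0_def real_in_leaf_domain)
  define \<mu> where "\<mu> v = (g (v$1) + v$2 * h (v$1)) / n (v$1)" for v :: "complex^2"
  define \<mu>s where "\<mu>s v = ((deriv g (v$1) + v$2 * deriv h (v$1)) * n (v$1)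
      - (g (v$1) + v$2 * h (v$1)) * deriv n (v$1)) / (n (v$1) * n (v$1))" for v :: "complex^2"
  define \<mu>o where "\<mu>o v = h (v$1) / n (v$1)" for v :: "complex^2"
  define e f :: "complex^2" where "e = vector [e1, e2]" and "f = vector [- e2, e1]"
  define \<psi> where "\<psi> v = p + v$2 *s f - \<mu> v *s e" for v
  define dS dO where "dS v = - (\<mu>s v *s e)" and "dO v = f - \<mu>o v *s e" for v
  have \<mu>der: "(\<mu> has_derivative (\<lambda>d. d$1 * \<mu>s v + d$2 * \<mu>o v)) (at v)" if v: "v \<in> U" for v
  proof -
    have D: "v$1 \<in> leaf_domain" "n (v$1) \<noteq> 0" using v by (auto simp: U_def)
    note fc = has_derivative_first_coordinate[OF _ open_leaf_domain D(1)]
    have v2: "((\<lambda>v :: complex^2. v $ 2) has_derivative (\<lambda>h. h $ 2)) (at v)"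
      by (rule bounded_linear.has_derivative[OF bounded_linear_vec_nth has_derivative_ident])
    have num: "((\<lambda>v :: complex^2. g (v$1) + v$2 * h (v$1)) has_derivative
        (\<lambda>d. deriv g (v$1) * d$1 + (v$2 * (deriv h (v$1) * d$1) + d$2 * h (v$1)))) (at v)"
      by (intro has_derivative_add has_derivative_mult fc hol v2)
    have "((\<lambda>v. (g (v$1) + v$2 * h (v$1)) / n (v$1)) has_derivative
        (\<lambda>d. ((deriv g (v$1) * d$1 + (v$2 * (deriv h (v$1) * d$1) + d$2 * h (v$1))) * n (v$1)
          - (g (v$1) + v$2 * h (v$1)) * (deriv n (v$1) * d$1)) / (n (v$1) * n (v$1)))) (at v)"
      by (rule has_derivative_divide'[OF num fc[OF hol(3)] D(2)])
    moreover have "((G * d1 + (w * (H * d1) + d2 * hh)) * nn - gg * (M * d1)) / (nn * nn)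
        = d1 * (((G + w * H) * nn - gg * M) / (nn * nn)) + d2 * (hh / nn)"
      if "nn \<noteq> 0" for G H M d1 d2 w hh nn gg :: complex
      using that by (simp add: field_simps)
    ultimately show ?thesis using D(2) unfolding \<mu>_def[abs_def] \<mu>s_def \<mu>o_def by simp
  qed
  have der: "(\<psi> has_derivative (\<lambda>d. (d$1) *s dS v + (d$2) *s dO v)) (at v)" if v: "v \<in> U" for v
  proof -
    have bl: "bounded_linear (\<lambda>c. c *s (u :: complex^2))" for u
      unfolding linear_conv_bounded_linear[symmetric]
      by (rule linearI) (auto simp: vec2_eq_iff algebra_simps)
    have v2: "((\<lambda>v :: complex^2. v $ 2) has_derivative (\<lambda>h. h $ 2)) (at v)"
      by (rule bounded_linear.has_derivative[OF bounded_linear_vec_nth has_derivative_ident])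
    have "(\<psi> has_derivative (\<lambda>d. 0 + d$2 *s f - (d$1 * \<mu>s v + d$2 * \<mu>o v) *s e)) (at v)"
      unfolding \<psi>_def
      by (intro has_derivative_add has_derivative_diff has_derivative_const
          bounded_linear.has_derivative[OF bl] v2 \<mu>der[OF v])
    moreover have "0 + d$2 *s f - (d$1 * \<mu>s v + d$2 * \<mu>o v) *s e = (d$1) *s dS v + (d$2) *s dO v" for d :: "complex^2"
      by (simp add: dS_def dO_def vec2_eq_iff algebra_simps)
    ultimately show ?thesis by (simp only:)
  qed
  have c1: "continuous_on U (\<lambda>v. G (v$1))" if "G holomorphic_on leaf_domain" for G :: "complex \<Rightarrow> complex"
    by (rule continuous_on_compose2[OF holomorphic_on_imp_continuous_on[OF that]])
      (auto intro!: continuous_intros simp: U_def)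
  have holD: "deriv g holomorphic_on leaf_domain" "deriv h holomorphic_on leaf_domain" "deriv n holomorphic_on leaf_domain"
    by (intro holomorphic_deriv hol open_leaf_domain)+
  have cv2: "continuous_on U (\<lambda>v. v$2)" by (intro continuous_intros)
  have c\<mu>: "continuous_on U \<mu>s" "continuous_on U \<mu>o"
    unfolding \<mu>s_def \<mu>o_def
    by (intro continuous_on_divide continuous_on_diff continuous_on_add continuous_on_mult c1 hol holD cv2 ballI;
        simp add: U_def)+
  have cS: "continuous_on U dS" "continuous_on U dO"
    unfolding dS_def dO_def vector_scalar_mult_def by (intro continuous_intros c\<mu>)+
  have det: "dS x0 $ 1 * dO x0 $ 2 - dS x0 $ 2 * dO x0 $ 1 \<noteq> 0"
  proof -
    have "deriv g (of_real t0) = of_real (leaf_deriv \<sigma> t0 $ k) + of_real (leaf_deriv \<sigma> t0 $ i) * p$1 + of_real (leaf_deriv \<sigma> t0 $ j) * p$2"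
    proof -
      have "(c l has_field_derivative of_real (leaf_deriv \<sigma> t0 $ l)) (at (of_real t0))" for l
        using holomorphic_derivI[OF ch open_leaf_domain real_in_leaf_domain, of l t0] deriv_complex_leaf[of \<sigma> l t0]
        by (simp add: c_def[abs_def])
      then have "(g has_field_derivative of_real (leaf_deriv \<sigma> t0 $ k) + of_real (leaf_deriv \<sigma> t0 $ i) * p$1 + of_real (leaf_deriv \<sigma> t0 $ j) * p$2) (at (of_real t0))"
        unfolding g_def[abs_def] by (intro DERIV_add DERIV_cmult_right)
      then show ?thesis by (rule DERIV_imp_deriv)
    qed
    then have "deriv g (of_real t0) \<noteq> 0" using p(2) by (simp add: idx(2))
    then have "\<mu>s x0 \<noteq> 0" using N by (simp add: \<mu>s_def x0_def g0 n0)
    moreover have "dS x0 $ 1 * dO x0 $ 2 - dS x0 $ 2 * dO x0 $ 1 = - \<mu>s x0 * N"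
      by (simp add: dS_def dO_def e_def f_def N_def algebra_simps)
    ultimately show ?thesis using N by simp
  qed
  obtain V where V: "open V" "x0 \<in> V" "V \<subseteq> U" "inj_on \<psi> V"
    "\<And>W. W \<subseteq> V \<Longrightarrow> open W \<Longrightarrow> holomorphic_coordinates (inv_into V \<psi>) (\<psi> ` W)"
    using holomorphic_inverse_coordinates[OF oU x0U der cS det] by blast
  have \<psi>x0: "\<psi> x0 = p" by (simp add: \<psi>_def \<mu>_def x0_def g0 vec2_eq_iff)
  define \<omega> where "\<omega> w = (e1 * (w$2 - p$2) - e2 * (w$1 - p$1)) / N" for w :: "complex^2"
  have on_line: "line_form (leaf \<sigma> t) (A (\<psi> v)) = 0" if v: "v \<in> U" "v$1 = of_real t" for v t
  proof -
    have n1: "n (of_real t) \<noteq> 0" using v by (simp add: U_def)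
    have "line_form (leaf \<sigma> t) (A (\<psi> v)) = g (of_real t) + v$2 * h (of_real t) - \<mu> v * n (of_real t)"
      unfolding idx(2) g_def h_def n_def cr \<psi>_def e_def f_def by (simp add: algebra_simps)
    also have "\<dots> = 0" using n1 v(2) by (simp add: \<mu>_def)
    finally show ?thesis .
  qed
  have line_param: "\<psi> (vector [of_real t, \<omega> w]) = w"
    if "n (of_real t) \<noteq> 0" "line_form (leaf \<sigma> t) (A w) = 0" for t w
  proof -
    \<comment> \<open>The coordinates of \<open>w - p\<close> in the orthogonal basis \<open>e\<close>, \<open>f\<close> are \<open>\<alpha>\<close> and \<open>\<omega> w\<close>.\<close>
    define \<alpha> where "\<alpha> = (e1 * (w$1 - p$1) + e2 * (w$2 - p$2)) / N"
    have w12: "w$1 - p$1 = \<alpha> * e1 - \<omega> w * e2" "w$2 - p$2 = \<alpha> * e2 + \<omega> w * e1"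
    proof -
      have "N * (\<alpha> * e1 - \<omega> w * e2) = N * (w$1 - p$1)" "N * (\<alpha> * e2 + \<omega> w * e1) = N * (w$2 - p$2)"
      proof -
        have "N * \<alpha> = e1 * (w$1 - p$1) + e2 * (w$2 - p$2)" "N * \<omega> w = e1 * (w$2 - p$2) - e2 * (w$1 - p$1)"
          using N by (simp_all add: \<alpha>_def \<omega>_def)
        then show "N * (\<alpha> * e1 - \<omega> w * e2) = N * (w$1 - p$1)" "N * (\<alpha> * e2 + \<omega> w * e1) = N * (w$2 - p$2)"
          unfolding N_def by algebra+
      qed
      then show "w$1 - p$1 = \<alpha> * e1 - \<omega> w * e2" "w$2 - p$2 = \<alpha> * e2 + \<omega> w * e1" using N by auto
    qed
    have "0 = g (of_real t) + c i (of_real t) * (w$1 - p$1) + c j (of_real t) * (w$2 - p$2)"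
      using that(2) by (simp add: idx(2) g_def cr algebra_simps)
    also have "\<dots> = g (of_real t) + \<omega> w * h (of_real t) + \<alpha> * n (of_real t)"
      unfolding w12 h_def n_def by (simp add: algebra_simps)
    finally have "\<alpha> * n (of_real t) = - (g (of_real t) + \<omega> w * h (of_real t))"
      by (simp add: eq_neg_iff_add_eq_0 algebra_simps)
    then have "\<alpha> = - \<mu> (vector [of_real t, \<omega> w])"
      using that(1) by (simp add: \<mu>_def nonzero_eq_divide_eq minus_divide_left)
    then have "w$1 = p$1 - \<omega> w * e2 - \<mu> (vector [of_real t, \<omega> w]) * e1" "w$2 = p$2 + \<omega> w * e1 - \<mu> (vector [of_real t, \<omega> w]) * e2"
      using w12 by (simp_all add: algebra_simps)
    then show ?thesis by (simp add: \<psi>_def e_def f_def vec2_eq_iff)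
  qed
  obtain \<delta> where \<delta>: "\<delta> > 0" "\<And>t z. \<bar>t - t0\<bar> < \<delta> \<Longrightarrow> cmod z < \<delta> \<Longrightarrow> vector [complex_of_real t, z] \<in> V"
  proof -
    obtain r where r: "r > 0" "ball x0 r \<subseteq> V" using V(1,2) by (meson openE)
    have "vector [complex_of_real t, z] \<in> V" if "\<bar>t - t0\<bar> < r / 2" "cmod z < r / 2" for t z
    proof -
      have "norm (vector [complex_of_real t, z] - x0) \<le> (\<Sum>l\<in>UNIV. norm ((vector [complex_of_real t, z] - x0) $ l))"
        by (simp add: norm_vec_def L2_set_le_sum)
      also have "\<dots> = \<bar>t - t0\<bar> + cmod z" by (simp add: sum_2 x0_def flip: of_real_diff)
      also have "\<dots> < r" using that by simp
      finally have "vector [complex_of_real t, z] \<in> ball x0 r" by (simp add: dist_norm norm_minus_commute)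
      then show ?thesis using r(2) by blast
    qed
    then show ?thesis using that[of "r / 2"] r(1) by simp
  qed
  obtain B where B: "open B" "p \<in> B" "\<And>w. w \<in> B \<Longrightarrow> w \<in> X \<Longrightarrow> \<exists>t. \<bar>t - t0\<bar> < \<delta> \<and> line_form (leaf \<sigma> t) (A w) = 0"
    using near[OF \<delta>(1)] by blast
  define B' where "B' = B \<inter> R \<inter> {w. cmod (\<omega> w) < \<delta>}"
  have B': "open B'" "p \<in> B'"
  proof -
    have "continuous_on UNIV \<omega>" unfolding \<omega>_def using N by (intro continuous_intros) auto
    then have "open {w. cmod (\<omega> w) < \<delta>}" by (intro open_Collect_less continuous_intros)
    then show "open B'" unfolding B'_def using B(1) R(1) by blast
    show "p \<in> B'" using B(2) R(2) \<delta>(1) by (simp add: B'_def \<omega>_def)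
  qed
  define W where "W = V \<inter> \<psi> -` B'"
  have "continuous_on V \<psi>"
    by (intro continuous_at_imp_continuous_on ballI has_derivative_continuous[OF der] subsetD[OF V(3)])
  then have W: "open W" "x0 \<in> W" "W \<subseteq> V"
    unfolding W_def using continuous_open_preimage[OF _ V(1) B'(1)] V(2) B'(2) \<psi>x0 by auto
  show ?thesis
  proof (intro exI conjI)
    show "p \<in> \<psi> ` W" using W(2) \<psi>x0 by force
    show "\<psi> ` W \<subseteq> R" by (auto simp: W_def B'_def)
    show "holomorphic_coordinates (inv_into V \<psi>) (\<psi> ` W)" by (rule V(5)[OF W(3,1)])
    have "\<psi> v \<in> X \<longleftrightarrow> Im (inv_into V \<psi> (\<psi> v) $ 1) = 0" if v: "v \<in> W" for v
    proof -
      have vV: "v \<in> V" using v W(3) by blast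
      have inv: "inv_into V \<psi> (\<psi> v) = v" by (rule inv_into_f_f[OF V(4) vV])
      show ?thesis
        unfolding inv
      proof
        assume "\<psi> v \<in> X"
        moreover have "\<psi> v \<in> B'" using v by (simp add: W_def)
        ultimately obtain t where t: "\<bar>t - t0\<bar> < \<delta>" "line_form (leaf \<sigma> t) (A (\<psi> v)) = 0"
          using B(3) unfolding B'_def by blast
        have mem: "vector [complex_of_real t, \<omega> (\<psi> v)] \<in> V"
          using \<delta>(2)[OF t(1)] \<open>\<psi> v \<in> B'\<close> by (simp add: B'_def)
        then have "n (of_real t) \<noteq> 0" using V(3) by (force simp: U_def)
        then have "\<psi> (vector [of_real t, \<omega> (\<psi> v)]) = \<psi> v" using line_param t(2) by blast
        then have "vector [of_real t, \<omega> (\<psi> v)] = v" using V(4) mem vV by (metis inj_onD)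
        then have "v $ 1 = of_real t" by (metis vector_2(1))
        then show "Im (v $ 1) = 0" by simp
      next
        assume "Im (v $ 1) = 0"
        then have "v $ 1 = of_real (Re (v $ 1))" by (simp add: complex_eq_iff)
        then show "\<psi> v \<in> X" using on_line[of v "Re (v $ 1)"] X vV V(3) by blast
      qed
    qed
    then show "X \<inter> \<psi> ` W = {x \<in> \<psi> ` W. Im (inv_into V \<psi> x $ 1) = 0}" by auto
  qed
qed

text \<open>
  At real points the linear form is real, and it changes its sign near \<open>t0\<close> because its derivative does not
  vanish; the sign change persists at nearby real points.
\<close>

lemma nearby_leaf_of_real_point:
  assumes A: "A \<in> chart_lifts" and p: "Im_vec p = 0" "line_form (leaf \<sigma> t0) (A p) = 0" "line_form (leaf_deriv \<sigma> t0) (A p) \<noteq> 0"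
    and \<delta>: "\<delta> > 0"
  obtains V where "open V" "p \<in> V"
    "\<And>w. w \<in> V \<Longrightarrow> Im_vec w = 0 \<Longrightarrow> \<exists>t. \<bar>t - t0\<bar> < \<delta> \<and> line_form (leaf \<sigma> t) (A w) = 0"
proof -
  obtain k i j where idx: "\<And>l. l = k \<or> l = i \<or> l = (j :: 3)"
    "\<And>a w. line_form a (A w) = of_real (a$k) + of_real (a$i) * w$1 + of_real (a$j) * w$2"
    using lift_index[OF A] by blast
  define F where "F a w = a$k + a$i * Re (w$1) + a$j * Re (w$2)" for a :: "real^3" and w :: "complex^2"
  have F: "line_form a (A w) = of_real (F a w)" if "Im_vec w = 0" for a w
    using that by (simp add: idx(2) F_def complex_eq_iff Im_vec_0_iff)
  have d: "((\<lambda>t. F (leaf \<sigma> t) p) has_real_derivative F (leaf_deriv \<sigma> t0) p) (at t0)"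
    unfolding F_def by (auto intro!: derivative_eq_intros leaf_has_derivative)
  have z: "F (leaf \<sigma> t0) p = 0" using p(2) F[OF p(1)] by (simp add: of_real_eq_0_iff)
  have nz: "F (leaf_deriv \<sigma> t0) p \<noteq> 0" using p(3) F[OF p(1)] by auto
  have fc: "continuous_on S (\<lambda>t. F (leaf \<sigma> t) w)" for S w
    unfolding F_def
    by (intro continuous_on_add continuous_on_mult continuous_on_const
        continuous_at_imp_continuous_on ballI DERIV_isCont[OF leaf_has_derivative])
  obtain a b where ab: "a \<in> {t0 - \<delta> <..< t0 + \<delta>}" "b \<in> {t0 - \<delta> <..< t0 + \<delta>}" "F (leaf \<sigma> a) p < 0" "0 < F (leaf \<sigma> b) p"
  proof (cases "F (leaf_deriv \<sigma> t0) p > 0")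
    case True
    obtain d1 where d1: "d1 > 0" "\<And>h. 0 < h \<Longrightarrow> h < d1 \<Longrightarrow> F (leaf \<sigma> (t0 + h)) p > 0"
      using DERIV_pos_inc_right[OF d True] z by auto
    obtain d2 where d2: "d2 > 0" "\<And>h. 0 < h \<Longrightarrow> h < d2 \<Longrightarrow> F (leaf \<sigma> (t0 - h)) p < 0"
      using DERIV_pos_inc_left[OF d True] z by auto
    define h where "h = min (min d1 d2) \<delta> / 2"
    have "0 < h" "h < d1" "h < d2" "h < \<delta>" using d1 d2 \<delta> by (auto simp: h_def)
    then show ?thesis using that[of "t0 - h" "t0 + h"] d1 d2 by auto
  next
    case False
    then have neg: "F (leaf_deriv \<sigma> t0) p < 0" using nz by simp
    obtain d1 where d1: "d1 > 0" "\<And>h. 0 < h \<Longrightarrow> h < d1 \<Longrightarrow> F (leaf \<sigma> (t0 + h)) p < 0"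
      using DERIV_neg_dec_right[OF d neg] z by auto
    obtain d2 where d2: "d2 > 0" "\<And>h. 0 < h \<Longrightarrow> h < d2 \<Longrightarrow> F (leaf \<sigma> (t0 - h)) p > 0"
      using DERIV_neg_dec_left[OF d neg] z by auto
    define h where "h = min (min d1 d2) \<delta> / 2"
    have "0 < h" "h < d1" "h < d2" "h < \<delta>" using d1 d2 \<delta> by (auto simp: h_def)
    then show ?thesis using that[of "t0 + h" "t0 - h"] d1 d2 by auto
  qed
  define V where "V = {w. F (leaf \<sigma> a) w < 0} \<inter> {w. 0 < F (leaf \<sigma> b) w}"
  show ?thesis
  proof (rule that[of V])
    have "continuous_on UNIV (F v)" for v unfolding F_def by (intro continuous_intros)
    then show "open V" unfolding V_def by (intro open_Int open_Collect_less continuous_on_const)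
    show "p \<in> V" using ab by (simp add: V_def)
    fix w assume w: "w \<in> V" "Im_vec w = 0"
    have "\<exists>t\<in>{t0 - \<delta> <..< t0 + \<delta>}. F (leaf \<sigma> t) w = 0"
    proof (cases "a \<le> b")
      case True
      then obtain t where "a \<le> t" "t \<le> b" "F (leaf \<sigma> t) w = 0"
        using IVT'[of "\<lambda>t. F (leaf \<sigma> t) w" a 0 b] w(1) fc by (force simp: V_def)
      then show ?thesis using ab by (intro bexI[of _ t]) auto
    next
      case False
      then obtain t where "b \<le> t" "t \<le> a" "F (leaf \<sigma> t) w = 0"
        using IVT2'[of "\<lambda>t. F (leaf \<sigma> t) w" a 0 b] w(1) fc by (force simp: V_def)
      then show ?thesis using ab by (intro bexI[of _ t]) auto
    qed
    then obtain t where "t \<in> {t0 - \<delta> <..< t0 + \<delta>}" "F (leaf \<sigma> t) w = 0" by blast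
    then show "\<exists>t. \<bar>t - t0\<bar> < \<delta> \<and> line_form (leaf \<sigma> t) (A w) = 0"
      using F[OF w(2)] by (intro exI[of _ t]) (auto simp: abs_less_iff)
  qed
qed

text \<open>
  Points near \<open>p\<close> on other leaves are excluded by compactness, and real points near a real \<open>p\<close> lie on leaves near
  the leaf at \<open>t0\<close>; so near \<open>p\<close> the web consists of the points with real leaf parameter.
\<close>

lemma web_levi_flat:
  assumes J: "J \<subseteq> {-1, 1}"
  shows "levi_flat (web J)"
  unfolding levi_flat_def
proof (intro ballI)
  fix \<phi> p assume \<phi>: "\<phi> \<in> affine_charts" and reg: "p \<in> regular_points (\<phi> -` web J)"
  obtain A where A: "A \<in> chart_lifts" "\<phi> = (\<lambda>w. hpoint (A w))" using \<phi> by (auto simp: affine_charts_eq_lifts)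
  define X where "X = (\<lambda>w. hpoint (A w)) -` web J"
  have X: "\<phi> -` web J = X" by (simp add: X_def A(2))
  obtain \<sigma> t0 where s: "\<sigma> \<in> J" "line_form (leaf \<sigma> t0) (A p) = 0" "line_form (leaf_deriv \<sigma> t0) (A p) \<noteq> 0"
    "\<And>\<sigma>' t'. \<sigma>' \<in> J \<Longrightarrow> line_form (leaf \<sigma>' t') (A p) = 0 \<Longrightarrow> \<sigma>' = \<sigma> \<and> sin (t' - t0) = 0"
    using regular_leaf[OF A(1) J] reg unfolding A(2) by blast
  have \<sigma>: "\<sigma> \<in> {-1, 1}" using s(1) J by blast
  obtain e where e: "e > 0" "X \<inter> ball p e \<subseteq> regular_points X"
    using regular_near[of p X] reg unfolding X by blast
  have Xmem: "w \<in> X \<longleftrightarrow> Im_vec w = 0 \<or> (\<exists>\<sigma>\<in>J. \<exists>t. line_form (leaf \<sigma> t) (A w) = 0)" for w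
    unfolding X_def vimage_chart_web[OF A(1)] using web_cone_iff_leaf[OF J] real_line_lift_0_iff[OF A(1)]
    by (simp add: Im_vec_0_iff)
  have near: "\<exists>V. open V \<and> p \<in> V \<and> (\<forall>w\<in>V \<inter> X. \<exists>t. \<bar>t - t0\<bar> < \<delta> \<and> line_form (leaf \<sigma> t) (A w) = 0)"
    if \<delta>: "\<delta> > 0" for \<delta>
  proof -
    obtain V where V: "open V" "p \<in> V"
      "\<And>w \<sigma>' t. w \<in> V \<Longrightarrow> \<sigma>' \<in> J \<Longrightarrow> line_form (leaf \<sigma>' t) (A w) = 0 \<Longrightarrow>
         \<sigma>' = \<sigma> \<and> (\<exists>s. \<bar>s - t0\<bar> < \<delta> \<and> line_form (leaf \<sigma> s) (A w) = 0)"
      using nearby_leaves[OF A(1) J \<delta> s(4)] by blast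
    obtain V' where V': "open V'" "p \<in> V'"
      "\<And>w. w \<in> V' \<Longrightarrow> Im_vec w = 0 \<Longrightarrow> \<exists>t. \<bar>t - t0\<bar> < \<delta> \<and> line_form (leaf \<sigma> t) (A w) = 0"
    proof (cases "Im_vec p = 0")
      case True
      then show ?thesis using nearby_leaf_of_real_point[OF A(1) True s(2,3) \<delta>] that by blast
    next
      case False
      have "open {w. Im_vec w \<noteq> 0}"
        unfolding Im_vec_def by (intro open_Collect_neq continuous_intros)
      then show ?thesis using that[of "{w. Im_vec w \<noteq> 0}"] False by blast
    qed
    have "open (V \<inter> V')" "p \<in> V \<inter> V'" using V V' by auto
    moreover have "\<exists>t. \<bar>t - t0\<bar> < \<delta> \<and> line_form (leaf \<sigma> t) (A w) = 0" if "w \<in> V \<inter> V' \<inter> X" for w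
    proof (cases "Im_vec w = 0")
      case True
      then show ?thesis using V'(3) that by blast
    next
      case False
      then show ?thesis using V(3) that Xmem by blast
    qed
    ultimately show ?thesis by blast
  qed
  have lines: "w \<in> X" if "line_form (leaf \<sigma> t) (A w) = 0" for t w using Xmem s(1) that by blast
  have "\<exists>U \<zeta>. p \<in> U \<and> U \<subseteq> ball p e \<and> holomorphic_coordinates \<zeta> U \<and> X \<inter> U = {x \<in> U. Im (\<zeta> x $ 1) = 0}"
    by (rule leaf_coordinates[OF A(1) \<sigma> s(2,3) lines near]) (use e(1) in auto)
  then obtain U \<zeta> where U: "p \<in> U" "U \<subseteq> ball p e" "holomorphic_coordinates \<zeta> U" "X \<inter> U = {x \<in> U. Im (\<zeta> x $ 1) = 0}"
    by blast
  have "regular_points X \<inter> U = X \<inter> U"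
    using e(2) U(2) by (auto simp: regular_iff)
  then show "\<exists>U \<zeta>. p \<in> U \<and> holomorphic_coordinates \<zeta> U \<and>
          regular_points (\<phi> -` web J) \<inter> U = {x \<in> U. Im (\<zeta> x $ 1) = 0}"
    unfolding X using U by blast
qed

lemma web_levi_flat_hypersurface:
  assumes "J \<in> {{-1}, {1}, {-1, 1}}"
  shows "singular_levi_flat_hypersurface (web J)"
  unfolding singular_levi_flat_hypersurface_def
  using web_analytic[OF assms] web_dimension[OF assms] web_levi_flat[of J] assms by auto

theorem corollary5p2:
  shows "(\<exists>H. singular_levi_flat_hypersurface H \<and> semialgebraic H \<and> \<not> real_algebraic H) \<and>
    (\<exists>X. real_algebraic X \<and> singular_levi_flat_hypersurface X \<and>
       irreducible_among real_algebraic X \<and>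
       \<not> irreducible_among real_analytic_subvariety X \<and>
       (\<exists>X1 X2. X = X1 \<union> X2 \<and> \<not> X1 \<subseteq> X2 \<and> \<not> X2 \<subseteq> X1 \<and>
          irreducible_among real_analytic_subvariety X1 \<and> has_real_codimension X1 1 \<and>
          irreducible_among real_analytic_subvariety X2 \<and> has_real_codimension X2 1))"
proof (intro conjI exI)
  show "singular_levi_flat_hypersurface (web {-1})" by (rule web_levi_flat_hypersurface) simp
  show "semialgebraic (web {-1})" by (rule web_semialgebraic) simp
  show "\<not> real_algebraic (web {-1})" by (rule web_not_algebraic)
  show "real_algebraic (web {-1, 1})" by (rule real_algebraic_web)
  show "singular_levi_flat_hypersurface (web {-1, 1})" by (rule web_levi_flat_hypersurface) simp
  show "irreducible_among real_algebraic (web {-1, 1})" by (rule web_algebraic_irreducible)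
  show "\<not> irreducible_among real_analytic_subvariety (web {-1, 1})" by (rule web_analytic_reducible)
  show "web {-1, 1} = web {-1} \<union> web {1}" by (rule web_union)
  show "\<not> web {-1} \<subseteq> web {1}" "\<not> web {1} \<subseteq> web {-1}" by (rule web_not_subset)+
  show "irreducible_among real_analytic_subvariety (web {-1})" "irreducible_among real_analytic_subvariety (web {1})"
    by (rule web_irreducible; simp)+
  show "has_real_codimension (web {-1}) 1" "has_real_codimension (web {1}) 1"
    by (rule web_dimension; simp)+
qed

end
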